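(* Let $(X,d,\mu)$ and $(Y,d_Y,\nu)$ be metric measure spaces. Let $\Omega\subset X$ be open and bounded, let $f\colon\Omega\to Y$ be injective and continuous with $\nu(f(\Omega))<\infty$, and suppose the following. (1) $(\Omega,d)$ is metric doubling, and there exist another Borel regular outer measure $\widetilde\mu$ on $\Omega$ with $\mu\le\widetilde\mu\ll\mu$ and a $\widetilde\mu$-measurable set $E\subset\Omega$ such that for some constant $C_\Omega>1$, $$\limsup_{r\to0}\frac{\mu(B(x,20r))}{\widetilde\mu(B(x,r))}<C_\Omega\quad\text{for every }x\in\Omega\setminus E,$$ and in $\Omega\setminus E$ there exist functions $Q(\cdot)\ge1$ and $R(\cdot)>0$ that are $\widetilde\mu$-measurable, with $Q(f^{-1}(\cdot))$ $\nu$-measurable, such that $$\limsup_{r\to0}\frac{\widetilde\mu(B(x,r))}{r^{Q(x)}}<R(x)\liminf_{r\to0}\frac{\nu(B(f(x),r))}{r^{Q(x)}}\quad\text{for every }x\in\Omega\setminus E.$$ (2) The exceptional set $E$ satisfies $$\operatorname{Mod}_1(\{\gamma\subset\Omega:\ \mathcal H^1(f(\gamma\cap E))>0\})=0,$$ and $h_f<\infty$ in $\Omega\setminus E$. (3) With $h_f^\vee:=\max\{h_f,1\}$, $$\frac{Q(\cdot)-1}{Q(\cdot)}\left(R(\cdot)h_f^\vee(\cdot)^{Q(\cdot)}\right)^{1/(Q(\cdot)-1)}\in L^1(\{Q>1\}\setminus E,\widetilde\mu),$$ and there is $H<\infty$ such that $h_f^\vee(x)R(x)\le H$ for all $x\in\{Q=1\}\setminus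 E$. Then $f\in D^{\mathrm{BV}}(\Omega;Y)$ and $f\in D^1(\{Q>1\}\cup E;Y)$.
   Context: Standing assumptions: $\mu$ and $\nu$ are Borel regular outer measures on the metric spaces $(X,d)$ and $(Y,d_Y)$, and every ball has finite measure. $B(x,r)$ denotes the open ball. $\widetilde\mu\ll\mu$ means that $\widetilde\mu$ is absolutely continuous with respect to $\mu$. $\mathcal H^1$ is the $1$-dimensional Hausdorff measure. $\{Q>1\}=\{x\in\Omega\setminus E: Q(x)>1\}$, and similarly for $\{Q=1\}$. Dilatation: for $f\colon\Omega\to Y$, $x\in\Omega$, $r>0$, $$L_f(x,r):=\sup\{d_Y(f(y),f(x)): y\in\Omega,\ d(y,x)\le r\},\qquad l_f(x,r):=\inf\{d_Y(f(y),f(x)): y\in\Omega,\ d(y,x)\ge r\},$$ $H_f(x,r):=L_f(x,r)/l_f(x,r)$ (interpreted as $\infty$ if the denominator is zero), and $h_f(x):=\liminf_{r\to0}H_f(x,r)$. Metric doubling: a metric space (or a subset, viewed as a metric space with the restricted metric) is metric doubling if there is $M\in\mathbb N$ such that every ball $B(x,r)$ in it can be covered by $M$ balls of radius $r/2$. Curves: all curves are continuous maps from compact intervals, rectifiable and arc-length parametrized, $\gamma\colon[0,\ell_\gamma]\to X$; $\int_\gamma g\,ds:=\int_0^{\ell_\gamma}g(\gamma(s))\,ds$ for Borel $g\ge 0$. The image of a curve is also denoted by $\gamma$. $1$-modulus: for a family $\Gamma$ of curves, $\operatorname{Mod}_1(\Gamma):=\inf\int_X\rho\,d\mu$, the infimum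 over all Borel $\rho\colon X\to[0,\infty]$ with $\int_\gamma\rho\,ds\ge1$ for every $\gamma\in\Gamma$. AM-modulus: a sequence $\{\rho_i\}_{i=1}^\infty$ of nonnegative Borel functions is AM-admissible for a family $\Gamma$ if $\liminf_{i\to\infty}\int_\gamma\rho_i\,ds\ge1$ for all $\gamma\in\Gamma$; $\operatorname{AM}(\Gamma):=\inf\{\liminf_{i\to\infty}\int_X\rho_i\,d\mu\}$, the infimum over all AM-admissible sequences. A property holds for AM-a.e. curve if it holds apart from a family $\Gamma$ with $\operatorname{AM}(\Gamma)=0$. $D^{\mathrm{BV}}$: for a continuous $f\colon\Omega\to Y$, $f\in D^{\mathrm{BV}}(\Omega;Y)$ if there is a sequence of nonnegative Borel functions $\{g_i\}_{i=1}^\infty$ that is bounded in $L^1(\Omega)$ (with respect to $\mu$) and satisfies $d_Y(f(\gamma(0)),f(\gamma(\ell_\gamma)))\le\liminf_{i\to\infty}\int_\gamma g_i\,ds$ for AM-a.e. curve $\gamma$ in $\Omega$. Upper gradient and Dirichlet space: for $H\subset X$ and $f\colon H\to Y$, a Borel function $g\colon H\to[0,\infty]$ is an upper gradient of $f$ in $H$ if $d_Y(f(\gamma(0)),f(\gamma(\ell_\gamma)))\le\int_\gamma g\,ds$ for every curve $\gamma$ in $H$. For $\mu$-measurable $H$, $D^1(H;Y)$ is the set of functions $f\colon H\to Y$ having an upper gradient $g\in L^1(H)$ (with respect to $\mu$). Here $f\in D^1(\{Q>1\}\cup E;Y)$ refers to the restriction of $f$ to $\{Q>1\}\cup E$. 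*)

theory Defs
  imports "HOL-Analysis.Analysis"
begin

section \<open>Borel regular outer measures\<close>

text \<open>
  An outer measure on a subset \<open>S\<close> of a metric space is a function on sets of which only the values
  on subsets of \<open>S\<close> matter. Measurability is Caratheodory's, i.e. membership in the
  \<^const>\<open>lambda_system\<close> relative to all subsets of \<open>S\<close>. Since
  \<^const>\<open>outer_measure_space\<close> includes monotonicity, it is no loss that
  \<^const>\<open>countably_subadditive\<close> only speaks about disjoint families.
\<close>

definition borel_regular_outer_measure :: "'a::metric_space set \<Rightarrow> ('a set \<Rightarrow> ennreal) \<Rightarrow> bool" where
  "borel_regular_outer_measure S m \<longleftrightarrow>
     outer_measure_space (Pow S) m \<and>
     sets (restrict_space borel S) \<subseteq> lambda_system S (Pow S) m \<and>
     (\<forall>A\<subseteq>S. \<exists>B\<in>sets (restrict_space borel S). A \<subseteq> B \<and> m B = m A)"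

definition caratheodory_measure :: "'a set \<Rightarrow> ('a set \<Rightarrow> ennreal) \<Rightarrow> 'a measure" where
  "caratheodory_measure S m = measure_of S (lambda_system S (Pow S) m) m"

lemma
  assumes "outer_measure_space (Pow S) m"
  shows space_caratheodory_measure: "space (caratheodory_measure S m) = S"
    and sets_caratheodory_measure: "sets (caratheodory_measure S m) = lambda_system S (Pow S) m"
    and emeasure_caratheodory_measure:
      "A \<in> lambda_system S (Pow S) m \<Longrightarrow> emeasure (caratheodory_measure S m) A = m A"
proof -
  have ms: "measure_space S (lambda_system S (Pow S) m) m"
    using assms by (rule sigma_algebra.caratheodory_lemma[OF sigma_algebra_Pow])
  then have sa: "sigma_algebra S (lambda_system S (Pow S) m)"
    by (simp add: measure_space_def)
  show "space (caratheodory_measure S m) = S"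
    and "sets (caratheodory_measure S m) = lambda_system S (Pow S) m"
    using sa by (simp_all add: caratheodory_measure_def sigma_algebra.space_measure_of_eq
        sigma_algebra.sets_measure_of_eq)
  show "emeasure (caratheodory_measure S m) A = m A" if "A \<in> lambda_system S (Pow S) m"
    unfolding caratheodory_measure_def using ms that
    by (intro emeasure_measure_of_sigma) (auto simp: measure_space_def)
qed

definition metric_measure :: "('a::metric_space set \<Rightarrow> ennreal) \<Rightarrow> bool" where
  "metric_measure m \<longleftrightarrow> borel_regular_outer_measure UNIV m \<and> (\<forall>x r. m (ball x r) < \<infinity>)"

text \<open>
  The one-dimensional Hausdorff outer measure. Boundedness of the covering sets is required because
  \<^const>\<open>diameter\<close> is only meaningful for bounded sets.
\<close>

definition hausdorff1_pre :: "real \<Rightarrow> 'a::metric_space set \<Rightarrow> ennreal" where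
  "hausdorff1_pre \<delta> S =
     (INF A\<in>{A :: nat \<Rightarrow> 'a set. S \<subseteq> (\<Union>i. A i) \<and> (\<forall>i. bounded (A i) \<and> diameter (A i) \<le> \<delta>)}.
        \<Sum>i. ennreal (diameter (A i)))"

definition hausdorff1 :: "'a::metric_space set \<Rightarrow> ennreal" where
  "hausdorff1 S = (SUP \<delta>\<in>{0<..}. hausdorff1_pre \<delta> S)"

section \<open>Metric doubling and dilatation\<close>

definition metric_doubling :: "'a::metric_space set \<Rightarrow> bool" where
  "metric_doubling S \<longleftrightarrow>
     (\<exists>M::nat. \<forall>x\<in>S. \<forall>r>0. \<exists>C\<subseteq>S. finite C \<and> card C \<le> M \<and> ball x r \<inter> S \<subseteq> (\<Union>c\<in>C. ball c (r / 2)))"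

definition upper_dil :: "'a::metric_space set \<Rightarrow> ('a \<Rightarrow> 'b::metric_space) \<Rightarrow> 'a \<Rightarrow> real \<Rightarrow> ennreal" where
  "upper_dil \<Omega> f x r = (SUP y\<in>{y \<in> \<Omega>. dist y x \<le> r}. ennreal (dist (f y) (f x)))"

definition lower_dil :: "'a::metric_space set \<Rightarrow> ('a \<Rightarrow> 'b::metric_space) \<Rightarrow> 'a \<Rightarrow> real \<Rightarrow> ennreal" where
  "lower_dil \<Omega> f x r = (INF y\<in>{y \<in> \<Omega>. dist y x \<ge> r}. ennreal (dist (f y) (f x)))"

text \<open>The case distinction matters because \<open>0 / 0 = 0\<close> in \<^typ>\<open>ennreal\<close>.\<close>

definition dil :: "'a::metric_space set \<Rightarrow> ('a \<Rightarrow> 'b::metric_space) \<Rightarrow> 'a \<Rightarrow> real \<Rightarrow> ennreal" where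
  "dil \<Omega> f x r = (if lower_dil \<Omega> f x r = 0 then \<infinity> else upper_dil \<Omega> f x r / lower_dil \<Omega> f x r)"

definition h_dil :: "'a::metric_space set \<Rightarrow> ('a \<Rightarrow> 'b::metric_space) \<Rightarrow> 'a \<Rightarrow> ennreal" where
  "h_dil \<Omega> f x = Liminf (at_right 0) (\<lambda>r. dil \<Omega> f x r)"

definition h_dil_max :: "'a::metric_space set \<Rightarrow> ('a \<Rightarrow> 'b::metric_space) \<Rightarrow> 'a \<Rightarrow> ennreal" where
  "h_dil_max \<Omega> f x = max (h_dil \<Omega> f x) 1"

section \<open>Curves\<close>

text \<open>
  A curve is a pair of its length \<open>l\<close> and a parametrization, of which only the values on
  \<open>{0..l}\<close> matter. All notions below are insensitive to the values elsewhere.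
\<close>

type_synonym 'a curve = "real \<times> (real \<Rightarrow> 'a)"

definition path_len :: "(real \<Rightarrow> 'a::metric_space) \<Rightarrow> real \<Rightarrow> real \<Rightarrow> ennreal" where
  "path_len \<gamma> a b =
     (SUP t\<in>{t. sorted t \<and> set t \<subseteq> {a..b}}.
        ennreal (\<Sum>i<length t - 1. dist (\<gamma> (t ! i)) (\<gamma> (t ! Suc i))))"

definition is_curve :: "'a::metric_space curve \<Rightarrow> bool" where
  "is_curve c \<longleftrightarrow>
     0 \<le> fst c \<and> continuous_on {0..fst c} (snd c) \<and>
     (\<forall>s t. 0 \<le> s \<and> s \<le> t \<and> t \<le> fst c \<longrightarrow> path_len (snd c) s t = ennreal (t - s))"

definition curve_image :: "'a curve \<Rightarrow> 'a set" where
  "curve_image c = snd c ` {0..fst c}"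

definition curves_in :: "'a::metric_space set \<Rightarrow> 'a curve set" where
  "curves_in S = {c. is_curve c \<and> curve_image c \<subseteq> S}"

definition curve_integral :: "('a \<Rightarrow> ennreal) \<Rightarrow> 'a curve \<Rightarrow> ennreal" where
  "curve_integral g c = (\<integral>\<^sup>+s\<in>{0..fst c}. g (snd c s) \<partial>lborel)"

definition end_dist :: "('a \<Rightarrow> 'b::metric_space) \<Rightarrow> 'a curve \<Rightarrow> ennreal" where
  "end_dist f c = ennreal (dist (f (snd c 0)) (f (snd c (fst c))))"

section \<open>Moduli\<close>

definition Mod1 :: "('a::metric_space set \<Rightarrow> ennreal) \<Rightarrow> 'a curve set \<Rightarrow> ennreal" where
  "Mod1 \<mu> \<Gamma> =
     (INF \<rho>\<in>{\<rho>. \<rho> \<in> borel_measurable borel \<and> (\<forall>c\<in>\<Gamma>. 1 \<le> curve_integral \<rho> c)}.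
        \<integral>\<^sup>+x. \<rho> x \<partial>caratheodory_measure UNIV \<mu>)"

definition AM_admissible :: "'a::metric_space curve set \<Rightarrow> (nat \<Rightarrow> 'a \<Rightarrow> ennreal) \<Rightarrow> bool" where
  "AM_admissible \<Gamma> \<rho> \<longleftrightarrow>
     (\<forall>i. \<rho> i \<in> borel_measurable borel) \<and> (\<forall>c\<in>\<Gamma>. 1 \<le> liminf (\<lambda>i. curve_integral (\<rho> i) c))"

definition AM :: "('a::metric_space set \<Rightarrow> ennreal) \<Rightarrow> 'a curve set \<Rightarrow> ennreal" where
  "AM \<mu> \<Gamma> =
     (INF \<rho>\<in>{\<rho>. AM_admissible \<Gamma> \<rho>}. liminf (\<lambda>i. \<integral>\<^sup>+x. \<rho> i x \<partial>caratheodory_measure UNIV \<mu>))"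

section \<open>The class D-BV and the Dirichlet space\<close>

definition in_DBV ::
  "('a::metric_space set \<Rightarrow> ennreal) \<Rightarrow> 'a set \<Rightarrow> ('a \<Rightarrow> 'b::metric_space) \<Rightarrow> bool" where
  "in_DBV \<mu> \<Omega> f \<longleftrightarrow>
     continuous_on \<Omega> f \<and>
     (\<exists>g :: nat \<Rightarrow> 'a \<Rightarrow> ennreal.
        (\<forall>i. g i \<in> borel_measurable (restrict_space borel \<Omega>)) \<and>
        (SUP i. \<integral>\<^sup>+x\<in>\<Omega>. g i x \<partial>caratheodory_measure UNIV \<mu>) < \<infinity> \<and>
        (\<exists>\<Gamma>. AM \<mu> \<Gamma> = 0 \<and>
           (\<forall>c\<in>curves_in \<Omega> - \<Gamma>. end_dist f c \<le> liminf (\<lambda>i. curve_integral (g i) c))))"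

definition upper_gradient ::
  "'a::metric_space set \<Rightarrow> ('a \<Rightarrow> 'b::metric_space) \<Rightarrow> ('a \<Rightarrow> ennreal) \<Rightarrow> bool" where
  "upper_gradient H f g \<longleftrightarrow>
     g \<in> borel_measurable (restrict_space borel H) \<and>
     (\<forall>c\<in>curves_in H. end_dist f c \<le> curve_integral g c)"

definition in_D1 ::
  "('a::metric_space set \<Rightarrow> ennreal) \<Rightarrow> 'a set \<Rightarrow> ('a \<Rightarrow> 'b::metric_space) \<Rightarrow> bool" where
  "in_D1 \<mu> H f \<longleftrightarrow>
     H \<in> sets (caratheodory_measure UNIV \<mu>) \<and>
     (\<exists>g. upper_gradient H f g \<and> (\<integral>\<^sup>+x\<in>H. g x \<partial>caratheodory_measure UNIV \<mu>) < \<infinity>)"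

end

theory Submission
  imports Defs
begin

text \<open>
  Around a point \<open>x\<close> of \<open>\<Omega> - E\<close> there are arbitrarily small good radii \<open>r\<close>, at which the dilatation is
  comparable to \<open>h\<^sub>f(x)\<close>. Choosing balls of good radius greedily, dyadic band by dyadic band, one covers
  any set of such points by balls \<open>B(x\<^sub>k, r\<^sub>k)\<close> for which the balls of radius \<open>l\<^sub>f(x\<^sub>k, r\<^sub>k) / 2\<close> around
  \<open>f(x\<^sub>k)\<close> have overlap bounded by the doubling constant: centres of different bands lie outside each
  other's balls. The function that is the sum of \<open>2 L\<^sub>f(x\<^sub>k, r\<^sub>k) / r\<^sub>k\<close> over the balls \<open>B(x\<^sub>k, 2 r\<^sub>k)\<close>
  controls the length of the part of \<open>f \<circ> \<gamma>\<close> over the covered set, and its integral is at most a constant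
  times the \<open>\<nu>\<close>-measure of a neighbourhood of the image wherever
  \<open>L\<^sub>f(x\<^sub>k, r\<^sub>k) \<mu>(B(x\<^sub>k, 2 r\<^sub>k)) / r\<^sub>k\<close> is at most a constant \<open>K\<close> times \<open>\<nu>(B(f(x\<^sub>k), l\<^sub>f(x\<^sub>k, r\<^sub>k) / 2))\<close>.

  For \<open>Q = 1\<close> this bound holds directly. For \<open>Q > 1\<close>, Young's inequality shows that it holds unless the
  lower Lipschitz constant \<open>lip f(x)\<close> is at most twice the integrable function \<open>\<phi>\<close> of hypothesis (3).
  Where \<open>lip f\<close> is finite it is an upper gradient along curves, and the covering argument makes it
  integrable over the points with the bound; where \<open>lip f = \<infinity>\<close> and \<open>Q > 1\<close> the constant \<open>K\<close> can be
  taken arbitrarily small, so these points do not contribute on curves of finite weight. Only the points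
  with \<open>Q = 1\<close> require a genuine sequence of weights, which is the difference between the two conclusions.
\<close>

section \<open>Selection of balls\<close>

text \<open>Good radii form, at each point, only some sequence tending to 0, and nothing bounds the
  overlap of the doubled balls in the domain. The overlap is therefore counted in the target: at a
  good radius \<open>r\<close> all points outside \<open>B(x, r)\<close> are sent at least
  \<open>l\<close> away from \<open>f x\<close>, so two image balls of radius \<open>l / 2\<close>
  can meet only if one centre lies in the other's ball; the selection permits this within a single
  dyadic band only, where doubling of \<open>\<Omega>\<close> counts. The constants 20 and 5 come
  from one rescaling: hypothesis (1) at radius \<open>r / 10\<close> in the domain and
  \<open>l / 2\<close> in the target bounds \<open>\<mu>(B(x, 2 r))\<close> and produces the
  quotient \<open>(l / 2) / (r / 10) = 5 l / r\<close>. The sets of points involved and their images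
  are not known to be measurable. Hence the estimates use outer measures, Borel functions enter as
  majorants built from Borel hulls, and \<open>f \<circ> \<gamma>\<close> is replaced by its
  distance from the starting point, a real function. Exceptional curves are not removed; they
  receive infinite weight.\<close>

lemma separated_card_le_cover:
  fixes F K :: "'a::metric_space set"
  assumes K: "finite K" and cov: "F \<subseteq> (\<Union>k\<in>K. ball k (e / 2))"
    and sep: "\<And>x y. x \<in> F \<Longrightarrow> y \<in> F \<Longrightarrow> x \<noteq> y \<Longrightarrow> e \<le> dist x y"
  shows "finite F \<and> card F \<le> card K"
proof -
  have "\<forall>x\<in>F. \<exists>k\<in>K. dist k x < e / 2"
    using cov unfolding subset_iff UN_iff mem_ball by blast
  then obtain g where g: "\<And>x. x \<in> F \<Longrightarrow> g x \<in> K \<and> dist (g x) x < e / 2"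
    by metis
  have "inj_on g F"
  proof (rule inj_onI, rule ccontr)
    fix x y assume xy: "x \<in> F" "y \<in> F" "g x = g y" "x \<noteq> y"
    have "dist x y \<le> dist (g x) x + dist (g x) y"
      by (rule dist_triangle3)
    with g[OF xy(1)] g[OF xy(2)] xy sep[OF xy(1,2,4)] show False
      by simp
  qed
  moreover have "g ` F \<subseteq> K"
    using g by auto
  ultimately show ?thesis
    using K by (meson card_inj_on_le inj_on_finite)
qed

lemma totally_bounded_iff_balls:
  "totally_bounded S \<longleftrightarrow> (\<forall>e>0. \<exists>K. finite K \<and> S \<subseteq> (\<Union>x\<in>K. ball x e))"
  by (simp add: totally_bounded_metric ball_def)

text \<open>Total boundedness caps the cardinality of separated subsets, so one of greatest
  cardinality exists; a point outside all its balls could be added to it.\<close>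

lemma maximal_separated_subset:
  fixes S :: "'a::metric_space set"
  assumes "totally_bounded S" and e: "0 < e"
  obtains D where "finite D" "D \<subseteq> S"
    "\<And>x y. x \<in> D \<Longrightarrow> y \<in> D \<Longrightarrow> x \<noteq> y \<Longrightarrow> e \<le> dist x y" "S \<subseteq> (\<Union>x\<in>D. ball x e)"
proof -
  have e2: "0 < e / 2" using e by simp
  from assms(1)[unfolded totally_bounded_iff_balls, rule_format, OF e2]
  obtain K where K: "finite K" "S \<subseteq> (\<Union>x\<in>K. ball x (e / 2))"
    by (elim exE conjE)
  define P where "P D \<longleftrightarrow> D \<subseteq> S \<and> (\<forall>x\<in>D. \<forall>y\<in>D. x \<noteq> y \<longrightarrow> e \<le> dist x y)" for D
  have bound: "finite D \<and> card D \<le> card K" if "P D" for D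
  proof (rule separated_card_le_cover[OF K(1)])
    show "D \<subseteq> (\<Union>k\<in>K. ball k (e / 2))" "\<And>x y. x \<in> D \<Longrightarrow> y \<in> D \<Longrightarrow> x \<noteq> y \<Longrightarrow> e \<le> dist x y"
      using that K(2) unfolding P_def by blast+
  qed
  have "\<exists>D. P D \<and> (\<forall>D'. P D' \<longrightarrow> card D' \<le> card D)"
  proof (rule Lattices_Big.ex_has_greatest_nat)
    show "P {}" by (simp add: P_def)
    show "\<forall>D. P D \<longrightarrow> card D < Suc (card K)"
      using bound by (simp add: less_Suc_eq_le)
  qed
  then obtain D where D: "P D" and max: "\<And>D'. P D' \<Longrightarrow> card D' \<le> card D"
    by blast
  have "S \<subseteq> (\<Union>x\<in>D. ball x e)"
  proof
    fix z assume z: "z \<in> S"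
    show "z \<in> (\<Union>x\<in>D. ball x e)"
    proof (rule ccontr)
      assume "z \<notin> (\<Union>x\<in>D. ball x e)"
      then have far: "\<And>x. x \<in> D \<Longrightarrow> e \<le> dist x z"
        by (meson UN_I mem_ball not_le)
      then have "P (insert z D)"
        using D z by (auto simp: P_def dist_commute)
      moreover have "z \<notin> D"
        using far[of z] e by auto
      ultimately show False
        using max[of "insert z D"] bound[OF D] by simp
    qed
  qed
  with D bound[OF D] show ?thesis
    by (intro that[of D]) (auto simp: P_def)
qed

section \<open>Dyadic bands of radii and the greedy choice of balls\<close>

definition dyadic_band :: "real \<Rightarrow> nat \<Rightarrow> bool" where
  "dyadic_band r m \<longleftrightarrow> (1/2)^Suc m < r \<and> r \<le> (1/2)^m"

lemma dyadic_band_ex: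
  assumes "0 < r" "r < 1"
  shows "\<exists>m. dyadic_band r m"
proof -
  obtain n where ex: "(1/2::real)^n < r"
    using real_arch_pow_inv[of r "1/2"] assms by auto
  define k where "k = (LEAST n. (1/2::real)^n < r)"
  have k: "(1/2::real)^k < r" unfolding k_def using ex by (rule LeastI)
  have "k \<noteq> 0" using k assms by (intro notI) simp
  then obtain m where m: "k = Suc m" by (cases k) auto
  have "\<not> (1/2::real)^m < r"
    using not_less_Least[of m "\<lambda>n. (1/2::real)^n < r"] m by (simp add: k_def)
  with k m show ?thesis by (auto simp: dyadic_band_def not_less)
qed

lemma dyadic_band_less:
  assumes "dyadic_band r i" "dyadic_band r' j" "i < j"
  shows "r' < r"
proof -
  have "(1/2::real)^j \<le> (1/2)^Suc i"
    using assms by (intro power_decreasing) auto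
  with assms show ?thesis unfolding dyadic_band_def by linarith
qed

lemma dyadic_band_unique: "dyadic_band r i \<Longrightarrow> dyadic_band r j \<Longrightarrow> i = j"
  by (metis dyadic_band_less less_irrefl nat_neq_iff)

text \<open>What the greedy choice guarantees for two centres: they avoid each other's full balls,
  or they share a band and are only as far apart as its lower end, which is at least half of either
  radius.\<close>

definition dyadic_separated :: "('a::metric_space \<Rightarrow> real) \<Rightarrow> 'a \<Rightarrow> 'a \<Rightarrow> bool" where
  "dyadic_separated r x y \<longleftrightarrow> max (r x) (r y) \<le> dist x y \<or>
     (\<exists>m. dyadic_band (r x) m \<and> dyadic_band (r y) m \<and> (1/2)^Suc m \<le> dist x y)"

text \<open>
  The greedy choice runs through the radii in decreasing order of magnitude; this is what makes
  centres of different bands avoid each other's full balls, not just a fraction of them.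
\<close>

lemma ball_selection:
  fixes A :: "'a::metric_space set" and r :: "'a \<Rightarrow> real"
  assumes tb: "totally_bounded A" and r: "\<And>x. x \<in> A \<Longrightarrow> 0 < r x \<and> r x < 1"
  obtains D where "countable D" "D \<subseteq> A" "A \<subseteq> (\<Union>x\<in>D. ball x (r x))"
    "\<And>x y. x \<in> D \<Longrightarrow> y \<in> D \<Longrightarrow> x \<noteq> y \<Longrightarrow> dyadic_separated r x y"
proof -
  \<comment> \<open>A net is fixed as a function of the set and the mesh, because the recursion for
    \<open>U\<close> needs a term.\<close>
  define net where "net S e = (SOME D. finite D \<and> D \<subseteq> S \<and>
    (\<forall>x\<in>D. \<forall>y\<in>D. x \<noteq> y \<longrightarrow> e \<le> dist x y) \<and> S \<subseteq> (\<Union>x\<in>D. ball x e))" for S :: "'a set" and e :: real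
  have net: "finite (net S e) \<and> net S e \<subseteq> S \<and> (\<forall>x\<in>net S e. \<forall>y\<in>net S e. x \<noteq> y \<longrightarrow> e \<le> dist x y) \<and>
      S \<subseteq> (\<Union>x\<in>net S e. ball x e)" if S: "S \<subseteq> A" and e: "0 < e" for S e
  proof -
    have "totally_bounded S"
      using tb S unfolding totally_bounded_iff_balls by (meson order_trans)
    then have "\<exists>D. finite D \<and> D \<subseteq> S \<and> (\<forall>x\<in>D. \<forall>y\<in>D. x \<noteq> y \<longrightarrow> e \<le> dist x y) \<and>
        S \<subseteq> (\<Union>x\<in>D. ball x e)"
      by (rule maximal_separated_subset[OF _ e]) blast
    then show ?thesis
      unfolding net_def by (rule someI_ex)
  qed
  define band where "band m = {x\<in>A. dyadic_band (r x) m}" for m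
  \<comment> \<open>\<open>U m\<close> is the region covered by the balls from the bands before
    \<open>m\<close>; the new centres of band \<open>m\<close> are taken outside it.\<close>
  define U where "U = rec_nat {} (\<lambda>m V. V \<union> (\<Union>x\<in>net (band m - V) ((1/2)^Suc m). ball x (r x)))"
  define N where "N m = net (band m - U m) ((1/2)^Suc m)" for m
  have U_Suc: "U (Suc m) = U m \<union> (\<Union>x\<in>N m. ball x (r x))" for m
    by (simp add: U_def N_def)
  have U_eq: "U m = (\<Union>i<m. \<Union>x\<in>N i. ball x (r x))" for m
  proof (induction m)
    case 0 show ?case by (simp add: U_def)
  next
    case (Suc m) then show ?case unfolding U_Suc lessThan_Suc by auto
  qed
  have N: "finite (N m)" "N m \<subseteq> band m - U m"
    "\<And>x y. x \<in> N m \<Longrightarrow> y \<in> N m \<Longrightarrow> x \<noteq> y \<Longrightarrow> (1/2)^Suc m \<le> dist x y"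
    "band m - U m \<subseteq> (\<Union>x\<in>N m. ball x ((1/2)^Suc m))" for m
  proof -
    have "band m - U m \<subseteq> A" "(0::real) < (1/2)^Suc m"
      by (auto simp: band_def)
    note n = net[OF this, folded N_def]
    show "finite (N m)" "N m \<subseteq> band m - U m"
      "band m - U m \<subseteq> (\<Union>x\<in>N m. ball x ((1/2)^Suc m))"
      using n by simp_all
    show "(1/2)^Suc m \<le> dist x y" if "x \<in> N m" "y \<in> N m" "x \<noteq> y" for x y
      using n that by blast
  qed
  \<comment> \<open>The later centre avoids the ball of the earlier one and has the smaller radius,
    so one inequality bounds the distance by both radii.\<close>
  have nested: "max (r x) (r y) \<le> dist x y" if xy: "x \<in> N i" "y \<in> N j" "i < j" for x y i j
  proof -
    have "y \<notin> U j" "y \<in> band j" "x \<in> band i"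
      using N(2) xy by blast+
    then have "y \<notin> ball x (r x)" "dyadic_band (r x) i" "dyadic_band (r y) j"
      using xy unfolding U_eq band_def by blast+
    with dyadic_band_less[of "r x" i "r y" j] xy show ?thesis by simp
  qed
  show ?thesis
  proof (rule that[of "\<Union>m. N m"])
    show "countable (\<Union>m. N m)"
      using N(1) by (auto intro: countable_finite)
    show "(\<Union>m. N m) \<subseteq> A"
      using N(2) by (auto simp: band_def)
    show "A \<subseteq> (\<Union>x\<in>(\<Union>m. N m). ball x (r x))"
    proof
      fix z assume z: "z \<in> A"
      then obtain m where "dyadic_band (r z) m"
        using dyadic_band_ex r by blast
      then have m: "z \<in> band m" using z by (simp add: band_def)
      show "z \<in> (\<Union>x\<in>(\<Union>m. N m). ball x (r x))"
      proof (cases "z \<in> U m")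
        case True then show ?thesis unfolding U_eq by auto
      next
        case False
        then obtain x where x: "x \<in> N m" "dist x z < (1/2)^Suc m"
          using N(4)[of m] m by auto
        \<comment> \<open>A net of this mesh is fine enough, since every radius of band
          \<open>m\<close> exceeds the mesh.\<close>
        moreover have "(1/2)^Suc m < r x"
          using N(2)[of m] x(1) by (auto simp: band_def dyadic_band_def)
        ultimately show ?thesis by (auto simp: intro!: bexI[of _ x])
      qed
    qed
    fix x y assume "x \<in> (\<Union>m. N m)" "y \<in> (\<Union>m. N m)" and ne: "x \<noteq> y"
    then obtain i j where ij: "x \<in> N i" "y \<in> N j" by auto
    consider "i < j" | "j < i" | "i = j" by linarith
    then show "dyadic_separated r x y"
    proof cases
      case 1 then show ?thesis using nested ij unfolding dyadic_separated_def by blast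
    next
      case 2 then show ?thesis using nested[OF ij(2,1)] unfolding dyadic_separated_def by (simp add: dist_commute max.commute)
    next
      case 3
      then have "(1/2)^Suc i \<le> dist x y" using N(3) ij ne by blast
      moreover have "dyadic_band (r x) i" "dyadic_band (r y) i"
        using N(2)[of i] ij 3 by (auto simp: band_def)
      ultimately show ?thesis unfolding dyadic_separated_def by blast
    qed
  qed
qed

text \<open>The radius \<open>r / 4\<close> fits the overlap count: points of one band in a ball of
  radius \<open>(1/2)^m\<close> are \<open>(1/2)^Suc m\<close> apart, and
  \<open>separated_card_le_cover\<close> wants balls of half that distance.\<close>

lemma metric_doubling_iterate:
  fixes S :: "'a::metric_space set"
  assumes "metric_doubling S"
  obtains N where "\<And>x r. x \<in> S \<Longrightarrow> 0 < r \<Longrightarrow>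
    \<exists>C\<subseteq>S. finite C \<and> card C \<le> N \<and> ball x r \<inter> S \<subseteq> (\<Union>c\<in>C. ball c (r / 4))"
proof -
  from assms obtain M where M: "\<And>x r. x \<in> S \<Longrightarrow> 0 < r \<Longrightarrow>
    \<exists>C\<subseteq>S. finite C \<and> card C \<le> M \<and> ball x r \<inter> S \<subseteq> (\<Union>c\<in>C. ball c (r / 2))"
    unfolding metric_doubling_def by blast
  show ?thesis
  proof (rule that[of "M * M"])
    fix x and r :: real assume x: "x \<in> S" and r: "0 < r"
    from M[OF x r] obtain C where C: "C \<subseteq> S" "finite C" "card C \<le> M" "ball x r \<inter> S \<subseteq> (\<Union>c\<in>C. ball c (r / 2))"
      by blast
    have "\<forall>c\<in>C. \<exists>D\<subseteq>S. finite D \<and> card D \<le> M \<and> ball c (r / 2) \<inter> S \<subseteq> (\<Union>d\<in>D. ball d (r / 2 / 2))"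
      using M[of _ "r / 2"] C(1) r by (auto simp: subset_iff)
    from bchoice[OF this] obtain D where D: "\<And>c. c \<in> C \<Longrightarrow> D c \<subseteq> S \<and> finite (D c) \<and> card (D c) \<le> M \<and>
        ball c (r / 2) \<inter> S \<subseteq> (\<Union>d\<in>D c. ball d (r / 2 / 2))"
      by blast
    have "card (\<Union>c\<in>C. D c) \<le> (\<Sum>c\<in>C. card (D c))"
      by (rule card_UN_le[OF C(2)])
    also have "\<dots> \<le> of_nat (card C) * M"
      using D by (intro sum_bounded_above) auto
    also have "\<dots> \<le> M * M" using C(3) by simp
    finally have "card (\<Union>c\<in>C. D c) \<le> M * M" .
    moreover have "ball x r \<inter> S \<subseteq> (\<Union>c\<in>(\<Union>c\<in>C. D c). ball c (r / 4))"
      using C(4) D by fastforce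
    ultimately show "\<exists>C\<subseteq>S. finite C \<and> card C \<le> M * M \<and> ball x r \<inter> S \<subseteq> (\<Union>c\<in>C. ball c (r / 4))"
      using D C(2) by (intro exI[of _ "\<Union>c\<in>C. D c"]) auto
  qed
qed

text \<open>Halving the balls can be iterated because \<open>metric_doubling\<close> keeps the new
  centres in \<open>S\<close>.\<close>

lemma metric_doubling_imp_totally_bounded:
  fixes S :: "'a::metric_space set"
  assumes md: "metric_doubling S" and b: "bounded S"
  shows "totally_bounded S"
proof (cases "S = {}")
  case True then show ?thesis by (auto simp: totally_bounded_iff_balls)
next
  case False
  then obtain x0 where x0: "x0 \<in> S" by auto
  from b obtain b where b: "0 < b" "S \<subseteq> ball x0 b"
    using bounded_subset_ballD by blast
  have *: "\<exists>C. finite C \<and> C \<subseteq> S \<and> S \<subseteq> (\<Union>c\<in>C. ball c (b * (1/2)^n))" for n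
  proof (induction n)
    case 0
    show ?case using x0 b by (intro exI[of _ "{x0}"]) auto
  next
    case (Suc n)
    then obtain C where C: "finite C" "C \<subseteq> S" "S \<subseteq> (\<Union>c\<in>C. ball c (b * (1/2)^n))" by blast
    have "\<forall>c\<in>C. \<exists>D\<subseteq>S. finite D \<and> ball c (b * (1/2)^n) \<inter> S \<subseteq> (\<Union>d\<in>D. ball d (b * (1/2)^n / 2))"
    proof
      fix c assume "c \<in> C"
      then have "c \<in> S" "0 < b * (1/2)^n" using C b by auto
      then show "\<exists>D\<subseteq>S. finite D \<and> ball c (b * (1/2)^n) \<inter> S \<subseteq> (\<Union>d\<in>D. ball d (b * (1/2)^n / 2))"
        using md unfolding metric_doubling_def by blast
    qed
    from bchoice[OF this] obtain D where D: "\<And>c. c \<in> C \<Longrightarrow> D c \<subseteq> S \<and> finite (D c) \<and>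
        ball c (b * (1/2)^n) \<inter> S \<subseteq> (\<Union>d\<in>D c. ball d (b * (1/2)^n / 2))"
      by blast
    have "S \<subseteq> (\<Union>c\<in>(\<Union>c\<in>C. D c). ball c (b * (1/2)^n / 2))"
    proof
      fix z assume z: "z \<in> S"
      then obtain c where c: "c \<in> C" "z \<in> ball c (b * (1/2)^n)" using C(3) by blast
      with D[OF c(1)] z obtain d where "d \<in> D c" "z \<in> ball d (b * (1/2)^n / 2)" by blast
      with c(1) show "z \<in> (\<Union>c\<in>(\<Union>c\<in>C. D c). ball c (b * (1/2)^n / 2))" by blast
    qed
    then show ?case using D C by (intro exI[of _ "\<Union>c\<in>C. D c"]) auto
  qed
  show ?thesis unfolding totally_bounded_iff_balls
  proof safe
    fix e :: real assume e: "0 < e"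
    obtain n where n: "(1/2::real)^n < e / b"
      using real_arch_pow_inv[of "e / b" "1/2"] e b by auto
    then have "b * (1/2)^n \<le> e" using b by (simp add: field_simps)
    moreover obtain C where "finite C" "S \<subseteq> (\<Union>c\<in>C. ball c (b * (1/2)^n))" using *[of n] by blast
    moreover have "(\<Union>c\<in>C. ball c (b * (1/2)^n)) \<subseteq> (\<Union>c\<in>C. ball c e)"
      using calculation(1) by (intro UN_mono subset_ball) auto
    ultimately show "\<exists>k. finite k \<and> S \<subseteq> (\<Union>x\<in>k. ball x e)"
      by blast
  qed
qed

text \<open>\<open>near\<close> excludes the first alternative of \<open>dyadic_separated\<close>.
  So all points of \<open>K\<close> share one band \<open>m\<close>, lie in one ball of radius
  \<open>(1/2)^m\<close> and are \<open>(1/2)^Suc m\<close> apart. A single point determines no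
  band; there \<open>1 \<le> N\<close> is used.\<close>

lemma overlap_card_le:
  fixes K :: "'a::metric_space set"
  assumes cov: "\<And>x \<rho>. x \<in> S \<Longrightarrow> 0 < \<rho> \<Longrightarrow>
      \<exists>C\<subseteq>S. finite C \<and> card C \<le> N \<and> ball x \<rho> \<inter> S \<subseteq> (\<Union>c\<in>C. ball c (\<rho> / 4))"
    and K: "K \<subseteq> S"
    and near: "\<And>x y. x \<in> K \<Longrightarrow> y \<in> K \<Longrightarrow> x \<noteq> y \<Longrightarrow> dist x y < max (r x) (r y)"
    and sep: "\<And>x y. x \<in> K \<Longrightarrow> y \<in> K \<Longrightarrow> x \<noteq> y \<Longrightarrow> dyadic_separated r x y"
    and one: "1 \<le> N"
  shows "finite K \<and> card K \<le> N"
proof (cases "\<exists>x\<in>K. \<exists>y\<in>K. x \<noteq> y")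
  case False
  then have "K = {} \<or> (\<exists>x. K = {x})" by blast
  then show ?thesis using one by auto
next
  case True
  then obtain x y where xy: "x \<in> K" "y \<in> K" "x \<noteq> y" by blast
  from near[OF xy] sep[unfolded dyadic_separated_def, OF xy] obtain m where m: "dyadic_band (r x) m" by auto
  have band: "dyadic_band (r z) m" if "z \<in> K" for z
  proof (cases "z = x")
    case False
    with near[OF xy(1) that] sep[unfolded dyadic_separated_def, OF xy(1) that] obtain m' where "dyadic_band (r x) m'" "dyadic_band (r z) m'"
      by fastforce
    then show ?thesis using dyadic_band_unique[OF m] by blast
  qed (use m in simp)
  have far: "(1/2)^Suc m \<le> dist z w" if "z \<in> K" "w \<in> K" "z \<noteq> w" for z w
    using near[OF that] sep[unfolded dyadic_separated_def, OF that] dyadic_band_unique[OF band[OF that(1)]] by force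
  have "K \<subseteq> ball x ((1/2)^m) \<inter> S"
  proof
    fix z assume z: "z \<in> K"
    have "dist x z < (1/2)^m"
    proof (cases "z = x")
      case False
      with near[OF xy(1) z] band[OF z] m show ?thesis by (auto simp: dyadic_band_def)
    qed simp
    then show "z \<in> ball x ((1/2)^m) \<inter> S" using z K by auto
  qed
  moreover obtain C where C: "finite C" "card C \<le> N" "ball x ((1/2)^m) \<inter> S \<subseteq> (\<Union>c\<in>C. ball c ((1/2)^m / 4))"
    using cov[of x "(1/2)^m"] xy K by auto
  moreover have "(1/2::real)^m / 4 = (1/2)^Suc m / 2" by simp
  ultimately have "finite K \<and> card K \<le> card C"
    by (intro separated_card_le_cover[of C K "(1/2)^Suc m"]) (auto simp del: power_Suc intro: far)
  then show ?thesis using C by auto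
qed

section \<open>Images of subsets of the line\<close>

text \<open>The index set \<open>I\<close> allows finite selections to be treated as sequences
  without repeating a centre.\<close>

lemma ball_selection_seq:
  fixes A :: "'a::metric_space set" and r :: "'a \<Rightarrow> real"
  assumes "totally_bounded A" "\<And>x. x \<in> A \<Longrightarrow> 0 < r x \<and> r x < 1"
  obtains x :: "nat \<Rightarrow> 'a" and I :: "nat set" where "inj_on x I" "x ` I \<subseteq> A"
    "A \<subseteq> (\<Union>i\<in>I. ball (x i) (r (x i)))"
    "\<And>i j. i \<in> I \<Longrightarrow> j \<in> I \<Longrightarrow> i \<noteq> j \<Longrightarrow> dyadic_separated r (x i) (x j)"
proof -
  obtain D where D: "countable D" "D \<subseteq> A" "A \<subseteq> (\<Union>x\<in>D. ball x (r x))"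
    "\<And>x y. x \<in> D \<Longrightarrow> y \<in> D \<Longrightarrow> x \<noteq> y \<Longrightarrow> dyadic_separated r x y"
    using ball_selection[of A r, OF assms(1), OF assms(2)] that by metis
  from countableE_bij[OF D(1)] obtain x :: "nat \<Rightarrow> 'a" and I where x: "bij_betw x I D" .
  then have im: "x ` I = D" and inj: "inj_on x I"
    by (auto simp: bij_betw_def)
  show ?thesis
  proof (rule that[OF inj])
    show "x ` I \<subseteq> A" "A \<subseteq> (\<Union>i\<in>I. ball (x i) (r (x i)))"
      using D(2,3) unfolding im[symmetric] by auto
    show "dyadic_separated r (x i) (x j)" if "i \<in> I" "j \<in> I" "i \<noteq> j" for i j
      using D(4)[of "x i" "x j"] that im inj by (auto dest: inj_onD)
  qed
qed

text \<open>Either alternative keeps the centres at least half of the larger radius apart, and the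
  two quarter radii add up to no more.\<close>

lemma dyadic_separated_quarter_balls:
  assumes "dyadic_separated r x y" "0 < r x" "0 < r y"
  shows "ball x (r x / 4) \<inter> ball y (r y / 4) = {}"
proof -
  have "max (r x) (r y) / 2 \<le> dist x y"
    using assms unfolding dyadic_separated_def dyadic_band_def by (auto simp: max_def)
  moreover have "r x / 4 + r y / 4 \<le> max (r x) (r y) / 2"
    by (simp add: max_def)
  ultimately have "r x / 4 + r y / 4 \<le> dist x y" by linarith
  then show ?thesis by (rule disjoint_ballI)
qed

text \<open>Images of arbitrary subsets of the line are measured below, hence an outer
  measure.\<close>

abbreviation leb_outer :: "real set \<Rightarrow> ennreal" where
  "leb_outer \<equiv> outer_measure_of lborel"

lemma leb_outer_hull: obtains B where "B \<in> sets lborel" "A \<subseteq> B" "leb_outer A = emeasure lborel B"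
  using outer_measure_of_attain[of A lborel] by auto

lemma leb_outer_le: "A \<subseteq> B \<Longrightarrow> B \<in> sets lborel \<Longrightarrow> leb_outer A \<le> emeasure lborel B"
  using outer_measure_of_mono[of A B lborel] by simp

lemma leb_outer_UN_le: "leb_outer (\<Union>n. A n) \<le> (\<Sum>n. leb_outer (A n))" for A :: "nat \<Rightarrow> real set"
proof -
  have "\<forall>n. \<exists>B\<in>sets lborel. A n \<subseteq> B \<and> leb_outer (A n) = emeasure lborel B"
    using leb_outer_hull by metis
  then obtain B where B: "\<And>n. B n \<in> sets lborel" "\<And>n. A n \<subseteq> B n" "\<And>n. leb_outer (A n) = emeasure lborel (B n)"
    by metis
  have "leb_outer (\<Union>n. A n) \<le> emeasure lborel (\<Union>n. B n)"
    using B by (intro leb_outer_le) auto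
  also have "\<dots> \<le> (\<Sum>n. emeasure lborel (B n))"
    using B by (intro emeasure_subadditive_countably) auto
  finally show ?thesis using B by simp
qed

lemma leb_outer_Un_le: "leb_outer (A \<union> B) \<le> leb_outer A + leb_outer B"
proof -
  obtain A' where A: "A' \<in> sets lborel" "A \<subseteq> A'" "leb_outer A = emeasure lborel A'" by (rule leb_outer_hull)
  obtain B' where B: "B' \<in> sets lborel" "B \<subseteq> B'" "leb_outer B = emeasure lborel B'" by (rule leb_outer_hull)
  have "leb_outer (A \<union> B) \<le> emeasure lborel (A' \<union> B')" using A B by (intro leb_outer_le) auto
  also have "\<dots> \<le> emeasure lborel A' + emeasure lborel B'" using A B by (intro emeasure_subadditive)
  finally show ?thesis using A B by simp
qed

lemma leb_outer_Icc_le: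
  assumes "A \<subseteq> {a..b}" "b - a \<le> m" "0 \<le> m" shows "leb_outer A \<le> ennreal m"
proof -
  have "leb_outer A \<le> emeasure lborel {a..b}" using assms by (intro leb_outer_le) auto
  also have "\<dots> \<le> ennreal m" using assms by (cases "a \<le> b") (auto intro: ennreal_leI)
  finally show ?thesis .
qed

lemma leb_outer_open_superset:
  assumes "0 < e"
  obtains U where "open U" "A \<subseteq> U" "emeasure lborel U \<le> leb_outer A + ennreal e"
proof -
  obtain B where B: "B \<in> sets lborel" "A \<subseteq> B" "leb_outer A = emeasure lborel B" by (rule leb_outer_hull)
  from outer_regular_lborel[of B e] B(1) assms obtain U where U: "open U" "B \<subseteq> U" "emeasure lborel (U - B) < e"
    by auto
  have "emeasure lborel U \<le> emeasure lborel (B \<union> (U - B))"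
    using U B by (intro emeasure_mono) auto
  also have "\<dots> \<le> emeasure lborel B + emeasure lborel (U - B)" using U B by (intro emeasure_subadditive) auto
  also have "\<dots> \<le> leb_outer A + ennreal e" using U B by (intro add_mono) auto
  finally show ?thesis using U B by (intro that) auto
qed

text \<open>The oscillation bound holds only at some small radii around each point, so
  \<open>u\<close> need not be Lipschitz and a Vitali-type covering inside an open neighbourhood of
  \<open>T\<close> is used.\<close>

lemma leb_outer_image_le:
  fixes u :: "real \<Rightarrow> real"
  assumes T: "T \<subseteq> {0..l}" and t: "0 \<le> t"
    and osc: "\<And>s \<delta>. s \<in> T \<Longrightarrow> 0 < \<delta> \<Longrightarrow>
      \<exists>r. 0 < r \<and> r < \<delta> \<and> (\<forall>s'\<in>T. \<bar>s' - s\<bar> < r \<longrightarrow> \<bar>u s' - u s\<bar> \<le> t * r)"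
  shows "leb_outer (u ` T) \<le> ennreal (4 * t) * leb_outer T"
proof (rule ennreal_le_epsilon)
  fix e :: real assume e: "0 < e"
  \<comment> \<open>The summand 1 keeps the denominator positive when \<open>t = 0\<close>.\<close>
  define e' where "e' = e / (4 * t + 1)"
  have e': "0 < e'" "4 * t * e' \<le> e"
    using e t by (auto simp: e'_def field_simps add_pos_nonneg add_nonneg_pos)
  obtain U where U: "open U" "T \<subseteq> U" "emeasure lborel U \<le> leb_outer T + ennreal e'"
    using leb_outer_open_superset[OF e'(1)] by blast
  have "\<exists>r. 0 < r \<and> r < 1 \<and> ball s r \<subseteq> U \<and> (\<forall>s'\<in>T. \<bar>s' - s\<bar> < r \<longrightarrow> \<bar>u s' - u s\<bar> \<le> t * r)" if s: "s \<in> T" for s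
  proof -
    from U s obtain d where d: "0 < d" "ball s d \<subseteq> U" by (meson openE subsetD)
    from osc[OF s, of "min d 1"] d obtain r where r: "0 < r" "r < min d 1"
      "\<forall>s'\<in>T. \<bar>s' - s\<bar> < r \<longrightarrow> \<bar>u s' - u s\<bar> \<le> t * r" by auto
    have "ball s r \<subseteq> ball s d" using r by (intro subset_ball) simp
    with r d show ?thesis by (intro exI[of _ r]) auto
  qed
  then obtain r where r: "\<And>s. s \<in> T \<Longrightarrow> 0 < r s \<and> r s < 1" "\<And>s. s \<in> T \<Longrightarrow> ball s (r s) \<subseteq> U"
    "\<And>s s'. s \<in> T \<Longrightarrow> s' \<in> T \<Longrightarrow> \<bar>s' - s\<bar> < r s \<Longrightarrow> \<bar>u s' - u s\<bar> \<le> t * r s"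
    by metis
  have "totally_bounded T"
  proof -
    have "totally_bounded {0..l}"
      unfolding totally_bounded_iff_balls using compact_Icc[of 0 l] by (simp add: compact_eq_totally_bounded)
    with T show ?thesis unfolding totally_bounded_iff_balls by (meson order_trans)
  qed
  note tb = this
  obtain x :: "nat \<Rightarrow> real" and I where
    x: "inj_on x I" "x ` I \<subseteq> T" "T \<subseteq> (\<Union>i\<in>I. ball (x i) (r (x i)))"
    "\<And>i j. i \<in> I \<Longrightarrow> j \<in> I \<Longrightarrow> i \<noteq> j \<Longrightarrow> dyadic_separated r (x i) (x j)"
    using ball_selection_seq[of T r, OF tb, OF r(1)] that by metis
  define P where "P i = (if i \<in> I then u ` (T \<inter> ball (x i) (r (x i))) else {})" for i
  define B where "B i = (if i \<in> I then ball (x i) (r (x i) / 4) else {})" for i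
  have xT: "x i \<in> T" if "i \<in> I" for i using x(2) that by auto
  have "u ` T \<subseteq> (\<Union>i. P i)"
  proof
    fix y assume "y \<in> u ` T"
    then obtain s where s: "s \<in> T" "y = u s" by auto
    with x(3) obtain i where "i \<in> I" "s \<in> ball (x i) (r (x i))" by blast
    with s have "y \<in> P i" by (auto simp: P_def)
    then show "y \<in> (\<Union>i. P i)" by blast
  qed
  then have "leb_outer (u ` T) \<le> leb_outer (\<Union>i. P i)" by (rule outer_measure_of_mono)
  also have "\<dots> \<le> (\<Sum>i. leb_outer (P i))" by (rule leb_outer_UN_le)
  also have "\<dots> \<le> (\<Sum>i. ennreal (4 * t) * emeasure lborel (B i))"
  proof (intro suminf_le allI)
    fix i show "leb_outer (P i) \<le> ennreal (4 * t) * emeasure lborel (B i)"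
    proof (cases "i \<in> I")
      case True
      note xi = xT[OF True]
      define c where "c = u (x i)"
      define \<rho> where "\<rho> = r (x i)"
      have \<rho>: "0 < \<rho>" using r(1)[OF xi] by (simp add: \<rho>_def)
      \<comment> \<open>The image piece has length at most \<open>2 * t * \<rho>\<close>, the
        quarter ball has length \<open>\<rho> / 2\<close>, and the quarter balls are disjoint: this
        is the constant \<open>4 * t\<close>.\<close>
      have "P i \<subseteq> {c - t * \<rho> .. c + t * \<rho>}"
      proof
        fix y assume "y \<in> P i"
        then obtain s where s: "s \<in> T" "dist (x i) s < \<rho>" "y = u s" using True by (auto simp: P_def \<rho>_def)
        then have "\<bar>u s - c\<bar> \<le> t * \<rho>"
          using r(3)[OF xi s(1)] by (auto simp: \<rho>_def c_def dist_real_def)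
        with s show "y \<in> {c - t * \<rho> .. c + t * \<rho>}" by auto
      qed
      then have "leb_outer (P i) \<le> ennreal (2 * t * \<rho>)"
        using t \<rho> by (intro leb_outer_Icc_le) auto
      also have "emeasure lborel (B i) = ennreal (\<rho> / 2)"
        using True \<rho> by (simp add: B_def \<rho>_def ball_eq_greaterThanLessThan)
      then have "ennreal (2 * t * \<rho>) = ennreal (4 * t) * emeasure lborel (B i)"
        using t \<rho> by (simp add: ennreal_mult[symmetric])
      finally show ?thesis .
    qed (simp add: P_def outer_measure_of_eq)
  qed auto
  also have "\<dots> = ennreal (4 * t) * (\<Sum>i. emeasure lborel (B i))" by simp
  also have "(\<Sum>i. emeasure lborel (B i)) = emeasure lborel (\<Union>i. B i)"
  proof (rule suminf_emeasure)
    show "disjoint_family B"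
      unfolding disjoint_family_on_def B_def
      using dyadic_separated_quarter_balls[OF x(4)] r(1) xT by auto
  qed (auto simp: B_def)
  also have "\<dots> \<le> emeasure lborel U"
  proof (rule emeasure_mono)
    show "(\<Union>i. B i) \<subseteq> U"
    proof
      fix y assume "y \<in> (\<Union>i. B i)"
      then obtain i where i: "i \<in> I" "y \<in> ball (x i) (r (x i) / 4)" by (auto simp: B_def split: if_splits)
      moreover have "ball (x i) (r (x i) / 4) \<subseteq> ball (x i) (r (x i))"
        using r(1)[OF xT[OF i(1)]] by (intro subset_ball) simp
      ultimately show "y \<in> U" using r(2)[OF xT[OF i(1)]] by blast
    qed
  qed (use U in auto)
  also note U(3)
  also have "ennreal (4 * t) * (leb_outer T + ennreal e') \<le> ennreal (4 * t) * leb_outer T + ennreal e"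
    using e' t by (simp add: distrib_left ennreal_mult[symmetric] ennreal_leI add_left_mono)
  finally show "leb_outer (u ` T) \<le> ennreal (4 * t) * leb_outer T + ennreal e"
    by (simp add: mult_left_mono)
qed

text \<open>Slicing by the values of \<open>\<phi>\<close> reduces this to constant bounds. Two
  functions are needed: \<open>w\<close> is finite, possibly nonmeasurable, and governs the
  oscillation; \<open>\<phi>\<close> is measurable, possibly infinite, and is integrated.\<close>

lemma leb_outer_image_le_integral:
  fixes u :: "real \<Rightarrow> real" and w \<phi> :: "real \<Rightarrow> ennreal"
  assumes T: "T \<subseteq> {0..l}" and \<phi>[measurable]: "\<phi> \<in> borel_measurable borel"
    and w: "\<And>s. s \<in> T \<Longrightarrow> w s \<le> \<phi> s" "\<And>s. s \<in> T \<Longrightarrow> w s < \<infinity>"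
    and osc: "\<And>s t \<delta>. s \<in> T \<Longrightarrow> w s < ennreal t \<Longrightarrow> 0 < \<delta> \<Longrightarrow>
      \<exists>r. 0 < r \<and> r < \<delta> \<and> (\<forall>s'\<in>{0..l}. \<bar>s' - s\<bar> < r \<longrightarrow> \<bar>u s' - u s\<bar> \<le> t * r)"
  shows "leb_outer (u ` T) \<le> 4 * (\<integral>\<^sup>+s\<in>{0..l}. \<phi> s \<partial>lborel)"
proof (rule ennreal_le_epsilon)
  fix e :: real assume fin: "4 * (\<integral>\<^sup>+s\<in>{0..l}. \<phi> s \<partial>lborel) < top" and e: "0 < e"
  show "leb_outer (u ` T) \<le> 4 * (\<integral>\<^sup>+s\<in>{0..l}. \<phi> s \<partial>lborel) + ennreal e"
  proof (cases "0 \<le> l")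
    case False
    then have "T = {}" using T by auto
    then show ?thesis by simp
  next
    case l: True
    have le: "leb_outer (u ` S) \<le> ennreal (4 * t) * leb_outer S"
      if S: "S \<subseteq> T" "0 \<le> t" "\<And>s. s \<in> S \<Longrightarrow> w s < ennreal t" for S t
    proof (rule leb_outer_image_le)
      show "S \<subseteq> {0..l}" using S T by auto
      show "0 \<le> t" by fact
      fix s \<delta> :: real assume "s \<in> S" "0 < \<delta>"
      then obtain r where "0 < r" "r < \<delta>" "\<forall>s'\<in>{0..l}. \<bar>s' - s\<bar> < r \<longrightarrow> \<bar>u s' - u s\<bar> \<le> t * r"
        using osc[of s t \<delta>] S(1) S(3)[of s] by auto
      then show "\<exists>r>0. r < \<delta> \<and> (\<forall>s'\<in>S. \<bar>s' - s\<bar> < r \<longrightarrow> \<bar>u s' - u s\<bar> \<le> t * r)"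
        using S(1) T by (intro exI[of _ r]) auto
    qed
    \<comment> \<open>\<open>J\<close> is Lebesgue null since the integral is finite. Its image is
      null because \<open>w\<close> is finite on \<open>J\<close>: each piece with
      \<open>w < k\<close> is null and has a constant oscillation bound.\<close>
    define J where "J = {s\<in>T. \<phi> s = \<infinity>}"
    have J: "leb_outer (u ` J) = 0"
    proof -
      have "AE s in lborel. \<phi> s * indicator {0..l} s \<noteq> \<infinity>"
        using fin by (intro nn_integral_noteq_infinite) (auto simp: ennreal_mult_less_top top_unique less_top)
      then have "emeasure lborel {s \<in> space lborel. \<not> (\<phi> s * indicator {0..l} s \<noteq> \<infinity>)} = 0"
        by (subst (asm) AE_iff_measurable[OF _ refl]) auto
      moreover have "J \<subseteq> {s \<in> space lborel. \<not> (\<phi> s * indicator {0..l} s \<noteq> \<infinity>)}"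
        using T by (auto simp: J_def)
      moreover have "{s \<in> space lborel. \<not> (\<phi> s * indicator {0..l} s \<noteq> \<infinity>)} \<in> sets lborel"
        by measurable
      ultimately have "leb_outer J \<le> 0" using leb_outer_le by metis
      then have J0: "leb_outer S = 0" if "S \<subseteq> J" for S
        using outer_measure_of_mono[OF that, of lborel] by simp
      have "u ` J \<subseteq> (\<Union>k. u ` {s\<in>J. w s < ennreal (real k)})"
      proof
        fix y assume "y \<in> u ` J"
        then obtain s where s: "s \<in> J" "y = u s" by auto
        then have "w s < top" using w(2) by (auto simp: J_def)
        then obtain k :: nat where "w s < of_nat k" by (metis ennreal_Ex_less_of_nat infinity_ennreal_def)
        with s show "y \<in> (\<Union>k. u ` {s\<in>J. w s < ennreal (real k)})"
          by (auto simp: ennreal_of_nat_eq_real_of_nat)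
      qed
      then have "leb_outer (u ` J) \<le> leb_outer (\<Union>k. u ` {s\<in>J. w s < ennreal (real k)})"
        by (rule outer_measure_of_mono)
      also have "\<dots> \<le> (\<Sum>k. leb_outer (u ` {s\<in>J. w s < ennreal (real k)}))" by (rule leb_outer_UN_le)
      also have "\<dots> \<le> (\<Sum>k. 0)"
      proof (intro suminf_le allI)
        fix k :: nat
        have "leb_outer (u ` {s\<in>J. w s < ennreal (real k)}) \<le> ennreal (4 * real k) * leb_outer {s\<in>J. w s < ennreal (real k)}"
          by (rule le) (auto simp: J_def)
        also have "\<dots> = 0" by (subst J0) auto
        finally show "leb_outer (u ` {s\<in>J. w s < ennreal (real k)}) \<le> 0" .
      qed auto
      finally show ?thesis by simp
    qed
    \<comment> \<open>Slices of height \<open>\<eta>\<close> overestimate \<open>\<phi>\<close> by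
      at most \<open>\<eta>\<close>, which costs at most \<open>4 * (\<eta> * l)\<close> in
      total.\<close>
    define \<eta> where "\<eta> = e / (4 * l + 1)"
    have \<eta>: "0 < \<eta>" "4 * (\<eta> * l) \<le> e" using e l by (auto simp: \<eta>_def field_simps add_nonneg_pos)
    define D where "D n = {s\<in>{0..l}. ennreal (real n * \<eta>) \<le> \<phi> s \<and> \<phi> s < ennreal (real (Suc n) * \<eta>)}" for n
    have D_meas[measurable]: "D n \<in> sets lborel" for n unfolding D_def by measurable
    have "T \<subseteq> J \<union> (\<Union>n. T \<inter> D n)"
    proof
      fix s assume s: "s \<in> T"
      show "s \<in> J \<union> (\<Union>n. T \<inter> D n)"
      proof (cases "\<phi> s" rule: ennreal_cases)
        case (real a)
        define n where "n = nat \<lfloor>a / \<eta>\<rfloor>"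
        have "real n \<le> a / \<eta>" "a / \<eta> < real (Suc n)"
          using real \<eta> unfolding n_def by (auto simp: of_nat_nat) linarith+
        then have "real n * \<eta> \<le> a" "a < real (Suc n) * \<eta>" using \<eta> by (simp_all add: field_simps)
        then have "s \<in> D n" using s T real \<eta> unfolding D_def by (auto intro!: ennreal_leI ennreal_lessI)
        with s show ?thesis by auto
      qed (use s in \<open>simp add: J_def\<close>)
    qed
    then have "u ` T \<subseteq> u ` J \<union> (\<Union>n. u ` (T \<inter> D n))" by blast
    then have "leb_outer (u ` T) \<le> leb_outer (u ` J \<union> (\<Union>n. u ` (T \<inter> D n)))" by (rule outer_measure_of_mono)
    also have "\<dots> \<le> leb_outer (u ` J) + leb_outer (\<Union>n. u ` (T \<inter> D n))" by (rule leb_outer_Un_le)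
    also have "\<dots> = leb_outer (\<Union>n. u ` (T \<inter> D n))" using J by simp
    also have "\<dots> \<le> (\<Sum>n. leb_outer (u ` (T \<inter> D n)))" by (rule leb_outer_UN_le)
    also have "\<dots> \<le> (\<Sum>n. 4 * (\<integral>\<^sup>+s. (\<phi> s + ennreal \<eta>) * indicator (D n) s \<partial>lborel))"
    proof (intro suminf_le allI)
      fix n
      have "leb_outer (u ` (T \<inter> D n)) \<le> ennreal (4 * (real (Suc n) * \<eta>)) * leb_outer (T \<inter> D n)"
        using \<eta> w(1) by (intro le) (auto simp: D_def intro: le_less_trans)
      also have "\<dots> \<le> ennreal (4 * (real (Suc n) * \<eta>)) * emeasure lborel (D n)"
        using D_meas[of n] by (intro mult_left_mono leb_outer_le) auto
      also have "\<dots> = (\<integral>\<^sup>+s. ennreal (4 * (real (Suc n) * \<eta>)) * indicator (D n) s \<partial>lborel)"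
        using D_meas[of n] by (subst nn_integral_cmult_indicator) auto
      also have "\<dots> \<le> (\<integral>\<^sup>+s. 4 * ((\<phi> s + ennreal \<eta>) * indicator (D n) s) \<partial>lborel)"
      proof (rule nn_integral_mono)
        fix s
        show "ennreal (4 * (real (Suc n) * \<eta>)) * indicator (D n) s \<le> 4 * ((\<phi> s + ennreal \<eta>) * indicator (D n) s)"
        proof (cases "s \<in> D n")
          case True
          have "ennreal (real (Suc n) * \<eta>) = ennreal (real n * \<eta>) + ennreal \<eta>"
            using \<eta> by (simp add: ennreal_plus[symmetric] algebra_simps del: ennreal_plus)
          also have "\<dots> \<le> \<phi> s + ennreal \<eta>" using True by (simp add: D_def add_right_mono)
          finally have "4 * ennreal (real (Suc n) * \<eta>) \<le> 4 * (\<phi> s + ennreal \<eta>)" by (rule mult_left_mono) simp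
          moreover have "ennreal (4 * (real (Suc n) * \<eta>)) = 4 * ennreal (real (Suc n) * \<eta>)"
            using \<eta> by (subst ennreal_mult) auto
          ultimately show ?thesis using True by simp
        qed simp
      qed
      also have "\<dots> = 4 * (\<integral>\<^sup>+s. (\<phi> s + ennreal \<eta>) * indicator (D n) s \<partial>lborel)"
        by (subst nn_integral_cmult) auto
      finally show "leb_outer (u ` (T \<inter> D n)) \<le> 4 * (\<integral>\<^sup>+s. (\<phi> s + ennreal \<eta>) * indicator (D n) s \<partial>lborel)" .
    qed auto
    also have "\<dots> = 4 * (\<integral>\<^sup>+s. (\<Sum>n. (\<phi> s + ennreal \<eta>) * indicator (D n) s) \<partial>lborel)"
      by (subst nn_integral_suminf) auto
    also have "\<dots> \<le> 4 * (\<integral>\<^sup>+s. (\<phi> s + ennreal \<eta>) * indicator {0..l} s \<partial>lborel)"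
    proof (intro mult_left_mono nn_integral_mono)
      fix s
      have dj: "disjoint_family D"
      proof (unfold disjoint_family_on_def, intro ballI impI)
        have *: "D m \<inter> D n = {}" if "m < n" for m n
        proof -
          have "real (Suc m) \<le> real n" using that by simp
          then have "real (Suc m) * \<eta> \<le> real n * \<eta>" using \<eta> by (intro mult_right_mono) auto
          then have "ennreal (real (Suc m) * \<eta>) \<le> ennreal (real n * \<eta>)" by (rule ennreal_leI)
          then have "\<not> (\<phi> s < ennreal (real (Suc m) * \<eta>) \<and> ennreal (real n * \<eta>) \<le> \<phi> s)" for s
            by (meson leD order_trans)
          then show ?thesis unfolding D_def by blast
        qed
        show "D m \<inter> D n = {}" if "m \<noteq> n" for m n
          using *[of m n] *[of n m] that by (cases "m < n") auto
      qed
      show "(\<Sum>n. (\<phi> s + ennreal \<eta>) * indicator (D n) s) \<le> (\<phi> s + ennreal \<eta>) * indicator {0..l} s"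
      proof (cases "\<exists>n. s \<in> D n")
        case True
        then obtain n where n: "s \<in> D n" by blast
        then have "s \<in> {0..l}" by (simp add: D_def)
        with suminf_cmult_indicator[OF dj n, of "\<lambda>_. \<phi> s + ennreal \<eta>"] show ?thesis by simp
      qed simp
    qed simp
    also have "(\<integral>\<^sup>+s. (\<phi> s + ennreal \<eta>) * indicator {0..l} s \<partial>lborel)
      = (\<integral>\<^sup>+s. \<phi> s * indicator {0..l} s + ennreal \<eta> * indicator {0..l} s \<partial>lborel)"
      by (simp add: distrib_right)
    also have "\<dots> = (\<integral>\<^sup>+s\<in>{0..l}. \<phi> s \<partial>lborel) + ennreal (\<eta> * l)"
      using l \<eta> by (subst nn_integral_add) (auto simp: nn_integral_cmult_indicator ennreal_mult)
    also have "4 * \<dots> = 4 * (\<integral>\<^sup>+s\<in>{0..l}. \<phi> s \<partial>lborel) + ennreal (4 * (\<eta> * l))"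
      using l \<eta> by (simp add: distrib_left ennreal_mult)
    also have "\<dots> \<le> 4 * (\<integral>\<^sup>+s\<in>{0..l}. \<phi> s \<partial>lborel) + ennreal e"
      using \<eta> by (intro add_left_mono ennreal_leI) auto
    finally show ?thesis .
  qed
qed

section \<open>Outer regularity\<close>

lemma suminf_half_powers: "0 \<le> e \<Longrightarrow> (\<Sum>n. ennreal (e * (1/2)^Suc n)) = ennreal e"
  using sums_mult[OF power_half_series, of e] by (intro suminf_ennreal_eq) auto

text \<open>The sets with this property form a sigma-algebra containing the closed sets.
  Approximating from inside and outside at once is what makes the property pass to
  complements.\<close>

lemma finite_borel_measure_closed_open_approx:
  fixes M :: "'a::metric_space measure"
  assumes M[simp, measurable_cong]: "sets M = sets borel" and fin: "emeasure M (space M) < \<infinity>"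
    and B: "B \<in> sets borel" and e: "0 < e"
  shows "\<exists>F U. closed F \<and> open U \<and> F \<subseteq> B \<and> B \<subseteq> U \<and> emeasure M (U - F) < ennreal e"
proof -
  have finM: "emeasure M A \<noteq> \<infinity>" for A
    using emeasure_space[of M A] fin by (auto simp: top_unique)
  define P where "P B \<longleftrightarrow> (\<forall>e>0. \<exists>F U. closed F \<and> open U \<and> F \<subseteq> B \<and> B \<subseteq> U \<and> emeasure M (U - F) < ennreal e)"
    for B :: "'a set"
  have closed: "P C" if C: "closed C" for C
    unfolding P_def
  proof (intro allI impI)
    fix e :: real assume e: "0 < e"
    show "\<exists>F U. closed F \<and> open U \<and> F \<subseteq> C \<and> C \<subseteq> U \<and> emeasure M (U - F) < ennreal e"
    proof (cases "C = {}")
      case True then show ?thesis using e by (intro exI[of _ "{}"]) auto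
    next
      case False
      \<comment> \<open>A closed set is the intersection of its metric neighbourhoods, so their
        excess tends to 0 in a finite measure.\<close>
      define U where "U n = {x. infdist x C < 1 / real (Suc n)}" for n
      have U: "open (U n)" for n
        unfolding U_def by (intro open_Collect_less continuous_intros)
      have CU: "C \<subseteq> U n" for n
        using C False by (auto simp: U_def)
      have "(\<lambda>n. emeasure M (U n - C)) \<longlonglongrightarrow> emeasure M (\<Inter>n. U n - C)"
      proof (rule Lim_emeasure_decseq)
        show "range (\<lambda>n. U n - C) \<subseteq> sets M" using U C by auto
        show "decseq (\<lambda>n. U n - C)"
        proof (rule decseq_SucI)
          fix n
          have "1 / real (Suc (Suc n)) \<le> 1 / real (Suc n)" by (intro divide_left_mono) auto
          then show "U (Suc n) - C \<subseteq> U n - C" unfolding U_def by (auto simp del: of_nat_Suc)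
        qed
      qed (use finM in auto)
      also have "(\<Inter>n. U n - C) = {}"
      proof (rule ccontr)
        assume "(\<Inter>n. U n - C) \<noteq> {}"
        then obtain x where x: "x \<notin> C" "\<And>n. infdist x C < 1 / real (Suc n)" by (auto simp: U_def)
        have "0 < infdist x C"
          using x(1) C False in_closed_iff_infdist_zero infdist_nonneg[of x C] by (metis less_eq_real_def)
        from nat_approx_posE[OF this] obtain n where "1 / real (Suc n) < infdist x C" .
        with x(2)[of n] show False by simp
      qed
      finally have "eventually (\<lambda>n. emeasure M (U n - C) < ennreal e) sequentially"
        using e by (intro order_tendstoD(2)) auto
      then obtain n where "emeasure M (U n - C) < ennreal e" by (meson eventually_happens sequentially_bot)
      then show ?thesis using U CU C by blast
    qed
  qed
  have compl: "P (- A)" if "P A" for A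
    unfolding P_def
  proof (intro allI impI)
    fix e :: real assume "0 < e"
    from that[unfolded P_def, rule_format, OF this]
    obtain F U where FU: "closed F" "open U" "F \<subseteq> A" "A \<subseteq> U" "emeasure M (U - F) < ennreal e"
      by (elim exE conjE)
    moreover have "- F - (- U) = U - F" by auto
    ultimately show "\<exists>F U. closed F \<and> open U \<and> F \<subseteq> - A \<and> - A \<subseteq> U \<and> emeasure M (U - F) < ennreal e"
      by (intro exI[of _ "- U"] exI[of _ "- F"]) auto
  qed
  have "B \<in> sigma_sets UNIV (Collect open)" using B by (simp add: borel_def)
  then have "P B"
  proof induction
    case (Basic a)
    then have "closed (- a)" by (simp add: closed_Compl)
    from compl[OF closed[OF this]] show ?case by simp
  next
    case Empty
    then show ?case using closed[of "{}"] by simp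
  next
    case (Compl a)
    then show ?case using compl[of a] by (simp add: Compl_eq_Diff_UNIV)
  next
    case (Union a)
    show ?case unfolding P_def
    proof (intro allI impI)
      fix e :: real assume e: "0 < e"
      have "\<exists>F U. closed F \<and> open U \<and> F \<subseteq> a n \<and> a n \<subseteq> U \<and> emeasure M (U - F) < ennreal (e / 2 * (1/2)^Suc n)" for n
      proof -
        have "0 < e / 2 * (1/2)^Suc n" using e by simp
        from Union(2)[of n, unfolded P_def, rule_format, OF this] show ?thesis .
      qed
      then obtain F U where FU: "\<And>n. closed (F n)" "\<And>n. open (U n)" "\<And>n. F n \<subseteq> a n" "\<And>n. a n \<subseteq> U n"
        "\<And>n. emeasure M (U n - F n) < ennreal (e / 2 * (1/2)^Suc n)"
        by metis
      have F_sets: "F n \<in> sets borel" for n using FU(1) by (rule borel_closed)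
      have U_sets: "U n \<in> sets borel" for n using FU(2) by (rule borel_open)
      \<comment> \<open>A countable union of closed sets need not be closed, so only finitely many
        \<open>F n\<close> are kept; the error \<open>e / 2\<close> of the whole union leaves room
        for that.\<close>
      define G where "G k = (\<Union>n. U n) - (\<Union>n<k. F n)" for k
      have "(\<lambda>k. emeasure M (G k)) \<longlonglongrightarrow> emeasure M (\<Inter>k. G k)"
      proof (rule Lim_emeasure_decseq)
        show "range G \<subseteq> sets M" using F_sets U_sets by (auto simp: G_def)
        show "decseq G" by (rule decseq_SucI) (auto simp: G_def)
      qed (use finM in auto)
      moreover have "emeasure M (\<Inter>k. G k) < ennreal e"
      proof -
        have "(\<Inter>k. G k) \<subseteq> (\<Union>n. U n - F n)"
        proof
          fix x assume x: "x \<in> (\<Inter>k. G k)"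
          then obtain n where "x \<in> U n" by (auto simp: G_def)
          moreover have "x \<in> G (Suc n)" using x by blast
          ultimately show "x \<in> (\<Union>n. U n - F n)" by (auto simp: G_def)
        qed
        then have "emeasure M (\<Inter>k. G k) \<le> emeasure M (\<Union>n. U n - F n)"
          using F_sets U_sets by (intro emeasure_mono) auto
        also have "\<dots> \<le> (\<Sum>n. emeasure M (U n - F n))"
          using F_sets U_sets by (intro emeasure_subadditive_countably) auto
        also have "\<dots> \<le> (\<Sum>n. ennreal (e / 2 * (1/2)^Suc n))"
          using FU(5) by (intro suminf_le) (auto intro: less_imp_le)
        also have "\<dots> = ennreal (e / 2)" using e by (intro suminf_half_powers) simp
        also have "\<dots> < ennreal e" using e by (intro ennreal_lessI) auto
        finally show ?thesis .
      qed
      ultimately have "eventually (\<lambda>k. emeasure M (G k) < ennreal e) sequentially"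
        by (rule order_tendstoD(2))
      then obtain k where "emeasure M (G k) < ennreal e" by (meson eventually_happens sequentially_bot)
      moreover have "closed (\<Union>n<k. F n)" using FU(1) by auto
      moreover have "open (\<Union>n. U n)" using FU(2) by auto
      ultimately show "\<exists>F U. closed F \<and> open U \<and> F \<subseteq> (\<Union>n. a n) \<and> (\<Union>n. a n) \<subseteq> U \<and> emeasure M (U - F) < ennreal e"
        using FU(3,4) unfolding G_def by (intro exI[of _ "\<Union>n<k. F n"] exI[of _ "\<Union>n. U n"]) blast
    qed
  qed
  from this[unfolded P_def, rule_format, OF e] show ?thesis .
qed

section \<open>Outer measures, their Caratheodory measures and Borel hulls\<close>

context
  fixes S :: "'a::metric_space set" and m :: "'a set \<Rightarrow> ennreal"
  assumes reg: "borel_regular_outer_measure S m"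
begin

lemma outer: "outer_measure_space (Pow S) m"
  using reg by (simp add: borel_regular_outer_measure_def)

lemma outer_empty: "m {} = 0"
  using outer by (simp add: outer_measure_space_def positive_def)

lemma outer_mono: "A \<subseteq> B \<Longrightarrow> B \<subseteq> S \<Longrightarrow> m A \<le> m B"
  using outer by (auto simp: outer_measure_space_def increasing_def)

lemma sets_caratheodory: "sets (caratheodory_measure S m) = lambda_system S (Pow S) m"
  using outer by (rule sets_caratheodory_measure)

lemma space_caratheodory: "space (caratheodory_measure S m) = S"
  using outer by (rule space_caratheodory_measure)

lemma emeasure_caratheodory:
  "A \<in> sets (caratheodory_measure S m) \<Longrightarrow> emeasure (caratheodory_measure S m) A = m A"
  using outer unfolding sets_caratheodory by (rule emeasure_caratheodory_measure)

lemma borel_sets_caratheodory: "A \<in> sets (restrict_space borel S) \<Longrightarrow> A \<in> sets (caratheodory_measure S m)"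
  using reg by (auto simp: borel_regular_outer_measure_def sets_caratheodory)

lemma borel_hull:
  assumes "A \<subseteq> S"
  obtains B where "B \<in> sets (restrict_space borel S)" "A \<subseteq> B" "B \<subseteq> S" "m B = m A"
proof -
  obtain B where "B \<in> sets (restrict_space borel S)" "A \<subseteq> B" "m B = m A"
    using reg assms unfolding borel_regular_outer_measure_def by blast
  moreover from this(1) have "B \<subseteq> S"
    using sets.sets_into_space[of B "restrict_space borel S"] by (simp add: space_restrict_space)
  ultimately show ?thesis by (intro that)
qed

text \<open>\<open>countably_subadditive\<close> speaks of disjoint families; for arbitrary
  sequences the sets are replaced by Borel hulls, on which \<open>m\<close> is a measure.\<close>

lemma outer_UN_le:
  fixes A :: "nat \<Rightarrow> 'a set"
  assumes "\<And>n. A n \<subseteq> S"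
  shows "m (\<Union>n. A n) \<le> (\<Sum>n. m (A n))"
proof -
  have "\<forall>n. \<exists>B. B \<in> sets (restrict_space borel S) \<and> A n \<subseteq> B \<and> B \<subseteq> S \<and> m B = m (A n)"
    using borel_hull[OF assms] by metis
  then obtain B where B: "\<And>n. B n \<in> sets (restrict_space borel S)" "\<And>n. A n \<subseteq> B n" "\<And>n. B n \<subseteq> S" "\<And>n. m (B n) = m (A n)"
    by metis
  let ?M = "caratheodory_measure S m"
  have Bs: "B n \<in> sets ?M" for n using B(1) by (rule borel_sets_caratheodory)
  have "m (\<Union>n. A n) \<le> m (\<Union>n. B n)" using B(2,3) by (intro outer_mono) blast+
  also have "\<dots> = emeasure ?M (\<Union>n. B n)" using Bs by (subst emeasure_caratheodory) auto
  also have "\<dots> \<le> (\<Sum>n. emeasure ?M (B n))" using Bs by (intro emeasure_subadditive_countably) auto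
  also have "\<dots> = (\<Sum>n. m (A n))" using Bs B by (simp add: emeasure_caratheodory)
  finally show ?thesis .
qed

lemma outer_Un_le:
  assumes "A \<subseteq> S" "B \<subseteq> S"
  shows "m (A \<union> B) \<le> m A + m B"
proof -
  define F where "F n = (if n = 0 then A else if n = 1 then B else {})" for n :: nat
  have "m (\<Union>n. F n) \<le> (\<Sum>n. m (F n))"
    using assms by (intro outer_UN_le) (auto simp: F_def)
  also have "(\<Union>n. F n) = A \<union> B"
  proof -
    have "F 0 = A" "F 1 = B" "\<And>n. F n \<subseteq> A \<union> B" by (auto simp: F_def)
    then show ?thesis by blast
  qed
  also have "(\<Sum>n. m (F n)) = (\<Sum>n\<in>{0,1}. m (F n))"
    by (rule suminf_finite) (auto simp: outer_empty F_def)
  finally show ?thesis by (simp add: F_def)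
qed

text \<open>Completeness: a set differing from a Borel set by a null set can thus be recognized as
  measurable.\<close>

lemma null_sets_caratheodory:
  assumes "A \<subseteq> S" "m A = 0" shows "A \<in> sets (caratheodory_measure S m)"
proof -
  have "m (A \<inter> x) + m ((S - A) \<inter> x) = m x" if x: "x \<subseteq> S" for x
  proof (rule antisym)
    have "m (A \<inter> x) \<le> m A" using assms by (intro outer_mono) auto
    then have "m (A \<inter> x) = 0" using assms by simp
    moreover have "m ((S - A) \<inter> x) \<le> m x" using x by (intro outer_mono) auto
    ultimately show "m (A \<inter> x) + m ((S - A) \<inter> x) \<le> m x" by simp
    have "m ((A \<inter> x) \<union> ((S - A) \<inter> x)) \<le> m (A \<inter> x) + m ((S - A) \<inter> x)"
      using x by (intro outer_Un_le) auto
    also have "(A \<inter> x) \<union> ((S - A) \<inter> x) = x" using x by auto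
    finally show "m x \<le> m (A \<inter> x) + m ((S - A) \<inter> x)" .
  qed
  then show ?thesis using assms by (auto simp: sets_caratheodory lambda_system_def)
qed

end

lemma metric_measure_regular: "metric_measure m \<Longrightarrow> borel_regular_outer_measure UNIV m"
  by (simp add: metric_measure_def)

lemma metric_measure_borel:
  assumes "metric_measure m" "A \<in> sets borel"
  shows "A \<in> sets (caratheodory_measure UNIV m)" "emeasure (caratheodory_measure UNIV m) A = m A"
proof -
  show *: "A \<in> sets (caratheodory_measure UNIV m)"
    using borel_sets_caratheodory[OF metric_measure_regular[OF assms(1)]] assms(2) by simp
  show "emeasure (caratheodory_measure UNIV m) A = m A"
    using emeasure_caratheodory[OF metric_measure_regular[OF assms(1)] *] .
qed

lemma metric_measure_borel_measurable:
  assumes "metric_measure m" "g \<in> borel_measurable borel"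
  shows "g \<in> borel_measurable (caratheodory_measure UNIV m)"
proof -
  have "space (caratheodory_measure UNIV m) = space borel"
    using space_caratheodory[OF metric_measure_regular[OF assms(1)]] by simp
  then show ?thesis
    using assms(2) metric_measure_borel(1)[OF assms(1)] by (auto simp: measurable_def)
qed

lemma metric_measure_hull:
  assumes "metric_measure m"
  obtains B where "B \<in> sets borel" "A \<subseteq> B" "m B = m A"
  using borel_hull[OF metric_measure_regular[OF assms], of A] by auto

text \<open>\<open>m\<close> is finite only on balls. The approximation is made in each ball
  \<open>b n\<close>, and the open sets are intersected with these balls before they are united, so
  that the excesses sum to \<open>e\<close>.\<close>

lemma metric_measure_open_superset:
  fixes m :: "'a::metric_space set \<Rightarrow> ennreal"
  assumes m: "metric_measure m" and e: "0 < e"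
  obtains U where "open U" "A \<subseteq> U" "m U \<le> m A + ennreal e"
proof -
  obtain B where B: "B \<in> sets borel" "A \<subseteq> B" "m B = m A" using metric_measure_hull[OF m] by blast
  let ?N = "caratheodory_measure UNIV m"
  have id: "(\<lambda>x. x) \<in> measurable ?N borel"
    using metric_measure_borel_measurable[OF m, of "\<lambda>x. x"] by simp
  define b where "b n = ball (undefined::'a) (real n)" for n
  \<comment> \<open>\<open>distr\<close> along the identity forgets all but the Borel sets, as the
    approximation lemma requires; the density restricts to \<open>b n\<close>.\<close>
  define K where "K n = density (distr ?N borel (\<lambda>x. x)) (indicator (b n))" for n
  have spN: "space ?N = UNIV" using space_caratheodory[OF metric_measure_regular[OF m]] by simp
  have b[measurable]: "b n \<in> sets borel" for n by (simp add: b_def)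
  have K: "emeasure (K n) A = m (b n \<inter> A)" if A: "A \<in> sets borel" for n A
  proof -
    have "emeasure (K n) A = (\<integral>\<^sup>+x. indicator (b n) x * indicator A x \<partial>distr ?N borel (\<lambda>x. x))"
      using A unfolding K_def by (subst emeasure_density) auto
    also have "\<dots> = (\<integral>\<^sup>+x. indicator (b n \<inter> A) x \<partial>distr ?N borel (\<lambda>x. x))"
      by (simp add: indicator_inter_arith)
    also have "\<dots> = emeasure (distr ?N borel (\<lambda>x. x)) (b n \<inter> A)" using A by simp
    also have "\<dots> = emeasure ?N (b n \<inter> A)" using A id by (subst emeasure_distr) (auto simp: spN)
    also have "\<dots> = m (b n \<inter> A)" using A by (intro metric_measure_borel[OF m]) auto
    finally show ?thesis .
  qed
  have "\<exists>U. open U \<and> B \<subseteq> U \<and> m (b n \<inter> (U - B)) < ennreal (e * (1/2)^Suc n)" for n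
  proof -
    have "emeasure (K n) (space (K n)) = m (b n)" using K[of UNIV n] by (simp add: K_def)
    also have "\<dots> < \<infinity>" using m by (simp add: metric_measure_def b_def)
    finally have fin: "emeasure (K n) (space (K n)) < \<infinity>" .
    have "sets (K n) = sets borel" by (simp add: K_def)
    from finite_borel_measure_closed_open_approx[OF this fin B(1), of "e * (1/2)^Suc n"] e
    obtain F U where FU: "closed F" "open U" "F \<subseteq> B" "B \<subseteq> U" "emeasure (K n) (U - F) < ennreal (e * (1/2)^Suc n)"
      by auto
    have "m (b n \<inter> (U - B)) \<le> m (b n \<inter> (U - F))"
      using FU by (intro outer_mono[OF metric_measure_regular[OF m]]) auto
    also have "\<dots> = emeasure (K n) (U - F)" using FU by (subst K) auto
    finally show ?thesis using FU by (intro exI[of _ U]) auto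
  qed
  then obtain U where U: "\<And>n. open (U n)" "\<And>n. B \<subseteq> U n" "\<And>n. m (b n \<inter> (U n - B)) < ennreal (e * (1/2)^Suc n)"
    by metis
  define V where "V = (\<Union>n. b n \<inter> U n)"
  have "open V" using U by (auto simp: V_def b_def)
  moreover have "B \<subseteq> V"
  proof
    fix x assume x: "x \<in> B"
    obtain n :: nat where "dist undefined x < real n" using reals_Archimedean2 by blast
    then show "x \<in> V" using x U(2) by (auto simp: V_def b_def)
  qed
  moreover have "m V \<le> m A + ennreal e"
  proof -
    have "m V \<le> m (B \<union> (\<Union>n. b n \<inter> (U n - B)))"
      by (intro outer_mono[OF metric_measure_regular[OF m]]) (auto simp: V_def)
    also have "\<dots> \<le> m B + m (\<Union>n. b n \<inter> (U n - B))"
      by (intro outer_Un_le[OF metric_measure_regular[OF m]]) auto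
    also have "\<dots> \<le> m B + (\<Sum>n. m (b n \<inter> (U n - B)))"
      by (intro add_left_mono outer_UN_le[OF metric_measure_regular[OF m]]) auto
    also have "\<dots> \<le> m B + (\<Sum>n. ennreal (e * (1/2)^Suc n))"
      using U(3) by (intro add_left_mono suminf_le) (auto intro: less_imp_le)
    also have "\<dots> = m A + ennreal e" using e B(3) by (simp only: suminf_half_powers less_imp_le)
    finally show ?thesis .
  qed
  ultimately show ?thesis using B(2) by (intro that[of V]) auto
qed

section \<open>Lower Lipschitz constant and curves\<close>

text \<open>The open ball, in contrast to the closed one in \<open>upper_dil\<close>, makes the
  strict superlevel sets open when \<open>f\<close> is continuous on an open
  \<open>\<Omega>\<close>.\<close>

definition ball_osc :: "'a::metric_space set \<Rightarrow> ('a \<Rightarrow> 'b::metric_space) \<Rightarrow> 'a \<Rightarrow> real \<Rightarrow> ennreal" where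
  "ball_osc \<Omega> f x r = (SUP y\<in>{y\<in>\<Omega>. dist y x < r}. ennreal (dist (f y) (f x)))"

text \<open>The lower Lipschitz constant sampled at dyadic radii: the countable liminf is
  measurable, and the sampling costs the factor 2 in \<open>lower_lip_le\<close>.\<close>

definition lower_lip :: "'a::metric_space set \<Rightarrow> ('a \<Rightarrow> 'b::metric_space) \<Rightarrow> 'a \<Rightarrow> ennreal" where
  "lower_lip \<Omega> f x = liminf (\<lambda>j. ennreal (2^j) * ball_osc \<Omega> f x ((1/2)^j))"

lemma ball_osc_le_iff:
  "0 \<le> L \<Longrightarrow> ball_osc \<Omega> f x r \<le> ennreal L \<longleftrightarrow> (\<forall>y\<in>\<Omega>. dist y x < r \<longrightarrow> dist (f y) (f x) \<le> L)"
  by (auto simp: ball_osc_def SUP_le_iff)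

lemma dyadic_mult_cancel:
  "ennreal (2^j) * a \<le> ennreal t \<longleftrightarrow> a \<le> ennreal (t * (1/2)^j)" if "0 \<le> t"
proof (cases a rule: ennreal_cases)
  case (real b)
  then have "ennreal (2^j) * a = ennreal (2^j * b)" by (simp add: ennreal_mult)
  moreover have "2^j * b \<le> t \<longleftrightarrow> b \<le> t * (1/2)^j" by (simp add: field_simps power_divide)
  ultimately show ?thesis using real that by simp
next
  case top
  then show ?thesis by (simp add: ennreal_mult_top top_unique)
qed

lemma lower_lip_less:
  assumes "lower_lip \<Omega> f x < ennreal t" "0 < \<delta>"
  obtains r where "0 < r" "r < \<delta>" "\<And>y. y \<in> \<Omega> \<Longrightarrow> dist y x < r \<Longrightarrow> dist (f y) (f x) \<le> t * r"
proof -
  have t: "0 < t" using assms(1) by (metis ennreal_neg gr_implies_not_zero not_le)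
  obtain N where N: "(1/2::real)^N < \<delta>" using real_arch_pow_inv[of \<delta> "1/2"] assms by auto
  have "\<exists>j\<ge>N. ennreal (2^j) * ball_osc \<Omega> f x ((1/2)^j) \<le> ennreal t"
  proof (rule ccontr)
    assume "\<not> ?thesis"
    then have "eventually (\<lambda>j. ennreal t \<le> ennreal (2^j) * ball_osc \<Omega> f x ((1/2)^j)) sequentially"
      unfolding eventually_sequentially by (meson linear)
    then have "ennreal t \<le> lower_lip \<Omega> f x" unfolding lower_lip_def by (rule Liminf_bounded)
    with assms show False by simp
  qed
  then obtain j where j: "N \<le> j" "ennreal (2^j) * ball_osc \<Omega> f x ((1/2)^j) \<le> ennreal t" by blast
  have "(1/2::real)^j \<le> (1/2)^N" using j by (intro power_decreasing) auto
  then have "(1/2)^j < \<delta>" using N by linarith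
  moreover have "ball_osc \<Omega> f x ((1/2)^j) \<le> ennreal (t * (1/2)^j)"
    using j(2) t by (simp add: dyadic_mult_cancel)
  ultimately show ?thesis using t by (intro that[of "(1/2)^j"]) (auto simp: ball_osc_le_iff)
qed

text \<open>A radius is replaced by the largest power of 1/2 strictly below it, which is at least
  half as large; hence the factor 2.\<close>

lemma lower_lip_le:
  assumes t: "0 \<le> t"
    and r: "\<And>\<delta>. 0 < \<delta> \<Longrightarrow> \<exists>r. 0 < r \<and> r < \<delta> \<and> (\<forall>y\<in>\<Omega>. dist y x < r \<longrightarrow> dist (f y) (f x) \<le> t * r)"
  shows "lower_lip \<Omega> f x \<le> ennreal (2 * t)"
proof (rule ccontr)
  assume "\<not> ?thesis"
  then have "ennreal (2 * t) < lower_lip \<Omega> f x" by simp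
  then have "eventually (\<lambda>j. ennreal (2 * t) < ennreal (2^j) * ball_osc \<Omega> f x ((1/2)^j)) sequentially"
    unfolding lower_lip_def by (rule less_LiminfD)
  then obtain N where N: "\<And>j. N \<le> j \<Longrightarrow> ennreal (2 * t) < ennreal (2^j) * ball_osc \<Omega> f x ((1/2)^j)"
    unfolding eventually_sequentially by blast
  from r[of "(1/2)^N"] obtain r where r: "0 < r" "r < (1/2)^N" "\<And>y. y \<in> \<Omega> \<Longrightarrow> dist y x < r \<Longrightarrow> dist (f y) (f x) \<le> t * r"
    by auto
  have "(1/2::real)^N \<le> 1" by (rule power_le_one) auto
  with r have "r < 1" by simp
  then obtain m where m: "(1/2)^Suc m < r" "r \<le> (1/2)^m"
    using dyadic_band_ex[OF r(1)] by (auto simp: dyadic_band_def)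
  have "N \<le> Suc m"
  proof (rule ccontr)
    assume "\<not> N \<le> Suc m"
    then have "(1/2::real)^N \<le> (1/2)^Suc m" by (intro power_decreasing) auto
    with m r show False by simp
  qed
  have "ball_osc \<Omega> f x ((1/2)^Suc m) \<le> ennreal (2 * t * (1/2)^Suc m)"
  proof (subst ball_osc_le_iff)
    show "\<forall>y\<in>\<Omega>. dist y x < (1/2)^Suc m \<longrightarrow> dist (f y) (f x) \<le> 2 * t * (1/2)^Suc m"
    proof (intro ballI impI)
      fix y assume "y \<in> \<Omega>" "dist y x < (1/2)^Suc m"
      then have "dist (f y) (f x) \<le> t * r" using r(3) m by force
      also have "\<dots> \<le> t * (1/2)^m" using m t by (intro mult_left_mono)
      finally show "dist (f y) (f x) \<le> 2 * t * (1/2)^Suc m" by simp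
    qed
  qed (use t in simp)
  then have "ennreal (2^Suc m) * ball_osc \<Omega> f x ((1/2)^Suc m) \<le> ennreal (2 * t)"
    using t by (subst dyadic_mult_cancel) auto
  with N[OF \<open>N \<le> Suc m\<close>] show False by simp
qed

lemma lower_lip_measurable:
  assumes \<Omega>: "open \<Omega>" and f: "continuous_on \<Omega> f"
  shows "lower_lip \<Omega> f \<in> borel_measurable (restrict_space borel \<Omega>)"
proof -
  have "(\<lambda>x. ball_osc \<Omega> f x r) \<in> borel_measurable (restrict_space borel \<Omega>)" for r
  proof (rule borel_measurableI_greater)
    fix a :: ennreal
    have "{x \<in> space (restrict_space borel \<Omega>). a < ball_osc \<Omega> f x r}
      = (\<Union>y\<in>\<Omega>. ball y r \<inter> ((\<lambda>x. ennreal (dist (f y) (f x))) -` {a<..} \<inter> \<Omega>))"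
      by (auto simp: space_restrict_space ball_osc_def less_SUP_iff)
    moreover have "open \<dots>"
    proof (rule open_UN, rule ballI, rule open_Int)
      fix y assume "y \<in> \<Omega>"
      have "continuous_on \<Omega> (\<lambda>x. ennreal (dist (f y) (f x)))"
        using f by (intro continuous_on_ennreal continuous_on_dist continuous_on_const)
      note * = iffD1[OF continuous_on_open_vimage[OF \<Omega>] this, rule_format]
      show "open ((\<lambda>x. ennreal (dist (f y) (f x))) -` {a<..} \<inter> \<Omega>)"
        by (rule *) (rule open_greaterThan)
    qed simp
    ultimately show "{x \<in> space (restrict_space borel \<Omega>). a < ball_osc \<Omega> f x r} \<in> sets (restrict_space borel \<Omega>)"
      using \<Omega> by (subst sets_restrict_space_iff) (auto simp: borel_open)
  qed
  then have [measurable]: "(\<lambda>x. ball_osc \<Omega> f x r) \<in> borel_measurable (restrict_space borel \<Omega>)" for r .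
  show ?thesis unfolding lower_lip_def by measurable
qed

text \<open>Composing with the distance from the starting point turns lengths of parts of the curve
  in the target into Lebesgue outer measures of subsets of the line.\<close>

definition curve_dist :: "('a \<Rightarrow> 'b::metric_space) \<Rightarrow> 'a curve \<Rightarrow> real \<Rightarrow> real" where
  "curve_dist f c s = dist (f (snd c 0)) (f (snd c s))"

lemma curve_lipschitz:
  assumes c: "is_curve c" and "s \<in> {0..fst c}" "t \<in> {0..fst c}"
  shows "dist (snd c s) (snd c t) \<le> \<bar>s - t\<bar>"
proof -
  have *: "dist (snd c s) (snd c t) \<le> t - s" if "0 \<le> s" "s \<le> t" "t \<le> fst c" for s t
  proof -
    have "ennreal (dist (snd c s) (snd c t)) \<le> path_len (snd c) s t"
      unfolding path_len_def using that by (intro SUP_upper2[of "[s, t]"]) auto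
    also have "\<dots> = ennreal (t - s)" using c that by (simp add: is_curve_def)
    finally show ?thesis using that by simp
  qed
  show ?thesis using *[of s t] *[of t s] assms by (cases "s \<le> t") (auto simp: dist_commute)
qed

lemma curve_integrand_measurable:
  fixes g :: "'a::metric_space \<Rightarrow> ennreal"
  assumes c: "is_curve c" and g: "g \<in> borel_measurable borel"
  shows "(\<lambda>s. g (snd c s) * indicator {0..fst c} s) \<in> borel_measurable borel"
proof -
  have "snd c \<in> borel_measurable (restrict_space borel {0..fst c})"
    using c by (intro borel_measurable_continuous_on_restrict) (simp add: is_curve_def)
  then have "(\<lambda>s. g (snd c s)) \<in> borel_measurable (restrict_space borel {0..fst c})"
    using g by (rule measurable_compose)
  then show ?thesis by (subst (asm) borel_measurable_restrict_space_iff_ennreal) auto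
qed

lemma curve_integral_suminf:
  fixes g :: "nat \<Rightarrow> 'a::metric_space \<Rightarrow> ennreal"
  assumes c: "is_curve c" and g: "\<And>n. g n \<in> borel_measurable borel"
  shows "curve_integral (\<lambda>x. \<Sum>n. g n x) c = (\<Sum>n. curve_integral (g n) c)"
  using curve_integrand_measurable[OF c g]
  by (simp add: curve_integral_def nn_integral_suminf[symmetric])

lemma curve_integral_add:
  fixes g h :: "'a::metric_space \<Rightarrow> ennreal"
  assumes c: "is_curve c" and g: "g \<in> borel_measurable borel" "h \<in> borel_measurable borel"
  shows "curve_integral (\<lambda>x. g x + h x) c = curve_integral g c + curve_integral h c"
  using curve_integrand_measurable[OF c g(1)] curve_integrand_measurable[OF c g(2)]
  by (simp add: curve_integral_def nn_integral_add[symmetric] distrib_right)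

lemma curve_integral_cmult:
  fixes g :: "'a::metric_space \<Rightarrow> ennreal"
  assumes c: "is_curve c" and g: "g \<in> borel_measurable borel"
  shows "curve_integral (\<lambda>x. k * g x) c = k * curve_integral g c"
  using curve_integrand_measurable[OF c g]
  by (simp add: curve_integral_def nn_integral_cmult[symmetric] mult.assoc)

text \<open>The parametrization is 1-Lipschitz, so an interval of length \<open>r\<close> containing
  \<open>s\<close> is mapped into the doubled ball. Starting at 0 or ending at \<open>s\<close>, it
  fits into the domain as soon as \<open>r \<le> fst c\<close>.\<close>

lemma curve_integral_ball_ge:
  assumes c: "is_curve c" and s: "s \<in> {0..fst c}" "snd c s \<in> ball x r" and r: "0 < r" "r \<le> fst c"
  shows "ennreal r \<le> curve_integral (indicator (ball x (2 * r))) c"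
proof -
  obtain a where a: "0 \<le> a" "a + r \<le> fst c" "a \<le> s" "s \<le> a + r"
  proof (cases "s \<le> r")
    case True then show ?thesis using that[of 0] s r by auto
  next
    case False then show ?thesis using that[of "s - r"] s r by auto
  qed
  have "ennreal r = (\<integral>\<^sup>+t. indicator {a..a + r} t \<partial>lborel)" using r by simp
  also have "\<dots> \<le> curve_integral (indicator (ball x (2 * r))) c"
    unfolding curve_integral_def
  proof (rule nn_integral_mono)
    fix t
    show "indicator {a..a + r} t \<le> (indicator (ball x (2 * r)) (snd c t) * indicator {0..fst c} t :: ennreal)"
    proof (cases "t \<in> {a..a + r}")
      case True
      then have "t \<in> {0..fst c}" "\<bar>s - t\<bar> \<le> r" using a by auto
      then have "dist x (snd c t) < 2 * r"
        using curve_lipschitz[OF c s(1), of t] s(2) dist_triangle[of x "snd c t" "snd c s"] by auto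
      with \<open>t \<in> {0..fst c}\<close> show ?thesis by (simp split: split_indicator)
    qed simp
  qed
  finally show ?thesis .
qed

lemma ball_indicator_measurable:
  "(\<lambda>z. a * indicator (ball x r) z :: ennreal) \<in> borel_measurable borel"
proof -
  have [measurable]: "ball x r \<in> sets borel" by simp
  show ?thesis by measurable
qed

lemma curve_dist_continuous:
  assumes "continuous_on \<Omega> f" "c \<in> curves_in \<Omega>"
  shows "continuous_on {0..fst c} (curve_dist f c)"
proof -
  have "continuous_on {0..fst c} (snd c)" "snd c ` {0..fst c} \<subseteq> \<Omega>"
    using assms by (auto simp: curves_in_def is_curve_def curve_image_def)
  from continuous_on_compose2[OF assms(1) this] show ?thesis
    unfolding curve_dist_def by (intro continuous_on_dist continuous_on_const)
qed

text \<open>By the intermediate value theorem the image contains the whole interval from 0 to the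
  end distance.\<close>

lemma end_dist_le_leb_outer:
  assumes f: "continuous_on \<Omega> f" and c: "c \<in> curves_in \<Omega>"
  shows "end_dist f c \<le> leb_outer (curve_dist f c ` {0..fst c})"
proof -
  have l: "0 \<le> fst c" using c by (simp add: curves_in_def is_curve_def)
  have sub: "{0..curve_dist f c (fst c)} \<subseteq> curve_dist f c ` {0..fst c}"
  proof
    fix y assume "y \<in> {0..curve_dist f c (fst c)}"
    then show "y \<in> curve_dist f c ` {0..fst c}"
      using IVT'[OF _ _ l curve_dist_continuous[OF f c], of y] by (auto simp: curve_dist_def)
  qed
  have "end_dist f c = leb_outer {0..curve_dist f c (fst c)}"
    by (simp add: end_dist_def curve_dist_def)
  also have "\<dots> \<le> leb_outer (curve_dist f c ` {0..fst c})" using sub by (rule outer_measure_of_mono)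
  finally show ?thesis .
qed

text \<open>\<open>dist p\<close> is 1-Lipschitz, so a set of diameter \<open>d\<close> goes into an
  interval of length \<open>2 * d\<close>. Only nullity is claimed, so covers at the single scale 1
  suffice.\<close>

lemma hausdorff1_null_imp_leb_outer_null:
  assumes "hausdorff1 S = 0"
  shows "leb_outer (dist p ` S) = 0"
proof -
  have "hausdorff1_pre 1 S \<le> hausdorff1 S" unfolding hausdorff1_def by (rule SUP_upper) simp
  then have pre: "hausdorff1_pre 1 S = 0" using assms by simp
  have "leb_outer (dist p ` S) \<le> 0 + ennreal e" if e: "0 < e" for e
  proof -
    have "hausdorff1_pre 1 S < ennreal (e / 2)" using pre e by simp
    then obtain A :: "nat \<Rightarrow> 'a set" where A: "S \<subseteq> (\<Union>i. A i)" "\<And>i. bounded (A i)"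
      "(\<Sum>i. ennreal (diameter (A i))) < ennreal (e / 2)"
      unfolding hausdorff1_pre_def INF_less_iff by auto
    have "leb_outer (dist p ` S) \<le> leb_outer (\<Union>i. dist p ` A i)"
      using A(1) by (intro outer_measure_of_mono) blast
    also have "\<dots> \<le> (\<Sum>i. leb_outer (dist p ` A i))" by (rule leb_outer_UN_le)
    also have "\<dots> \<le> (\<Sum>i. 2 * ennreal (diameter (A i)))"
    proof (intro suminf_le allI)
      fix i
      show "leb_outer (dist p ` A i) \<le> 2 * ennreal (diameter (A i))"
      proof (cases "A i = {}")
        case False
        then obtain a where a: "a \<in> A i" by blast
        let ?d = "diameter (A i)"
        have "dist p ` A i \<subseteq> {dist p a - ?d .. dist p a + ?d}"
        proof
          fix z assume "z \<in> dist p ` A i"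
          then obtain b where b: "b \<in> A i" "z = dist p b" by auto
          have "dist a b \<le> ?d" using diameter_bounded_bound[OF A(2) a b(1)] .
          moreover have "\<bar>dist p a - dist p b\<bar> \<le> dist a b"
            using dist_triangle[of p a b] dist_triangle[of p b a] by (simp add: dist_commute abs_le_iff)
          ultimately show "z \<in> {dist p a - ?d .. dist p a + ?d}" using b by auto
        qed
        then have "leb_outer (dist p ` A i) \<le> ennreal (2 * ?d)"
          using diameter_ge_0[OF A(2)[of i]] by (intro leb_outer_Icc_le) auto
        then show ?thesis using diameter_ge_0[OF A(2)[of i]] by (simp add: ennreal_mult)
      qed simp
    qed auto
    also have "\<dots> = 2 * (\<Sum>i. ennreal (diameter (A i)))" by simp
    also have "\<dots> \<le> 2 * ennreal (e / 2)" using A(3) by (intro mult_left_mono) auto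
    also have "\<dots> = ennreal e" using e by (simp add: ennreal_mult[symmetric] flip: ennreal_numeral)
    finally show ?thesis by simp
  qed
  then have "leb_outer (dist p ` S) \<le> 0" by (rule ennreal_le_epsilon)
  then show ?thesis by simp
qed

text \<open>Arc length makes \<open>snd c\<close> 1-Lipschitz, so a good radius for \<open>f\<close>
  at \<open>snd c s\<close> is also one for \<open>curve_dist f c\<close> at \<open>s\<close>, with
  \<open>lower_lip\<close> in the part of \<open>w\<close>.\<close>

lemma curve_image_le_lip_integral:
  assumes c: "c \<in> curves_in \<Omega>" and \<Phi>: "\<Phi> \<in> borel_measurable borel" and T: "T \<subseteq> {0..fst c}"
    and le: "\<And>s. s \<in> T \<Longrightarrow> lower_lip \<Omega> f (snd c s) \<le> \<Phi> (snd c s)"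
    and fin: "\<And>s. s \<in> T \<Longrightarrow> lower_lip \<Omega> f (snd c s) < \<infinity>"
  shows "leb_outer (curve_dist f c ` T) \<le> 4 * curve_integral \<Phi> c"
proof -
  have cc: "is_curve c" and im: "\<And>s. s \<in> {0..fst c} \<Longrightarrow> snd c s \<in> \<Omega>"
    using c by (auto simp: curves_in_def curve_image_def)
  define \<phi> where "\<phi> s = \<Phi> (snd c s) * indicator {0..fst c} s" for s
  have "leb_outer (curve_dist f c ` T) \<le> 4 * (\<integral>\<^sup>+s\<in>{0..fst c}. \<phi> s \<partial>lborel)"
  proof (rule leb_outer_image_le_integral[OF T])
    show "\<phi> \<in> borel_measurable borel"
      unfolding \<phi>_def using curve_integrand_measurable[OF cc \<Phi>] .
    show "lower_lip \<Omega> f (snd c s) \<le> \<phi> s" if "s \<in> T" for s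
      using le[OF that] that T by (auto simp: \<phi>_def)
    show "lower_lip \<Omega> f (snd c s) < \<infinity>" if "s \<in> T" for s using fin[OF that] .
    fix s t \<delta> :: real
    assume s: "s \<in> T" and "lower_lip \<Omega> f (snd c s) < ennreal t" "0 < \<delta>"
    then obtain r where r: "0 < r" "r < \<delta>" "\<And>y. y \<in> \<Omega> \<Longrightarrow> dist y (snd c s) < r \<Longrightarrow> dist (f y) (f (snd c s)) \<le> t * r"
      using lower_lip_less by blast
    show "\<exists>r. 0 < r \<and> r < \<delta> \<and> (\<forall>s'\<in>{0..fst c}. \<bar>s' - s\<bar> < r \<longrightarrow> \<bar>curve_dist f c s' - curve_dist f c s\<bar> \<le> t * r)"
    proof (intro exI[of _ r] conjI ballI impI r(1,2))
      fix s' assume s': "s' \<in> {0..fst c}" "\<bar>s' - s\<bar> < r"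
      have "dist (snd c s') (snd c s) < r"
        using curve_lipschitz[OF cc s'(1), of s] s T s'(2) by auto
      then have "dist (f (snd c s')) (f (snd c s)) \<le> t * r" using r(3) im s' by blast
      moreover have "\<bar>curve_dist f c s' - curve_dist f c s\<bar> \<le> dist (f (snd c s')) (f (snd c s))"
        unfolding curve_dist_def
        using dist_triangle[of "f (snd c 0)" "f (snd c s')" "f (snd c s)"]
          dist_triangle[of "f (snd c 0)" "f (snd c s)" "f (snd c s')"] by (simp add: dist_commute abs_le_iff)
      ultimately show "\<bar>curve_dist f c s' - curve_dist f c s\<bar> \<le> t * r" by linarith
    qed
  qed
  also have "(\<integral>\<^sup>+s\<in>{0..fst c}. \<phi> s \<partial>lborel) = curve_integral \<Phi> c"
    unfolding curve_integral_def \<phi>_def by (intro nn_integral_cong) (simp split: split_indicator)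
  finally show ?thesis .
qed

text \<open>A ball met by the curve contributes at most \<open>2 * L n\<close> to the image, while
  the curve spends length at least \<open>r n\<close> in the doubled ball; the weight is the
  quotient. Radius 0 stands for an absent ball.\<close>

lemma curve_image_le_ball_sum:
  assumes c: "c \<in> curves_in \<Omega>" and T: "T \<subseteq> {0..fst c}" "snd c ` T \<subseteq> (\<Union>n. ball (x n) (r n))"
    and r: "\<And>n. r n \<le> fst c" and L: "\<And>n. 0 \<le> L n"
    and osc: "\<And>n. 0 < r n \<Longrightarrow> x n \<in> \<Omega> \<and> (\<forall>y\<in>\<Omega>. dist y (x n) < r n \<longrightarrow> dist (f y) (f (x n)) \<le> L n)"
  shows "leb_outer (curve_dist f c ` T)
    \<le> curve_integral (\<lambda>z. \<Sum>n. ennreal (2 * L n / r n) * indicator (ball (x n) (2 * r n)) z) c"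
proof -
  have cc: "is_curve c" and im: "\<And>s. s \<in> {0..fst c} \<Longrightarrow> snd c s \<in> \<Omega>"
    using c by (auto simp: curves_in_def curve_image_def)
  define P where "P n = {s\<in>T. snd c s \<in> ball (x n) (r n)}" for n
  have "curve_dist f c ` T \<subseteq> (\<Union>n. curve_dist f c ` P n)"
  proof
    fix z assume "z \<in> curve_dist f c ` T"
    then obtain s where s: "s \<in> T" "z = curve_dist f c s" by auto
    then obtain n where "snd c s \<in> ball (x n) (r n)" using T(2) by blast
    with s have "s \<in> P n" by (simp add: P_def)
    with s(2) show "z \<in> (\<Union>n. curve_dist f c ` P n)" by blast
  qed
  then have "leb_outer (curve_dist f c ` T) \<le> leb_outer (\<Union>n. curve_dist f c ` P n)"
    by (rule outer_measure_of_mono)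
  also have "\<dots> \<le> (\<Sum>n. leb_outer (curve_dist f c ` P n))" by (rule leb_outer_UN_le)
  also have "\<dots> \<le> (\<Sum>n. curve_integral (\<lambda>z. ennreal (2 * L n / r n) * indicator (ball (x n) (2 * r n)) z) c)"
  proof (intro suminf_le allI)
    fix n
    show "leb_outer (curve_dist f c ` P n)
      \<le> curve_integral (\<lambda>z. ennreal (2 * L n / r n) * indicator (ball (x n) (2 * r n)) z) c"
    proof (cases "P n = {}")
      case False
      then obtain s where s: "s \<in> T" "snd c s \<in> ball (x n) (r n)" by (auto simp: P_def)
      then have rn: "0 < r n" by (auto intro: le_less_trans[OF zero_le_dist])
      define a where "a = dist (f (snd c 0)) (f (x n))"
      have "curve_dist f c ` P n \<subseteq> {a - L n .. a + L n}"
      proof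
        fix z assume "z \<in> curve_dist f c ` P n"
        then obtain s where s: "s \<in> T" "dist (x n) (snd c s) < r n" "z = curve_dist f c s" by (auto simp: P_def)
        moreover from this have "snd c s \<in> \<Omega>" using im T(1) by blast
        ultimately have "dist (f (snd c s)) (f (x n)) \<le> L n"
          using osc[OF rn] by (metis dist_commute)
        then have "\<bar>z - a\<bar> \<le> L n"
          unfolding \<open>z = curve_dist f c s\<close> curve_dist_def a_def
          using dist_triangle[of "f (snd c 0)" "f (snd c s)" "f (x n)"]
            dist_triangle[of "f (snd c 0)" "f (x n)" "f (snd c s)"] by (simp add: dist_commute abs_le_iff)
        then show "z \<in> {a - L n .. a + L n}" by auto
      qed
      then have "leb_outer (curve_dist f c ` P n) \<le> ennreal (2 * L n)"
        using L[of n] by (intro leb_outer_Icc_le) auto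
      also have "\<dots> = ennreal (2 * L n / r n) * ennreal (r n)"
        using rn L[of n] by (simp add: ennreal_mult[symmetric])
      also have "\<dots> \<le> ennreal (2 * L n / r n) * curve_integral (indicator (ball (x n) (2 * r n))) c"
        using s T(1) rn r[of n] by (intro mult_left_mono curve_integral_ball_ge[OF cc, of s]) auto
      also have "\<dots> = curve_integral (\<lambda>z. ennreal (2 * L n / r n) * indicator (ball (x n) (2 * r n)) z) c"
        by (rule curve_integral_cmult[OF cc, symmetric]) (intro borel_measurable_indicator borel_open open_ball)
      finally show ?thesis .
    qed simp
  qed auto
  also have "\<dots> = curve_integral (\<lambda>z. \<Sum>n. ennreal (2 * L n / r n) * indicator (ball (x n) (2 * r n)) z) c"
    by (rule curve_integral_suminf[OF cc, symmetric]) (rule ball_indicator_measurable)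
  finally show ?thesis .
qed

section \<open>Coverings with controlled images\<close>

text \<open>
  On the image side the ball of radius \<open>s\<close> has at most half the radius that the lower dilatation
  permits: balls of this size around the images of \<open>x\<close> and \<open>x'\<close> are disjoint as soon as the distance
  of \<open>x\<close> and \<open>x'\<close> is at least both radii.
\<close>

definition image_controlled ::
  "('a::metric_space set \<Rightarrow> ennreal) \<Rightarrow> ('b::metric_space set \<Rightarrow> ennreal) \<Rightarrow> 'a set \<Rightarrow> ('a \<Rightarrow> 'b) \<Rightarrow> real \<Rightarrow> 'a \<Rightarrow> bool" where
  "image_controlled \<mu> \<nu> \<Omega> f K x \<longleftrightarrow>
     (\<forall>\<delta>>0. \<exists>r s L. 0 < r \<and> r < \<delta> \<and> 0 < s \<and> s < \<delta> \<and> 0 \<le> L \<and>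
        (\<forall>y\<in>\<Omega>. r \<le> dist y x \<longrightarrow> 2 * s \<le> dist (f y) (f x)) \<and>
        (\<forall>y\<in>\<Omega>. dist y x < r \<longrightarrow> dist (f y) (f x) \<le> L) \<and>
        ennreal L * \<mu> (ball x (2 * r)) \<le> ennreal (K * r) * \<nu> (ball (f x) s))"

lemma image_controlled_mono:
  assumes "image_controlled \<mu> \<nu> \<Omega> f K x" "K \<le> K'"
  shows "image_controlled \<mu> \<nu> \<Omega> f K' x"
  unfolding image_controlled_def
proof (intro allI impI)
  fix \<delta> :: real assume "0 < \<delta>"
  with assms(1) obtain r s L where *: "0 < r" "r < \<delta>" "0 < s" "s < \<delta>" "0 \<le> L"
        "\<forall>y\<in>\<Omega>. r \<le> dist y x \<longrightarrow> 2 * s \<le> dist (f y) (f x)"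
        "\<forall>y\<in>\<Omega>. dist y x < r \<longrightarrow> dist (f y) (f x) \<le> L"
        "ennreal L * \<mu> (ball x (2 * r)) \<le> ennreal (K * r) * \<nu> (ball (f x) s)"
    unfolding image_controlled_def by metis
  have "ennreal (K * r) * \<nu> (ball (f x) s) \<le> ennreal (K' * r) * \<nu> (ball (f x) s)"
    using assms(2) * by (intro mult_right_mono ennreal_leI mult_right_mono) auto
  with * show "\<exists>r s L. 0 < r \<and> r < \<delta> \<and> 0 < s \<and> s < \<delta> \<and> 0 \<le> L \<and>
        (\<forall>y\<in>\<Omega>. r \<le> dist y x \<longrightarrow> 2 * s \<le> dist (f y) (f x)) \<and>
        (\<forall>y\<in>\<Omega>. dist y x < r \<longrightarrow> dist (f y) (f x) \<le> L) \<and>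
        ennreal L * \<mu> (ball x (2 * r)) \<le> ennreal (K' * r) * \<nu> (ball (f x) s)"
    by (meson order_trans)
qed

text \<open>Doubling in the form in which \<open>overlap_card_le\<close> consumes it.\<close>

definition quarter_cover_bound :: "'a::metric_space set \<Rightarrow> nat \<Rightarrow> bool" where
  "quarter_cover_bound S N \<longleftrightarrow> 1 \<le> N \<and> (\<forall>x\<in>S. \<forall>r>0. \<exists>C\<subseteq>S. finite C \<and> card C \<le> N \<and> ball x r \<inter> S \<subseteq> (\<Union>c\<in>C. ball c (r / 4)))"

lemma metric_doubling_quarter_cover_bound:
  assumes "metric_doubling S" obtains N where "quarter_cover_bound S N"
proof -
  obtain N where N: "\<And>x r. x \<in> S \<Longrightarrow> 0 < r \<Longrightarrow>
    \<exists>C\<subseteq>S. finite C \<and> card C \<le> N \<and> ball x r \<inter> S \<subseteq> (\<Union>c\<in>C. ball c (r / 4))"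
    by (rule metric_doubling_iterate[OF assms]) (rule that; blast)
  have "quarter_cover_bound S (max N 1)"
    unfolding quarter_cover_bound_def using N by (meson le_max_iff_disj order_refl)
  then show ?thesis by (rule that)
qed

section \<open>Dyadic level sets and Borel majorants\<close>

lemma disjoint_family_dyadic_levels:
  "disjoint_family (\<lambda>j. {x\<in>S. ennreal (2^j) \<le> G x \<and> G x < ennreal (2^Suc j)})"
proof (unfold disjoint_family_on_def, intro ballI impI)
  let ?B = "\<lambda>j. {x\<in>S. ennreal (2^j) \<le> G x \<and> G x < ennreal (2^Suc j)}"
  have *: "?B i \<inter> ?B j = {}" if "i < j" for i j
  proof -
    have "ennreal (2^Suc i) \<le> ennreal (2^j)" using that by (intro ennreal_leI power_increasing) auto
    then have "\<not> (G x < ennreal (2^Suc i) \<and> ennreal (2^j) \<le> G x)" for x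
      by (meson leD order_trans)
    then show ?thesis by blast
  qed
  show "?B i \<inter> ?B j = {}" if "i \<noteq> j" for i j using *[of i j] *[of j i] that by (cases "i < j") auto
qed

lemma dyadic_level_ex:
  assumes "1 \<le> a" "a < (\<infinity>::ennreal)"
  shows "\<exists>j. ennreal (2^j) \<le> a \<and> a < ennreal (2^Suc j)"
proof -
  obtain b where b: "a = ennreal b" "1 \<le> b" using assms by (cases a rule: ennreal_cases) auto
  obtain n where "b < 2^n" using real_arch_pow[of 2 b] by auto
  define k where "k = (LEAST n. b < 2^n)"
  have k: "b < 2^k" unfolding k_def by (rule LeastI) fact
  have "k \<noteq> 0" using k b by (intro notI) simp
  then obtain m where m: "k = Suc m" by (cases k) auto
  have "\<not> b < 2^m" using not_less_Least[of m "\<lambda>n. b < 2^n"] m by (simp add: k_def)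
  with k b m show ?thesis by (intro exI[of _ m]) (auto intro!: ennreal_leI ennreal_lessI simp del: power_Suc)
qed

text \<open>Neither \<open>S\<close> nor \<open>\<psi>\<close> is assumed measurable. Each level set
  is replaced by a Borel hull of the same measure, weighted with the upper end of the level; the
  hulls may overlap. The summand 1 in \<open>\<Phi>\<close> covers the points with
  \<open>\<psi> < 1\<close>, at cost \<open>\<mu> \<Omega>\<close>.\<close>

lemma borel_majorant:
  fixes \<mu> :: "'a::metric_space set \<Rightarrow> ennreal"
  assumes \<mu>: "metric_measure \<mu>" and \<Omega>: "open \<Omega>" "\<mu> \<Omega> < \<infinity>"
    and fin: "(\<Sum>j. ennreal (2^j) * \<mu> (S \<inter> {x. ennreal (2^j) \<le> \<psi> x \<and> \<psi> x < ennreal (2^Suc j)})) < \<infinity>"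
  obtains \<Phi> where "\<Phi> \<in> borel_measurable borel" "(\<integral>\<^sup>+x\<in>\<Omega>. \<Phi> x \<partial>caratheodory_measure UNIV \<mu>) < \<infinity>"
    "\<And>x. x \<in> S \<Longrightarrow> \<psi> x < \<infinity> \<Longrightarrow> \<psi> x \<le> \<Phi> x"
proof -
  let ?M = "caratheodory_measure UNIV \<mu>"
  define A where "A j = S \<inter> {x. ennreal (2^j) \<le> \<psi> x \<and> \<psi> x < ennreal (2^Suc j)}" for j
  have "\<forall>j. \<exists>B. B \<in> sets borel \<and> A j \<subseteq> B \<and> \<mu> B = \<mu> (A j)" using metric_measure_hull[OF \<mu>] by metis
  then obtain B where B: "\<And>j. B j \<in> sets borel" "\<And>j. A j \<subseteq> B j" "\<And>j. \<mu> (B j) = \<mu> (A j)" by metis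
  note [measurable] = B(1)
  define \<Phi> where "\<Phi> x = 1 + (\<Sum>j. ennreal (2^Suc j) * indicator (B j) x)" for x
  have \<Phi>: "\<Phi> \<in> borel_measurable borel" unfolding \<Phi>_def by measurable
  have hm: "(\<lambda>x. ennreal (2^Suc j) * indicator (B j) x) \<in> borel_measurable ?M" for j
    by (rule metric_measure_borel_measurable[OF \<mu>]) measurable
  have im: "indicator \<Omega> \<in> borel_measurable ?M"
    using \<Omega> by (intro borel_measurable_indicator metric_measure_borel[OF \<mu>]) auto
  have "(\<integral>\<^sup>+x\<in>\<Omega>. \<Phi> x \<partial>?M) \<le> (\<integral>\<^sup>+x. indicator \<Omega> x + (\<Sum>j. ennreal (2^Suc j) * indicator (B j) x) \<partial>?M)"
    by (intro nn_integral_mono) (simp add: \<Phi>_def split: split_indicator)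
  also have "\<dots> = (\<integral>\<^sup>+x. indicator \<Omega> x \<partial>?M) + (\<integral>\<^sup>+x. (\<Sum>j. ennreal (2^Suc j) * indicator (B j) x) \<partial>?M)"
    using im hm by (intro nn_integral_add) auto
  also have "(\<integral>\<^sup>+x. indicator \<Omega> x \<partial>?M) = \<mu> \<Omega>" using \<Omega> by (simp add: metric_measure_borel[OF \<mu>])
  also have "(\<integral>\<^sup>+x. (\<Sum>j. ennreal (2^Suc j) * indicator (B j) x) \<partial>?M) = (\<Sum>j. ennreal (2^Suc j) * \<mu> (A j))"
    using hm B by (subst nn_integral_suminf) (auto simp: nn_integral_cmult_indicator metric_measure_borel[OF \<mu>] simp del: power_Suc)
  also have "\<dots> = (\<Sum>j. 2 * (ennreal (2^j) * \<mu> (A j)))"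
    by (simp add: ennreal_mult mult.assoc)
  also have "\<dots> = 2 * (\<Sum>j. ennreal (2^j) * \<mu> (A j))" by simp
  also have "\<mu> \<Omega> + \<dots> < \<infinity>"
    using \<Omega>(2) fin by (simp add: A_def ennreal_mult_less_top)
  finally have int: "(\<integral>\<^sup>+x\<in>\<Omega>. \<Phi> x \<partial>?M) < \<infinity>" .
  show ?thesis
  proof (rule that[OF \<Phi> int])
    show "\<psi> x \<le> \<Phi> x" if x: "x \<in> S" "\<psi> x < \<infinity>" for x
    proof (cases "1 \<le> \<psi> x")
      case True
      from dyadic_level_ex[OF this x(2)] obtain j where j: "ennreal (2^j) \<le> \<psi> x" "\<psi> x < ennreal (2^Suc j)" by blast
      then have "x \<in> B j" using x(1) B(2)[of j] by (auto simp: A_def)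
      have "\<psi> x \<le> ennreal (2^Suc j) * indicator (B j) x" using j \<open>x \<in> B j\<close> by simp
      also have "\<dots> \<le> (\<Sum>j. ennreal (2^Suc j) * indicator (B j) x)"
      proof -
        have *: "sum h {j} \<le> suminf h" for h :: "nat \<Rightarrow> ennreal"
          by (rule sum_le_suminf) auto
        then have "h j \<le> suminf h" for h :: "nat \<Rightarrow> ennreal"
          using *[of h] by simp
        then show ?thesis .
      qed
      also have "\<dots> \<le> \<Phi> x" by (simp add: \<Phi>_def)
      finally show ?thesis .
    next
      case False
      then have "\<psi> x \<le> 1" by simp
      also have "1 \<le> \<Phi> x" by (simp add: \<Phi>_def)
      finally show ?thesis .
    qed
  qed
qed

context
  fixes \<mu> :: "'a::metric_space set \<Rightarrow> ennreal" and \<nu> :: "'b::metric_space set \<Rightarrow> ennreal"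
    and \<Omega> :: "'a set" and f :: "'a \<Rightarrow> 'b" and N :: nat
  assumes \<mu>: "metric_measure \<mu>" and \<nu>: "metric_measure \<nu>"
    and tb: "totally_bounded \<Omega>" and N: "quarter_cover_bound \<Omega> N"
begin

text \<open>The covering behind all later estimates. The free bound \<open>\<eta>\<close> on the
  radii serves once to exclude radii of small oscillation and once to stay below the length of a
  curve.\<close>

lemma controlled_cover:
  assumes A: "A \<subseteq> \<Omega>" "\<forall>x\<in>A. image_controlled \<mu> \<nu> \<Omega> f K x"
    and W: "open W" "f ` A \<subseteq> W" and \<eta>: "\<forall>x\<in>A. 0 < \<eta> x" and K: "0 \<le> K"
  shows "\<exists>(x :: nat \<Rightarrow> 'a) r s L. A \<subseteq> (\<Union>n. ball (x n) (r n)) \<and>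
    (\<forall>n. 0 \<le> r n \<and> 0 \<le> L n \<and>
      (0 < r n \<longrightarrow> x n \<in> A \<and> r n < \<eta> (x n) \<and> (\<forall>y\<in>\<Omega>. dist y (x n) < r n \<longrightarrow> dist (f y) (f (x n)) \<le> L n)) \<and>
      ennreal (2 * L n / r n) * \<mu> (ball (x n) (2 * r n)) \<le> ennreal (2 * K) * \<nu> (ball (f (x n)) (s n))) \<and>
    (\<Sum>n. \<nu> (ball (f (x n)) (s n))) \<le> of_nat N * \<nu> W"
proof -
  define good where "good x r s L \<longleftrightarrow> 0 < r \<and> r < 1 \<and> r < \<eta> x \<and> 0 < s \<and> ball (f x) s \<subseteq> W \<and> 0 \<le> L \<and>
        (\<forall>y\<in>\<Omega>. r \<le> dist y x \<longrightarrow> 2 * s \<le> dist (f y) (f x)) \<and>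
        (\<forall>y\<in>\<Omega>. dist y x < r \<longrightarrow> dist (f y) (f x) \<le> L) \<and>
        ennreal L * \<mu> (ball x (2 * r)) \<le> ennreal (K * r) * \<nu> (ball (f x) s)" for x r s L
  have "\<exists>r s L. good x r s L" if x: "x \<in> A" for x
  proof -
    from W x obtain d where d: "0 < d" "ball (f x) d \<subseteq> W" by (meson imageI openE subsetD)
    define \<delta> where "\<delta> = min d (min 1 (\<eta> x))"
    have "0 < \<delta>" using d \<eta> x by (simp add: \<delta>_def)
    with bspec[OF A(2) x] obtain r s L where *: "0 < r" "r < \<delta>" "0 < s" "s < \<delta>" "0 \<le> L"
        "\<forall>y\<in>\<Omega>. r \<le> dist y x \<longrightarrow> 2 * s \<le> dist (f y) (f x)"
        "\<forall>y\<in>\<Omega>. dist y x < r \<longrightarrow> dist (f y) (f x) \<le> L"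
        "ennreal L * \<mu> (ball x (2 * r)) \<le> ennreal (K * r) * \<nu> (ball (f x) s)"
      unfolding image_controlled_def by metis
    have "ball (f x) s \<subseteq> ball (f x) d" using * by (intro subset_ball) (simp add: \<delta>_def)
    with d have "ball (f x) s \<subseteq> W" by blast
    with * show ?thesis unfolding good_def by (intro exI[of _ r] exI[of _ s] exI[of _ L]) (simp add: \<delta>_def)
  qed
  then obtain r s L where good: "\<And>x. x \<in> A \<Longrightarrow> good x (r x) (s x) (L x)" by metis
  then have r: "\<And>x. x \<in> A \<Longrightarrow> 0 < r x \<and> r x < 1" "\<And>x. x \<in> A \<Longrightarrow> r x < \<eta> x"
    and s: "\<And>x. x \<in> A \<Longrightarrow> 0 < s x" "\<And>x. x \<in> A \<Longrightarrow> ball (f x) (s x) \<subseteq> W"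
      "\<And>x y. x \<in> A \<Longrightarrow> y \<in> \<Omega> \<Longrightarrow> r x \<le> dist y x \<Longrightarrow> 2 * s x \<le> dist (f y) (f x)"
    and L: "\<And>x. x \<in> A \<Longrightarrow> 0 \<le> L x" "\<And>x y. x \<in> A \<Longrightarrow> y \<in> \<Omega> \<Longrightarrow> dist y x < r x \<Longrightarrow> dist (f y) (f x) \<le> L x"
      "\<And>x. x \<in> A \<Longrightarrow> ennreal (L x) * \<mu> (ball x (2 * r x)) \<le> ennreal (K * r x) * \<nu> (ball (f x) (s x))"
    unfolding good_def by blast+
  have "totally_bounded A"
    using tb A(1) unfolding totally_bounded_iff_balls by (meson order_trans)
  note sel = ball_selection_seq[of A r, OF this, OF r(1)]
  obtain x :: "nat \<Rightarrow> 'a" and I where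
    x: "inj_on x I" "x ` I \<subseteq> A" "A \<subseteq> (\<Union>i\<in>I. ball (x i) (r (x i)))"
    "\<And>i j. i \<in> I \<Longrightarrow> j \<in> I \<Longrightarrow> i \<noteq> j \<Longrightarrow> dyadic_separated r (x i) (x j)"
    using sel that by metis
  have xA: "x i \<in> A" if "i \<in> I" for i using x(2) that by auto
  \<comment> \<open>Outside \<open>I\<close> all three values are 0, so that the balls are empty and
    the weights vanish.\<close>
  define r' where "r' n = (if n \<in> I then r (x n) else 0)" for n
  define s' where "s' n = (if n \<in> I then s (x n) else 0)" for n
  define L' where "L' n = (if n \<in> I then L (x n) else 0)" for n
  let ?B = "\<lambda>n. ball (f (x n)) (s' n)"
  have cover: "A \<subseteq> (\<Union>n. ball (x n) (r' n))"
    proof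
      fix z assume "z \<in> A"
      then obtain i where "i \<in> I" "z \<in> ball (x i) (r (x i))" using x(3) by blast
      then have "z \<in> ball (x i) (r' i)" by (simp add: r'_def)
      then show "z \<in> (\<Union>n. ball (x n) (r' n))" by blast
    qed
    have r'0: "0 \<le> r' n" for n using r(1) xA by (auto simp: r'_def intro: less_imp_le)
    have L'0: "0 \<le> L' n" for n using L(1) xA by (auto simp: L'_def)
    have osc': "x n \<in> A \<and> r' n < \<eta> (x n) \<and> (\<forall>y\<in>\<Omega>. dist y (x n) < r' n \<longrightarrow> dist (f y) (f (x n)) \<le> L' n)" if "0 < r' n" for n
    proof -
      have "n \<in> I" using that by (simp add: r'_def split: if_splits)
      then show ?thesis using xA r(2) L(2) by (simp add: r'_def L'_def)
    qed
    have term': "ennreal (2 * L' n / r' n) * \<mu> (ball (x n) (2 * r' n)) \<le> ennreal (2 * K) * \<nu> (?B n)" for n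
    proof (cases "n \<in> I")
      case True
      note xn = xA[OF True]
      have rp: "0 < r (x n)" using r(1)[OF xn] by simp
      have "ennreal (2 * L (x n) / r (x n)) * \<mu> (ball (x n) (2 * r (x n)))
        = ennreal (2 / r (x n)) * (ennreal (L (x n)) * \<mu> (ball (x n) (2 * r (x n))))"
        using rp L(1)[OF xn] by (simp add: ennreal_mult[symmetric] mult.assoc[symmetric])
      also have "\<dots> \<le> ennreal (2 / r (x n)) * (ennreal (K * r (x n)) * \<nu> (ball (f (x n)) (s (x n))))"
        using L(3)[OF xn] by (rule mult_left_mono) simp
      also have "\<dots> = ennreal (2 * K) * \<nu> (ball (f (x n)) (s (x n)))"
        using rp K by (simp add: ennreal_mult[symmetric] mult.assoc[symmetric])
      finally show ?thesis using True by (simp add: r'_def s'_def L'_def)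
    qed (simp add: L'_def)
    \<comment> \<open>If two image balls share \<open>y\<close>, their centres are less than
      \<open>s a + s b\<close> apart. Were \<open>dist a b\<close> at least both radii, the centres
      would be at least \<open>2 * s a\<close> and \<open>2 * s b\<close> apart.\<close>
    have count: "finite {n. y \<in> ?B n} \<and> card {n. y \<in> ?B n} \<le> N" for y
    proof -
      let ?J = "{n. y \<in> ?B n}"
      have JI: "?J \<subseteq> I" by (auto simp: s'_def split: if_splits intro: le_less_trans[OF zero_le_dist])
      have inj: "inj_on x ?J" using x(1) JI by (rule inj_on_subset)
      have "finite (x ` ?J) \<and> card (x ` ?J) \<le> N"
      proof (rule overlap_card_le[of \<Omega> N "x ` ?J" r])
        show "x ` ?J \<subseteq> \<Omega>" using JI x(2) A(1) by blast
        show "1 \<le> N" "\<And>x \<rho>. x \<in> \<Omega> \<Longrightarrow> 0 < \<rho> \<Longrightarrow>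
            \<exists>C\<subseteq>\<Omega>. finite C \<and> card C \<le> N \<and> ball x \<rho> \<inter> \<Omega> \<subseteq> (\<Union>c\<in>C. ball c (\<rho> / 4))"
          using N unfolding quarter_cover_bound_def by auto
        fix a b assume "a \<in> x ` ?J" "b \<in> x ` ?J" and ne: "a \<noteq> b"
        then obtain i j where ij: "y \<in> ?B i" "y \<in> ?B j" "a = x i" "b = x j" "i \<in> I" "j \<in> I" using JI by blast
        with ne have "i \<noteq> j" by auto
        with x(4) ij show "dyadic_separated r a b" by blast
        note aA = xA[OF ij(5), folded ij(3)]
        note bA = xA[OF ij(6), folded ij(4)]
        have "dist (f a) y < s a" "dist (f b) y < s b"
          using ij by (auto simp: s'_def)
        then have lt: "dist (f a) (f b) < s a + s b"
          using dist_triangle2[of "f a" "f b" y] by linarith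
        show "dist a b < max (r a) (r b)"
        proof (rule ccontr)
          assume "\<not> ?thesis"
          then have "r a \<le> dist b a" "r b \<le> dist a b" by (auto simp: dist_commute)
          then have "2 * s a \<le> dist (f b) (f a)" "2 * s b \<le> dist (f a) (f b)"
            using s(3)[OF aA, of b] s(3)[OF bA, of a] aA bA A(1) by auto
          with lt show False by (simp add: dist_commute)
        qed
      qed
      with inj show ?thesis by (auto simp: finite_image_iff card_image)
    qed
    let ?M = "caratheodory_measure UNIV \<nu>"
    have BW: "?B n \<subseteq> W" for n using s(2) xA by (auto simp: s'_def)
    have Bm: "?B n \<in> sets ?M" and Wm: "W \<in> sets ?M" for n
      using W by (auto intro!: metric_measure_borel[OF \<nu>])
    have "(\<Sum>n. \<nu> (?B n)) = (\<Sum>n. \<integral>\<^sup>+y. indicator (?B n) y \<partial>?M)"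
      using Bm by (simp add: metric_measure_borel[OF \<nu>])
    also have "\<dots> = (\<integral>\<^sup>+y. (\<Sum>n. indicator (?B n) y) \<partial>?M)"
      using Bm by (intro nn_integral_suminf[symmetric]) auto
    also have "\<dots> \<le> (\<integral>\<^sup>+y. of_nat N * indicator W y \<partial>?M)"
    proof (rule nn_integral_mono)
      fix y
      have "(\<Sum>n. indicator (?B n) y :: ennreal) = (\<Sum>n\<in>{n. y \<in> ?B n}. indicator (?B n) y)"
        using count[of y] by (intro suminf_finite) auto
      also have "\<dots> = of_nat (card {n. y \<in> ?B n})" by simp
      also have "\<dots> \<le> of_nat N * indicator W y"
      proof (cases "y \<in> W")
        case True then show ?thesis using count[of y] by simp
      next
        case False
        then have "{n. y \<in> ?B n} = {}" using BW by blast
        then show ?thesis by simp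
      qed
      finally show "(\<Sum>n. indicator (?B n) y :: ennreal) \<le> of_nat N * indicator W y" .
    qed
    also have "\<dots> = of_nat N * \<nu> W"
      using Wm W by (simp add: nn_integral_cmult_indicator metric_measure_borel[OF \<nu>])
    finally have sum': "(\<Sum>n. \<nu> (?B n)) \<le> of_nat N * \<nu> W" .
    have "\<forall>n. 0 \<le> r' n \<and> 0 \<le> L' n \<and>
      (0 < r' n \<longrightarrow> x n \<in> A \<and> r' n < \<eta> (x n) \<and> (\<forall>y\<in>\<Omega>. dist y (x n) < r' n \<longrightarrow> dist (f y) (f (x n)) \<le> L' n)) \<and>
      ennreal (2 * L' n / r' n) * \<mu> (ball (x n) (2 * r' n)) \<le> ennreal (2 * K) * \<nu> (ball (f (x n)) (s' n))"
      by (rule allI, rule conjI[OF r'0 conjI[OF L'0 conjI[OF impI[OF osc'] term']]])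
    from conjI[OF cover conjI[OF this sum']] show ?thesis
      by (intro exI)
qed

text \<open>A weak-type estimate: where \<open>lower_lip\<close> exceeds \<open>t\<close>, all small
  radii have \<open>t \<le> 2 * L / r\<close>, so \<open>t\<close> times the measure of a covering
  ball is bounded by its term in \<open>controlled_cover\<close>; then \<open>W\<close> shrinks to
  the image of \<open>A\<close>.\<close>

lemma lip_superlevel_measure_le:
  assumes A: "A \<subseteq> \<Omega>" "\<And>x. x \<in> A \<Longrightarrow> image_controlled \<mu> \<nu> \<Omega> f K x" and K: "0 \<le> K"
    and t: "0 < t" "\<And>x. x \<in> A \<Longrightarrow> ennreal t < lower_lip \<Omega> f x"
  shows "ennreal t * \<mu> A \<le> ennreal (2 * K) * (of_nat N * \<nu> (f ` A))"
proof (rule ennreal_le_epsilon)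
  fix e :: real assume e: "0 < e"
  define e' where "e' = e / (2 * K * real N + 1)"
  have "0 < 2 * K * real N + 1" using K by (simp add: add_nonneg_pos)
  then have e': "0 < e'" "2 * K * (real N * e') \<le> e" using e by (simp_all add: e'_def field_simps)
  obtain W where W: "open W" "f ` A \<subseteq> W" "\<nu> W \<le> \<nu> (f ` A) + ennreal e'"
    using metric_measure_open_superset[OF \<nu> e'(1)] by blast
  \<comment> \<open>The bound \<open>t / 2\<close> compensates the factor 2 in
    \<open>lower_lip_le\<close>.\<close>
  have "\<exists>\<eta>>0. \<forall>r. 0 < r \<and> r < \<eta> \<longrightarrow> \<not> (\<forall>y\<in>\<Omega>. dist y x < r \<longrightarrow> dist (f y) (f x) \<le> t / 2 * r)" if "x \<in> A" for x
  proof (rule ccontr)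
    assume "\<not> ?thesis"
    then have "\<And>\<delta>. 0 < \<delta> \<Longrightarrow> \<exists>r. 0 < r \<and> r < \<delta> \<and> (\<forall>y\<in>\<Omega>. dist y x < r \<longrightarrow> dist (f y) (f x) \<le> t / 2 * r)"
      by blast
    then have "lower_lip \<Omega> f x \<le> ennreal (2 * (t / 2))" using t by (intro lower_lip_le) auto
    with t(2)[OF that] show False by simp
  qed
  then obtain \<eta> where \<eta>: "\<And>x. x \<in> A \<Longrightarrow> 0 < \<eta> x"
    "\<And>x r. x \<in> A \<Longrightarrow> 0 < r \<Longrightarrow> r < \<eta> x \<Longrightarrow> \<not> (\<forall>y\<in>\<Omega>. dist y x < r \<longrightarrow> dist (f y) (f x) \<le> t / 2 * r)"
    by metis
  have "\<forall>x\<in>A. image_controlled \<mu> \<nu> \<Omega> f K x" "\<forall>x\<in>A. 0 < \<eta> x"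
    using A(2) \<eta>(1) by blast+
  from controlled_cover[where \<eta> = \<eta>, OF A(1) this(1) W(1,2) this(2) K]
  obtain x r s L where c': "A \<subseteq> (\<Union>n. ball (x n) (r n))"
    "\<forall>n. 0 \<le> r n \<and> 0 \<le> L n \<and>
      (0 < r n \<longrightarrow> x n \<in> A \<and> r n < \<eta> (x n) \<and> (\<forall>y\<in>\<Omega>. dist y (x n) < r n \<longrightarrow> dist (f y) (f (x n)) \<le> L n)) \<and>
      ennreal (2 * L n / r n) * \<mu> (ball (x n) (2 * r n)) \<le> ennreal (2 * K) * \<nu> (ball (f (x n)) (s n))"
    "(\<Sum>n. \<nu> (ball (f (x n)) (s n))) \<le> of_nat N * \<nu> W"
    by (elim exE conjE) (rule that)
  have c: "A \<subseteq> (\<Union>n. ball (x n) (r n))" "\<And>n. 0 \<le> r n" "\<And>n. 0 \<le> L n"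
    "\<And>n. 0 < r n \<Longrightarrow> x n \<in> A \<and> r n < \<eta> (x n) \<and> (\<forall>y\<in>\<Omega>. dist y (x n) < r n \<longrightarrow> dist (f y) (f (x n)) \<le> L n)"
    "\<And>n. ennreal (2 * L n / r n) * \<mu> (ball (x n) (2 * r n)) \<le> ennreal (2 * K) * \<nu> (ball (f (x n)) (s n))"
    "(\<Sum>n. \<nu> (ball (f (x n)) (s n))) \<le> of_nat N * \<nu> W"
    using c' by blast+
  have "\<mu> A \<le> \<mu> (\<Union>n. ball (x n) (r n))"
    using c(1) by (intro outer_mono[OF metric_measure_regular[OF \<mu>]]) auto
  also have "\<dots> \<le> (\<Sum>n. \<mu> (ball (x n) (r n)))"
    by (intro outer_UN_le[OF metric_measure_regular[OF \<mu>]]) auto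
  finally have "ennreal t * \<mu> A \<le> ennreal t * (\<Sum>n. \<mu> (ball (x n) (r n)))"
    by (rule mult_left_mono) simp
  also have "\<dots> = (\<Sum>n. ennreal t * \<mu> (ball (x n) (r n)))" by simp
  also have "\<dots> \<le> (\<Sum>n. ennreal (2 * K) * \<nu> (ball (f (x n)) (s n)))"
  proof (intro suminf_le allI)
    fix n
    show "ennreal t * \<mu> (ball (x n) (r n)) \<le> ennreal (2 * K) * \<nu> (ball (f (x n)) (s n))"
    proof (cases "0 < r n")
      case True
      note cn = c(4)[OF True]
      have "\<not> L n \<le> t / 2 * r n" using \<eta>(2)[of "x n" "r n"] cn True by (meson order_trans)
      then have "t \<le> 2 * L n / r n" using True by (simp add: field_simps)
      then have "ennreal t * \<mu> (ball (x n) (r n)) \<le> ennreal (2 * L n / r n) * \<mu> (ball (x n) (2 * r n))"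
        using True by (intro mult_mono ennreal_leI outer_mono[OF metric_measure_regular[OF \<mu>]] subset_ball) auto
      also note c(5)
      finally show ?thesis .
    next
      case False
      then have "\<mu> (ball (x n) (r n)) = 0"
        using outer_empty[OF metric_measure_regular[OF \<mu>]] by (simp only: not_less ball_empty)
      then show ?thesis by simp
    qed
  qed auto
  also have "\<dots> = ennreal (2 * K) * (\<Sum>n. \<nu> (ball (f (x n)) (s n)))" by simp
  also have "\<dots> \<le> ennreal (2 * K) * (of_nat N * (\<nu> (f ` A) + ennreal e'))"
    using order_trans[OF c(6) mult_left_mono[OF W(3)]] by (intro mult_left_mono) auto
  also have "\<dots> = ennreal (2 * K) * (of_nat N * \<nu> (f ` A)) + ennreal (2 * K * (real N * e'))"
    using K e' by (simp add: distrib_left ennreal_mult ennreal_of_nat_eq_real_of_nat)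
  also have "\<dots> \<le> ennreal (2 * K) * (of_nat N * \<nu> (f ` A)) + ennreal e"
    using e' by (intro add_left_mono ennreal_leI)
  finally show "ennreal t * \<mu> A \<le> ennreal (2 * K) * (of_nat N * \<nu> (f ` A)) + ennreal e" .
qed

text \<open>Radii below \<open>\<delta>\<close> make \<open>curve_image_le_ball_sum\<close>
  available for all curves of length at least \<open>\<delta>\<close>. The integral bound does not
  depend on \<open>\<delta>\<close>, so \<open>\<delta>\<close> may tend to 0 along a bounded
  sequence of weights.\<close>

lemma controlled_curve_weight:
  assumes A: "A \<subseteq> \<Omega>" "\<And>x. x \<in> A \<Longrightarrow> image_controlled \<mu> \<nu> \<Omega> f K x" and K: "0 \<le> K"
    and W: "open W" "f ` A \<subseteq> W" and \<delta>: "0 < \<delta>"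
  shows "\<exists>g. g \<in> borel_measurable borel \<and>
    (\<integral>\<^sup>+x. g x \<partial>caratheodory_measure UNIV \<mu>) \<le> ennreal (2 * K) * (of_nat N * \<nu> W) \<and>
    (\<forall>c T. c \<in> curves_in \<Omega> \<longrightarrow> \<delta> \<le> fst c \<longrightarrow> T \<subseteq> {0..fst c} \<longrightarrow> snd c ` T \<subseteq> A \<longrightarrow>
       leb_outer (curve_dist f c ` T) \<le> curve_integral g c)"
proof -
  have "\<forall>x\<in>A. image_controlled \<mu> \<nu> \<Omega> f K x" "\<forall>x\<in>A. 0 < \<delta>"
    using A(2) \<delta> by blast+
  from controlled_cover[where \<eta> = "\<lambda>_. \<delta>", OF A(1) this(1) W(1,2) this(2) K]
  obtain x r s L where c': "A \<subseteq> (\<Union>n. ball (x n) (r n))"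
    "\<forall>n. 0 \<le> r n \<and> 0 \<le> L n \<and>
      (0 < r n \<longrightarrow> x n \<in> A \<and> r n < \<delta> \<and> (\<forall>y\<in>\<Omega>. dist y (x n) < r n \<longrightarrow> dist (f y) (f (x n)) \<le> L n)) \<and>
      ennreal (2 * L n / r n) * \<mu> (ball (x n) (2 * r n)) \<le> ennreal (2 * K) * \<nu> (ball (f (x n)) (s n))"
    "(\<Sum>n. \<nu> (ball (f (x n)) (s n))) \<le> of_nat N * \<nu> W"
    by (elim exE conjE) (rule that)
  have c: "A \<subseteq> (\<Union>n. ball (x n) (r n))" "\<And>n. 0 \<le> r n" "\<And>n. 0 \<le> L n"
    "\<And>n. 0 < r n \<Longrightarrow> x n \<in> A \<and> r n < \<delta> \<and> (\<forall>y\<in>\<Omega>. dist y (x n) < r n \<longrightarrow> dist (f y) (f (x n)) \<le> L n)"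
    "\<And>n. ennreal (2 * L n / r n) * \<mu> (ball (x n) (2 * r n)) \<le> ennreal (2 * K) * \<nu> (ball (f (x n)) (s n))"
    "(\<Sum>n. \<nu> (ball (f (x n)) (s n))) \<le> of_nat N * \<nu> W"
    using c' by blast+
  let ?M = "caratheodory_measure UNIV \<mu>"
  define g where "g z = (\<Sum>n. ennreal (2 * L n / r n) * indicator (ball (x n) (2 * r n)) z)" for z
  have gn: "(\<lambda>z. ennreal (2 * L n / r n) * indicator (ball (x n) (2 * r n)) z) \<in> borel_measurable borel" for n
    by (rule ball_indicator_measurable)
  show ?thesis
  proof (intro exI[of _ g] conjI allI impI)
    show "g \<in> borel_measurable borel" unfolding g_def using gn by measurable
    have "(\<integral>\<^sup>+x. g x \<partial>?M) = (\<Sum>n. \<integral>\<^sup>+z. ennreal (2 * L n / r n) * indicator (ball (x n) (2 * r n)) z \<partial>?M)"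
      unfolding g_def using metric_measure_borel_measurable[OF \<mu> gn] by (rule nn_integral_suminf)
    also have "\<dots> = (\<Sum>n. ennreal (2 * L n / r n) * \<mu> (ball (x n) (2 * r n)))"
      by (simp add: nn_integral_cmult_indicator metric_measure_borel[OF \<mu>])
    also have "\<dots> \<le> (\<Sum>n. ennreal (2 * K) * \<nu> (ball (f (x n)) (s n)))"
      using c(5) by (intro suminf_le) auto
    also have "\<dots> = ennreal (2 * K) * (\<Sum>n. \<nu> (ball (f (x n)) (s n)))" by simp
    also have "\<dots> \<le> ennreal (2 * K) * (of_nat N * \<nu> W)" using c(6) by (intro mult_left_mono) auto
    finally show "(\<integral>\<^sup>+x. g x \<partial>?M) \<le> ennreal (2 * K) * (of_nat N * \<nu> W)" .
    fix \<gamma> T assume \<gamma>: "\<gamma> \<in> curves_in \<Omega>" "\<delta> \<le> fst \<gamma>" "T \<subseteq> {0..fst \<gamma>}" "snd \<gamma> ` T \<subseteq> A"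
    show "leb_outer (curve_dist f \<gamma> ` T) \<le> curve_integral g \<gamma>"
      unfolding g_def
    proof (rule curve_image_le_ball_sum[OF \<gamma>(1,3)])
      show "snd \<gamma> ` T \<subseteq> (\<Union>n. ball (x n) (r n))" using c(1) \<gamma>(4) by blast
      show "r n \<le> fst \<gamma>" for n using c(2)[of n] c(4)[of n] \<gamma>(2) \<delta> by (cases "0 < r n") auto
      show "0 \<le> L n" for n by (rule c(3))
      show "x n \<in> \<Omega> \<and> (\<forall>y\<in>\<Omega>. dist y (x n) < r n \<longrightarrow> dist (f y) (f (x n)) \<le> L n)" if "0 < r n" for n
        using c(4)[OF that] A(1) by blast
    qed
  qed
qed

text \<open>
  The image of a Borel set need not be measurable. What saves additivity is that \<open>f\<close> restricted to
  controlled points is a homeomorphism onto its image.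
\<close>

lemma controlled_image_additive:
  assumes A: "A \<subseteq> \<Omega>" "\<And>x. x \<in> A \<Longrightarrow> image_controlled \<mu> \<nu> \<Omega> f K x" and inj: "inj_on f \<Omega>"
    and B: "\<And>j. B j \<in> sets (restrict_space borel \<Omega>)" "disjoint_family B"
  shows "(\<Sum>j::nat. \<nu> (f ` (A \<inter> B j))) \<le> \<nu> (f ` A)"
proof -
  define g where "g = the_inv_into \<Omega> f"
  have g: "g (f x) = x" if "x \<in> \<Omega>" for x using inj that by (simp add: g_def the_inv_into_f_f)
  \<comment> \<open>Points outside \<open>B(a, r)\<close> are sent at least \<open>2 * s\<close>
    away from \<open>f a\<close>: this is continuity of the inverse at \<open>f a\<close>.\<close>
  have "continuous_on (f ` A) g"
    unfolding continuous_on_iff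
  proof (intro ballI allI impI)
    fix y and e :: real assume "y \<in> f ` A" and e: "0 < e"
    then obtain a where a: "a \<in> A" "y = f a" by auto
    from A(2)[OF a(1)] e obtain r s where r: "r < e" "0 < s" "\<forall>y\<in>\<Omega>. r \<le> dist y a \<longrightarrow> 2 * s \<le> dist (f y) (f a)"
      unfolding image_controlled_def by metis
    show "\<exists>d>0. \<forall>y'\<in>f ` A. dist y' y < d \<longrightarrow> dist (g y') (g y) < e"
    proof (intro exI[of _ s] conjI ballI impI r(2))
      fix y' assume "y' \<in> f ` A" and d: "dist y' y < s"
      then obtain b where b: "b \<in> A" "y' = f b" by auto
      have "dist b a < e"
      proof (rule ccontr)
        assume "\<not> ?thesis"
        then have "2 * s \<le> dist (f b) (f a)" using r b A(1) by auto
        with d r(2) a b show False by auto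
      qed
      then show "dist (g y') (g y) < e" using g a b A(1) by (simp add: subset_iff)
    qed
  qed
  then have "g \<in> borel_measurable (restrict_space borel (f ` A))"
    by (rule borel_measurable_continuous_on_restrict)
  then have gm: "g \<in> measurable (restrict_space borel (f ` A)) (restrict_space borel \<Omega>)"
    using g A(1) by (intro measurable_restrict_space2) (auto simp: space_restrict_space)
  have "\<exists>D\<in>sets borel. f ` (A \<inter> B j) = f ` A \<inter> D" for j
  proof -
    have "g -` B j \<inter> space (restrict_space borel (f ` A)) \<in> sets (restrict_space borel (f ` A))"
      using gm B(1) by (rule measurable_sets)
    moreover have "g -` B j \<inter> space (restrict_space borel (f ` A)) = f ` (A \<inter> B j)"
      using g A(1) by (auto simp: space_restrict_space subset_iff)
    ultimately show ?thesis by (auto simp: sets_restrict_space)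
  qed
  then obtain D where D: "\<And>j. D j \<in> sets borel" "\<And>j. f ` (A \<inter> B j) = f ` A \<inter> D j" by metis
  obtain H where H: "H \<in> sets borel" "f ` A \<subseteq> H" "\<nu> H = \<nu> (f ` A)" using metric_measure_hull[OF \<nu>] by blast
  let ?M = "caratheodory_measure UNIV \<nu>"
  \<comment> \<open>The sets \<open>D j\<close> are disjoint on the image of \<open>A\<close> but
    perhaps not elsewhere. Making them disjoint loses nothing there, because \<open>f\<close> is
    injective.\<close>
  have dd: "disjointed D j \<in> sets borel" for j
    using D(1) sets.range_disjointed_sets[of D borel] by auto
  have sub: "f ` (A \<inter> B j) \<subseteq> disjointed D j \<inter> H" for j
  proof
    fix y assume y: "y \<in> f ` (A \<inter> B j)"
    have "y \<notin> D i" if "i < j" for i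
    proof
      assume "y \<in> D i"
      with y have "y \<in> f ` (A \<inter> B i)" unfolding D(2) by blast
      moreover have "B i \<inter> B j = {}" using B(2) that by (auto simp: disjoint_family_on_def)
      ultimately show False using y inj A(1) by (auto simp: inj_on_def)
    qed
    with y H(2) show "y \<in> disjointed D j \<inter> H" unfolding D(2) disjointed_def by auto
  qed
  have "(\<Sum>j. \<nu> (f ` (A \<inter> B j))) \<le> (\<Sum>j. emeasure ?M (disjointed D j \<inter> H))"
  proof (intro suminf_le allI)
    fix j
    have "\<nu> (f ` (A \<inter> B j)) \<le> \<nu> (disjointed D j \<inter> H)"
      using sub by (intro outer_mono[OF metric_measure_regular[OF \<nu>]]) auto
    also have "\<dots> = emeasure ?M (disjointed D j \<inter> H)"
      using dd H(1) by (subst metric_measure_borel[OF \<nu>]) auto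
    finally show "\<nu> (f ` (A \<inter> B j)) \<le> emeasure ?M (disjointed D j \<inter> H)" .
  qed auto
  also have "\<dots> = emeasure ?M (\<Union>j. disjointed D j \<inter> H)"
  proof (rule suminf_emeasure)
    show "range (\<lambda>j. disjointed D j \<inter> H) \<subseteq> sets ?M"
      using dd H(1) by (auto intro!: metric_measure_borel[OF \<nu>])
    show "disjoint_family (\<lambda>j. disjointed D j \<inter> H)"
      using disjoint_family_disjointed[of D] by (auto simp: disjoint_family_on_def)
  qed
  also have "\<dots> \<le> emeasure ?M H"
    using H(1) by (intro emeasure_mono) (auto intro!: metric_measure_borel[OF \<nu>])
  also have "\<dots> = \<nu> (f ` A)" using H by (simp add: metric_measure_borel[OF \<nu>])
  finally show ?thesis .
qed

text \<open>The weak-type estimate on each dyadic level bounds its contribution by the measure of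
  its image, and these measures add up to a finite one. This upgrades the weak-type bound to
  integrability.\<close>

lemma controlled_lip_majorant:
  assumes \<Omega>: "open \<Omega>" "\<mu> \<Omega> < \<infinity>" and f: "continuous_on \<Omega> f" "inj_on f \<Omega>" "\<nu> (f ` \<Omega>) < \<infinity>"
    and A: "A \<subseteq> \<Omega>" "\<And>x. x \<in> A \<Longrightarrow> image_controlled \<mu> \<nu> \<Omega> f K x" and K: "0 \<le> K"
  obtains \<Phi> where "\<Phi> \<in> borel_measurable borel" "(\<integral>\<^sup>+x\<in>\<Omega>. \<Phi> x \<partial>caratheodory_measure UNIV \<mu>) < \<infinity>"
    "\<And>x. x \<in> A \<Longrightarrow> lower_lip \<Omega> f x < \<infinity> \<Longrightarrow> lower_lip \<Omega> f x \<le> \<Phi> x"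
proof (rule borel_majorant[OF \<mu> \<Omega>, of A "lower_lip \<Omega> f"])
  define B where "B j = {x\<in>\<Omega>. ennreal (2^j) \<le> lower_lip \<Omega> f x \<and> lower_lip \<Omega> f x < ennreal (2^Suc j)}" for j
  let ?S = "\<lambda>j. A \<inter> {x. ennreal (2^j) \<le> lower_lip \<Omega> f x \<and> lower_lip \<Omega> f x < ennreal (2^Suc j)}"
  have S: "?S j = A \<inter> B j" for j using A(1) by (auto simp: B_def)
  have [measurable]: "lower_lip \<Omega> f \<in> borel_measurable (restrict_space borel \<Omega>)"
    by (rule lower_lip_measurable[OF \<Omega>(1) f(1)])
  have Bs: "B j \<in> sets (restrict_space borel \<Omega>)" for j
  proof -
    have "{x\<in>space (restrict_space borel \<Omega>). ennreal (2^j) \<le> lower_lip \<Omega> f x \<and> lower_lip \<Omega> f x < ennreal (2^Suc j)}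
        \<in> sets (restrict_space borel \<Omega>)" by measurable
    then show ?thesis by (simp add: B_def space_restrict_space)
  qed
  have Bd: "disjoint_family B"
    unfolding B_def by (rule disjoint_family_dyadic_levels)
  have "ennreal (2^j) * \<mu> (?S j) \<le> 2 * ennreal (2 * K) * of_nat N * \<nu> (f ` (A \<inter> B j))" for j
  proof -
    \<comment> \<open>The superlevel estimate wants a strict lower bound, while on level
      \<open>j\<close> the value \<open>2^j\<close> may be attained; hence the half.\<close>
    have "ennreal (2^j / 2) * \<mu> (A \<inter> B j) \<le> ennreal (2 * K) * (of_nat N * \<nu> (f ` (A \<inter> B j)))"
    proof (rule lip_superlevel_measure_le[OF _ _ K])
      fix x assume x: "x \<in> A \<inter> B j"
      have "ennreal (2^j / 2) < ennreal (2^j)" by (intro ennreal_lessI) auto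
      with x show "ennreal (2^j / 2) < lower_lip \<Omega> f x" by (auto simp: B_def intro: less_le_trans)
    qed (use A in auto)
    then have "2 * (ennreal (2^j / 2) * \<mu> (A \<inter> B j)) \<le> 2 * (ennreal (2 * K) * (of_nat N * \<nu> (f ` (A \<inter> B j))))"
      by (rule mult_left_mono) simp
    moreover have "2 * ennreal (2^j / 2) = ennreal (2^j)"
      using ennreal_mult[of 2 "2^j / 2"] by simp
    ultimately show ?thesis unfolding S by (simp add: mult.assoc[symmetric])
  qed
  then have "(\<Sum>j. ennreal (2^j) * \<mu> (?S j)) \<le> (\<Sum>j. 2 * ennreal (2 * K) * of_nat N * \<nu> (f ` (A \<inter> B j)))"
    by (intro suminf_le) auto
  also have "\<dots> = 2 * ennreal (2 * K) * of_nat N * (\<Sum>j. \<nu> (f ` (A \<inter> B j)))" by simp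
  also have "\<dots> \<le> 2 * ennreal (2 * K) * of_nat N * \<nu> (f ` A)"
    by (intro mult_left_mono controlled_image_additive[OF A f(2) Bs Bd]) auto
  also have "\<dots> < \<infinity>"
  proof -
    have "\<nu> (f ` A) \<le> \<nu> (f ` \<Omega>)" using A(1) by (intro outer_mono[OF metric_measure_regular[OF \<nu>]]) auto
    with f(3) have "\<nu> (f ` A) < \<infinity>" by simp
    then show ?thesis by (simp add: ennreal_mult_less_top ennreal_of_nat_eq_real_of_nat)
  qed
  finally show "(\<Sum>j. ennreal (2^j) * \<mu> (?S j)) < \<infinity>" .
qed (rule that)

end

section \<open>Pointwise consequences of the dilatation bounds\<close>

lemma ennreal_divide_less_imp_le:
  assumes "a / b < (c::ennreal)" shows "a \<le> c * b"
proof (cases "b = 0 \<or> b = top")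
  case True
  then show ?thesis using assms by (auto simp: ennreal_mult_top split: if_splits)
next
  case False
  then have "a < c * b" using assms by (subst (asm) divide_less_ennreal) (auto simp: less_top)
  then show ?thesis by simp
qed

text \<open>Young's inequality with exponents \<open>q\<close> and \<open>q / (q - 1)\<close> for
  the factors \<open>a * \<rho> powr (- 1 / q)\<close> and \<open>h * \<rho> powr (1 / q)\<close>.
  The split of \<open>\<rho>\<close> makes the second term the function of hypothesis (3); the first
  loses its factor \<open>1 / q\<close>.\<close>

lemma young_dilatation:
  fixes q \<rho> h a :: real
  assumes q: "1 < q" and \<rho>: "0 < \<rho>" and h: "0 < h" and a: "0 < a"
  shows "h * a \<le> (q - 1) / q * (\<rho> * h powr q) powr (1 / (q - 1)) + a powr q / \<rho>"
proof -
  let ?a = "a * \<rho> powr (- 1 / q)" and ?b = "h * \<rho> powr (1 / q)" and ?p = "q / (q - 1)"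
  have "?a * ?b \<le> ?a powr q / q + ?b powr ?p / ?p"
    using assms by (intro Youngs_inequality) (auto simp: field_simps)
  also have "?a * ?b = h * a * (\<rho> powr (- 1 / q) * \<rho> powr (1 / q))" by simp
  also have "\<rho> powr (- 1 / q) * \<rho> powr (1 / q) = 1"
    using \<rho> by (simp flip: powr_add)
  also have "?a powr q = a powr q / \<rho>"
  proof -
    have "(\<rho> powr (- 1 / q)) powr q = \<rho> powr - 1"
      using q by (simp add: powr_powr)
    also have "\<dots> = 1 / \<rho>" using \<rho> by (simp add: powr_minus_divide)
    finally show ?thesis using a by (simp add: powr_mult)
  qed
  also have "?b powr ?p = (\<rho> * h powr q) powr (1 / (q - 1))"
    using assms by (simp add: powr_mult powr_powr mult.commute)
  also have "a powr q / \<rho> / q \<le> a powr q / \<rho>"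
    using assms by (simp add: field_simps)
  finally show ?thesis using q by (simp add: mult.commute)
qed

text \<open>A good radius in real numbers. In the application \<open>l\<close> and \<open>L\<close>
  are the lower and upper dilatations at \<open>r\<close>, \<open>m\<close> is the
  \<open>\<mu>'\<close>-measure of the ball of radius \<open>r / 10\<close> in
  \<open>\<Omega>\<close>, and \<open>5 * l / r\<close> is the quotient of \<open>l / 2\<close> and
  \<open>r / 10\<close>.\<close>

definition dilatation_scale ::
  "('a::metric_space set \<Rightarrow> ennreal) \<Rightarrow> ('b::metric_space set \<Rightarrow> ennreal) \<Rightarrow> 'a set \<Rightarrow> ('a \<Rightarrow> 'b) \<Rightarrow>
    real \<Rightarrow> real \<Rightarrow> real \<Rightarrow> real \<Rightarrow> 'a \<Rightarrow> real \<Rightarrow> real \<Rightarrow> real \<Rightarrow> real \<Rightarrow> real \<Rightarrow> bool" where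
  "dilatation_scale \<mu> \<nu> \<Omega> f C q \<rho> h x r l L m v \<longleftrightarrow>
     0 < r \<and> 0 < l \<and> 0 \<le> L \<and> 0 \<le> m \<and> 0 \<le> v \<and> L \<le> 2 * h * l \<and>
     (\<forall>y\<in>\<Omega>. r \<le> dist y x \<longrightarrow> l \<le> dist (f y) (f x)) \<and>
     (\<forall>y\<in>\<Omega>. dist y x < r \<longrightarrow> dist (f y) (f x) \<le> L) \<and>
     \<mu> (ball x (2 * r)) \<le> ennreal (C * m) \<and> \<nu> (ball (f x) (l / 2)) = ennreal v \<and>
     m * (5 * l / r) powr q \<le> \<rho> * v"

text \<open>The left-hand side of the inequality is the bound for
  \<open>L * \<mu> (ball x (2 * r)) / r\<close> that the scale provides; \<open>2 / 5\<close> turns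
  \<open>2 * h * l / r\<close> into a multiple of \<open>5 * l / r\<close>. The target radius is
  \<open>s = l / 2\<close>.\<close>

lemma dilatation_scale_imp_image_controlled:
  assumes *: "\<And>\<delta>. 0 < \<delta> \<Longrightarrow> \<exists>r l L m v. r < \<delta> \<and> l < \<delta> \<and> dilatation_scale \<mu> \<nu> \<Omega> f C q \<rho> h x r l L m v \<and>
      2 / 5 * C * (h * (5 * l / r) * m) \<le> K * v"
    and K: "0 \<le> K" and C: "0 \<le> C"
  shows "image_controlled \<mu> \<nu> \<Omega> f K x"
  unfolding image_controlled_def
proof (intro allI impI)
  fix \<delta> :: real assume "0 < \<delta>"
  from *[OF this] obtain r l L m v where rl: "r < \<delta>" "l < \<delta>"
    and le: "2 / 5 * C * (h * (5 * l / r) * m) \<le> K * v"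
    and sc: "dilatation_scale \<mu> \<nu> \<Omega> f C q \<rho> h x r l L m v" by blast
  from sc have s: "0 < r" "0 < l" "0 \<le> L" "0 \<le> m" "0 \<le> v" "L \<le> 2 * h * l"
     "\<forall>y\<in>\<Omega>. r \<le> dist y x \<longrightarrow> l \<le> dist (f y) (f x)"
     "\<forall>y\<in>\<Omega>. dist y x < r \<longrightarrow> dist (f y) (f x) \<le> L"
     "\<mu> (ball x (2 * r)) \<le> ennreal (C * m)" "\<nu> (ball (f x) (l / 2)) = ennreal v"
    by (simp_all add: dilatation_scale_def)
  have "2 / 5 * C * (h * (5 * l / r) * m) = 2 * h * l * (C * m) / r" using s by (simp add: field_simps)
  with le have "2 * h * l * (C * m) \<le> K * r * v" using s(1) by (simp add: pos_divide_le_eq mult_ac)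
  moreover have "L * (C * m) \<le> 2 * h * l * (C * m)" using s(4,6) C by (intro mult_right_mono) auto
  ultimately have "L * (C * m) \<le> K * r * v" by linarith
  then have "ennreal (L * (C * m)) \<le> ennreal (K * r * v)" by (rule ennreal_leI)
  then have "ennreal L * ennreal (C * m) \<le> ennreal (K * r) * ennreal v"
    using s C K by (simp add: ennreal_mult)
  moreover have "ennreal L * \<mu> (ball x (2 * r)) \<le> ennreal L * ennreal (C * m)"
    using s(9) by (rule mult_left_mono) simp
  ultimately have "ennreal L * \<mu> (ball x (2 * r)) \<le> ennreal (K * r) * \<nu> (ball (f x) (l / 2))"
    using s(10) by (metis order_trans)
  with s rl show "\<exists>r s L. 0 < r \<and> r < \<delta> \<and> 0 < s \<and> s < \<delta> \<and> 0 \<le> L \<and>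
        (\<forall>y\<in>\<Omega>. r \<le> dist y x \<longrightarrow> 2 * s \<le> dist (f y) (f x)) \<and>
        (\<forall>y\<in>\<Omega>. dist y x < r \<longrightarrow> dist (f y) (f x) \<le> L) \<and>
        ennreal L * \<mu> (ball x (2 * r)) \<le> ennreal (K * r) * \<nu> (ball (f x) s)"
    by (intro exI[of _ r] exI[of _ "l / 2"] exI[of _ L]) auto
qed

text \<open>The dilatation is a liminf and is good only frequently, but the density and volume
  hypotheses hold at all small radii, so they can be used at any good radius.\<close>

lemma dilatation_scale_ex:
  fixes \<mu> :: "'a::metric_space set \<Rightarrow> ennreal" and \<nu> :: "'b::metric_space set \<Rightarrow> ennreal"
  assumes \<nu>: "metric_measure \<nu>" and f: "continuous_on \<Omega> f" and x: "x \<in> \<Omega>" "x islimpt \<Omega>"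
    and \<rho>: "0 < \<rho>" and C: "0 < C"
    and dil: "h_dil \<Omega> f x < \<infinity>"
    and dens: "Limsup (at_right 0) (\<lambda>r. \<mu> (ball x (20 * r)) / \<mu>' (ball x r \<inter> \<Omega>)) < ennreal C"
    and vol: "Limsup (at_right 0) (\<lambda>r. \<mu>' (ball x r \<inter> \<Omega>) / ennreal (r powr q))
           < ennreal \<rho> * Liminf (at_right 0) (\<lambda>r. \<nu> (ball (f x) r) / ennreal (r powr q))"
    and \<delta>: "0 < \<delta>"
  shows "\<exists>r l L m v. r < \<delta> \<and> l < \<delta> \<and>
    dilatation_scale \<mu> \<nu> \<Omega> f C q \<rho> (enn2real (h_dil_max \<Omega> f x)) x r l L m v"
proof -
  define h where "h = enn2real (h_dil_max \<Omega> f x)"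
  have hm: "h_dil_max \<Omega> f x = ennreal h"
    using dil by (simp add: h_def h_dil_max_def max_def)
  have "ennreal 1 \<le> ennreal h" unfolding hm[symmetric] by (simp add: h_dil_max_def)
  then have h: "1 \<le> h" by (metis ennreal_1 ennreal_le_1 ennreal_less_one_iff leI not_less)
  have "h_dil \<Omega> f x \<le> ennreal h" unfolding hm[symmetric] by (simp add: h_dil_max_def)
  also have "\<dots> < ennreal (2 * h)" using h by (intro ennreal_lessI) auto
  finally have "\<not> ennreal (2 * h) \<le> h_dil \<Omega> f x" by simp
  then have "\<not> eventually (\<lambda>r. ennreal (2 * h) \<le> dil \<Omega> f x r) (at_right 0)"
    unfolding h_dil_def using Liminf_bounded[of "ennreal (2 * h)" "dil \<Omega> f x" "at_right 0"] by blast
  then have freq: "frequently (\<lambda>r. dil \<Omega> f x r < ennreal (2 * h)) (at_right 0)"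
    by (simp add: frequently_def not_less)
  from Limsup_lessD[OF dens] obtain d1 where d1: "0 < d1"
    "\<And>r. 0 < r \<Longrightarrow> r < d1 \<Longrightarrow> \<mu> (ball x (20 * r)) / \<mu>' (ball x r \<inter> \<Omega>) < ennreal C"
    by (auto simp: eventually_at_right_field)
  \<comment> \<open>A number strictly between the two sides separates them: eventually the domain
    quotients lie below \<open>c\<close> and the target quotients above
    \<open>c / \<rho>\<close>.\<close>
  from dense[OF vol] obtain c0 where c0: "Limsup (at_right 0) (\<lambda>r. \<mu>' (ball x r \<inter> \<Omega>) / ennreal (r powr q)) < c0"
    "c0 < ennreal \<rho> * Liminf (at_right 0) (\<lambda>r. \<nu> (ball (f x) r) / ennreal (r powr q))" by blast
  then have "c0 < top" using less_top_ennreal by (metis order.strict_trans2 top_greatest)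
  then obtain c where c: "c0 = ennreal c" "0 \<le> c" by (cases c0 rule: ennreal_cases) auto
  from Limsup_lessD[OF c0(1)] obtain d2 where d2: "0 < d2"
    "\<And>r. 0 < r \<Longrightarrow> r < d2 \<Longrightarrow> \<mu>' (ball x r \<inter> \<Omega>) / ennreal (r powr q) < ennreal c"
    by (auto simp: eventually_at_right_field c)
  have "ennreal (c / \<rho>) < Liminf (at_right 0) (\<lambda>r. \<nu> (ball (f x) r) / ennreal (r powr q))"
  proof (rule ccontr)
    assume "\<not> ?thesis"
    then have "ennreal \<rho> * Liminf (at_right 0) (\<lambda>r. \<nu> (ball (f x) r) / ennreal (r powr q)) \<le> ennreal \<rho> * ennreal (c / \<rho>)"
      by (intro mult_left_mono) auto
    also have "\<dots> = ennreal c" using \<rho> c by (simp add: ennreal_mult[symmetric])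
    finally show False using c0(2) c by simp
  qed
  from less_LiminfD[OF this] obtain d3 where d3: "0 < d3"
    "\<And>r. 0 < r \<Longrightarrow> r < d3 \<Longrightarrow> ennreal (c / \<rho>) < \<nu> (ball (f x) r) / ennreal (r powr q)"
    by (auto simp: eventually_at_right_field)
  define \<epsilon> where "\<epsilon> = min \<delta> d3"
  have \<epsilon>: "0 < \<epsilon>" using \<delta> d3 by (simp add: \<epsilon>_def)
  \<comment> \<open>A further point of \<open>\<Omega>\<close> with image close to
    \<open>f x\<close> bounds \<open>lower_dil\<close> from above, which makes \<open>l\<close>
    small. This is where \<open>x\<close> has to be a limit point.\<close>
  from f x(1) \<epsilon> obtain d4 where d4: "0 < d4" "\<And>y. y \<in> \<Omega> \<Longrightarrow> dist y x < d4 \<Longrightarrow> dist (f y) (f x) < \<epsilon>"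
    unfolding continuous_on_iff by metis
  from x(2) d4(1) obtain y0 where y0: "y0 \<in> \<Omega>" "y0 \<noteq> x" "dist y0 x < d4"
    unfolding islimpt_approachable by blast
  define b where "b = min (min \<delta> (dist y0 x)) (min d1 d2)"
  have b: "0 < b" using \<delta> y0 d1 d2 by (simp add: b_def)
  then have "eventually (\<lambda>r. 0 < r \<and> r < b) (at_right 0)"
    unfolding eventually_at_right_field by blast
  with freq have "frequently (\<lambda>r. dil \<Omega> f x r < ennreal (2 * h) \<and> 0 < r \<and> r < b) (at_right 0)"
    by (simp add: frequently_eventually_frequently)
  then obtain r where r: "dil \<Omega> f x r < ennreal (2 * h)" "0 < r" "r < b"
    using frequently_ex by blast
  have lo_le: "lower_dil \<Omega> f x r \<le> ennreal (dist (f y0) (f x))"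
    unfolding lower_dil_def using y0 r by (intro INF_lower) (auto simp: b_def)
  have lo0: "lower_dil \<Omega> f x r \<noteq> 0"
    using r(1) by (auto simp: dil_def)
  have "lower_dil \<Omega> f x r < top" using lo_le by (rule le_less_trans) simp
  then obtain l where l: "lower_dil \<Omega> f x r = ennreal l" "0 < l"
    using lo0 by (cases "lower_dil \<Omega> f x r" rule: ennreal_cases) (auto simp: less_le)
  have "ennreal l < ennreal \<epsilon>"
  proof (rule le_less_trans)
    show "ennreal l \<le> ennreal (dist (f y0) (f x))" using lo_le l by simp
    show "ennreal (dist (f y0) (f x)) < ennreal \<epsilon>" using d4(2) y0 \<epsilon> by (intro ennreal_lessI) auto
  qed
  then have l\<epsilon>: "l < \<epsilon>" using l by (simp add: ennreal_less_iff)
  have "upper_dil \<Omega> f x r / ennreal l < ennreal (2 * h)" using r(1) lo0 l by (simp add: dil_def)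
  then have up: "upper_dil \<Omega> f x r \<le> ennreal (2 * h * l)"
    using ennreal_divide_less_imp_le[of "upper_dil \<Omega> f x r" "ennreal l" "ennreal (2 * h)"] h l
    by (simp add: ennreal_mult)
  then have "upper_dil \<Omega> f x r < top" by (rule le_less_trans) simp
  then obtain L where L: "upper_dil \<Omega> f x r = ennreal L" "0 \<le> L"
    by (cases "upper_dil \<Omega> f x r" rule: ennreal_cases) auto
  \<comment> \<open>The domain hypotheses are used at \<open>r / 10\<close>, since the density
    hypothesis then bounds the measure of \<open>ball x (2 * r)\<close>.\<close>
  have rq: "0 < (r / 10) powr q" using r by simp
  have "\<mu>' (ball x (r / 10) \<inter> \<Omega>) / ennreal ((r / 10) powr q) < ennreal c"
    using r d2(1) by (intro d2(2)) (auto simp: b_def)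
  then have m': "\<mu>' (ball x (r / 10) \<inter> \<Omega>) \<le> ennreal (c * (r / 10) powr q)"
    using ennreal_divide_less_imp_le[of _ "ennreal ((r / 10) powr q)"] c by (metis ennreal_mult')
  then have "\<mu>' (ball x (r / 10) \<inter> \<Omega>) < top" by (rule le_less_trans) simp
  then obtain m where m: "\<mu>' (ball x (r / 10) \<inter> \<Omega>) = ennreal m" "0 \<le> m"
    by (cases "\<mu>' (ball x (r / 10) \<inter> \<Omega>)" rule: ennreal_cases) auto
  have mc: "m \<le> c * (r / 10) powr q" using m' m c by (simp add: ennreal_le_iff)
  have "\<mu> (ball x (20 * (r / 10))) / \<mu>' (ball x (r / 10) \<inter> \<Omega>) < ennreal C"
    using r d1(1) by (intro d1(2)) (auto simp: b_def)
  then have \<mu>m: "\<mu> (ball x (2 * r)) \<le> ennreal (C * m)"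
    using ennreal_divide_less_imp_le[of "\<mu> (ball x (2 * r))" "ennreal m" "ennreal C"] m C
    by (simp add: ennreal_mult')
  have "\<nu> (ball (f x) (l / 2)) < top" using \<nu> by (simp add: metric_measure_def)
  then obtain v where v: "\<nu> (ball (f x) (l / 2)) = ennreal v" "0 \<le> v"
    by (cases "\<nu> (ball (f x) (l / 2))" rule: ennreal_cases) auto
  have lq: "0 < (l / 2) powr q" using l by simp
  have "ennreal (c / \<rho>) < \<nu> (ball (f x) (l / 2)) / ennreal ((l / 2) powr q)"
    using l l\<epsilon> by (intro d3(2)) (auto simp: \<epsilon>_def)
  also have "\<dots> = ennreal (v / (l / 2) powr q)" using v lq by (simp add: divide_ennreal)
  finally have "c / \<rho> < v / (l / 2) powr q" using c \<rho> by (simp add: ennreal_less_iff)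
  then have cv: "c * (l / 2) powr q \<le> \<rho> * v" using \<rho> lq by (simp add: field_simps)
  have "5 * l / r = (l / 2) / (r / 10)" using r by simp
  then have "(5 * l / r) powr q = (l / 2) powr q / (r / 10) powr q"
    using r l by (simp only: powr_divide)
  then have "m * (5 * l / r) powr q = m / (r / 10) powr q * (l / 2) powr q" by simp
  also have "\<dots> \<le> c * (l / 2) powr q"
    using mc rq lq by (intro mult_right_mono) (auto simp: pos_divide_le_eq)
  also note cv
  finally have mv: "m * (5 * l / r) powr q \<le> \<rho> * v" .
  have lower: "l \<le> dist (f y) (f x)" if "y \<in> \<Omega>" "r \<le> dist y x" for y
  proof -
    have "ennreal l \<le> ennreal (dist (f y) (f x))"
      unfolding l(1)[symmetric] lower_dil_def using that by (intro INF_lower) auto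
    then show ?thesis by simp
  qed
  have upper: "dist (f y) (f x) \<le> L" if "y \<in> \<Omega>" "dist y x < r" for y
  proof -
    have "ennreal (dist (f y) (f x)) \<le> ennreal L"
      unfolding L(1)[symmetric] upper_dil_def using that by (intro SUP_upper) auto
    then show ?thesis using L by (simp add: ennreal_le_iff)
  qed
  have "L \<le> 2 * h * l" using up L h l by (simp add: ennreal_le_iff)
  with r l L m v lower upper \<mu>m mv have "dilatation_scale \<mu> \<nu> \<Omega> f C q \<rho> h x r l L m v"
    by (simp add: dilatation_scale_def)
  moreover have "r < \<delta>" "l < \<delta>" using r l\<epsilon> by (auto simp: b_def \<epsilon>_def)
  ultimately show ?thesis unfolding h_def by blast
qed

text \<open>At isolated points \<open>dilatation_scale_ex\<close> does not apply; they are handled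
  through their vanishing Lipschitz constant.\<close>

lemma lower_lip_isolated:
  assumes "x \<in> \<Omega>" "\<not> x islimpt \<Omega>"
  shows "lower_lip \<Omega> f x = 0"
proof -
  obtain d where d: "0 < d" "\<And>y. y \<in> \<Omega> \<Longrightarrow> dist y x < d \<Longrightarrow> y = x"
    using assms unfolding islimpt_approachable by metis
  have "lower_lip \<Omega> f x \<le> ennreal (2 * 0)"
  proof (rule lower_lip_le)
    fix \<delta> :: real assume "0 < \<delta>"
    then have "0 < min d \<delta> / 2" "min d \<delta> / 2 < \<delta>" "min d \<delta> / 2 < d" using d by (auto simp: min_def)
    moreover from this(3) have "\<forall>y\<in>\<Omega>. dist y x < min d \<delta> / 2 \<longrightarrow> dist (f y) (f x) \<le> 0 * (min d \<delta> / 2)"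
      using d(2) by force
    ultimately show "\<exists>r>0. r < \<delta> \<and> (\<forall>y\<in>\<Omega>. dist y x < r \<longrightarrow> dist (f y) (f x) \<le> 0 * r)" by blast
  qed simp
  then show ?thesis by simp
qed

context
  fixes \<mu> :: "'a::metric_space set \<Rightarrow> ennreal" and \<nu> :: "'b::metric_space set \<Rightarrow> ennreal"
    and \<Omega> :: "'a set" and f :: "'a \<Rightarrow> 'b" and C q \<rho> h :: real and x :: 'a
  assumes C: "0 < C" and \<rho>: "0 < \<rho>" and h: "1 \<le> h"
    and scale: "\<And>\<delta>. 0 < \<delta> \<Longrightarrow> \<exists>r l L m v. r < \<delta> \<and> l < \<delta> \<and> dilatation_scale \<mu> \<nu> \<Omega> f C q \<rho> h x r l L m v"
begin

text \<open>For \<open>q = 1\<close> the volume bound is linear in \<open>5 * l / r\<close>, just as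
  the quantity to be controlled, so the bound on \<open>h * \<rho>\<close> is enough.\<close>

lemma image_controlled_exponent_one:
  assumes q: "q = 1" and H: "h * \<rho> \<le> H"
  shows "image_controlled \<mu> \<nu> \<Omega> f (C * H) x"
proof (rule dilatation_scale_imp_image_controlled)
  fix \<delta> :: real assume "0 < \<delta>"
  from scale[OF this] obtain r l L m v where s: "r < \<delta>" "l < \<delta>" "dilatation_scale \<mu> \<nu> \<Omega> f C q \<rho> h x r l L m v"
    by blast
  then have p: "0 < r" "0 < l" "0 \<le> m" "0 \<le> v" "m * (5 * l / r) \<le> \<rho> * v"
    using q by (auto simp: dilatation_scale_def)
  have "h * (5 * l / r) * m = h * (m * (5 * l / r))" by simp
  also have "\<dots> \<le> h * (\<rho> * v)" using p h by (intro mult_left_mono) auto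
  also have "\<dots> \<le> H * v" using mult_right_mono[OF H p(4)] by simp
  finally have "2 / 5 * C * (h * (5 * l / r) * m) \<le> 2 / 5 * C * (H * v)" using C by (intro mult_left_mono) auto
  also have "\<dots> \<le> C * H * v"
  proof -
    have "0 \<le> C * (H * v)" using C p H h \<rho> by (intro mult_nonneg_nonneg) (auto intro: order_trans[OF _ H])
    then show ?thesis by simp
  qed
  finally show "\<exists>r l L m v. r < \<delta> \<and> l < \<delta> \<and> dilatation_scale \<mu> \<nu> \<Omega> f C q \<rho> h x r l L m v \<and>
      2 / 5 * C * (h * (5 * l / r) * m) \<le> C * H * v" using s by blast
qed (use C H h \<rho> in \<open>auto intro!: mult_nonneg_nonneg intro: order_trans[OF _ H]\<close>)

text \<open>
  Where the mean dilatation stays above \<open>2\<phi>\<close>, the summand \<open>\<phi>\<close> in Young's inequality is absorbed into the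
  left-hand side; everywhere else the lower Lipschitz constant is at most \<open>2\<phi>\<close>.
\<close>

lemma image_controlled_or_lower_lip_le:
  assumes q: "1 < q"
  shows "image_controlled \<mu> \<nu> \<Omega> f C x \<or>
    lower_lip \<Omega> f x \<le> ennreal (2 * ((q - 1) / q * (\<rho> * h powr q) powr (1 / (q - 1))))"
proof -
  define \<phi> where "\<phi> = (q - 1) / q * (\<rho> * h powr q) powr (1 / (q - 1))"
  have \<phi>: "0 \<le> \<phi>" using q by (simp add: \<phi>_def)
  show ?thesis
  proof (cases "\<forall>\<delta>>0. \<exists>r>0. r < \<delta> \<and> (\<forall>y\<in>\<Omega>. dist y x < r \<longrightarrow> dist (f y) (f x) \<le> \<phi> * r)")
    case True
    then have "lower_lip \<Omega> f x \<le> ennreal (2 * \<phi>)" using \<phi> by (intro lower_lip_le) auto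
    then show ?thesis by (simp add: \<phi>_def)
  next
    case False
    then obtain d where d: "0 < d" "\<And>r. 0 < r \<Longrightarrow> r < d \<Longrightarrow> \<not> (\<forall>y\<in>\<Omega>. dist y x < r \<longrightarrow> dist (f y) (f x) \<le> \<phi> * r)"
      by blast
    have "image_controlled \<mu> \<nu> \<Omega> f C x"
    proof (rule dilatation_scale_imp_image_controlled)
      fix \<delta> :: real assume "0 < \<delta>"
      then have "0 < min \<delta> d" using d by simp
      from scale[OF this] obtain r l L m v where s: "r < min \<delta> d" "l < min \<delta> d"
        "dilatation_scale \<mu> \<nu> \<Omega> f C q \<rho> h x r l L m v" by blast
      then have p: "0 < r" "0 < l" "0 \<le> m" "0 \<le> v" "m * (5 * l / r) powr q \<le> \<rho> * v" "L \<le> 2 * h * l"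
        and osc: "\<forall>y\<in>\<Omega>. dist y x < r \<longrightarrow> dist (f y) (f x) \<le> L"
        by (auto simp: dilatation_scale_def)
      define a where "a = 5 * l / r"
      have a: "0 < a" using p by (simp add: a_def)
      \<comment> \<open>The oscillation at this radius exceeds \<open>\<phi> * r\<close>, hence so
        does \<open>L\<close>; with \<open>L \<le> 2 * h * l\<close> this makes \<open>h * a\<close>
        larger than \<open>5 / 2 * \<phi>\<close>.\<close>
      have "\<not> L \<le> \<phi> * r" using d(2)[OF p(1)] s(1) osc by (meson min_less_iff_conj order_trans)
      then have "\<phi> * r < 2 * h * l" using p by linarith
      then have "5 / 2 * \<phi> < h * a" using p by (simp add: a_def field_simps)
      then have "2 * \<phi> \<le> h * a" using \<phi> by linarith
      moreover have "h * a \<le> \<phi> + a powr q / \<rho>"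
        unfolding \<phi>_def using q \<rho> h a by (intro young_dilatation) auto
      ultimately have "h * a \<le> 2 * (a powr q / \<rho>)" by linarith
      then have "h * a * m \<le> 2 * (a powr q / \<rho>) * m" using p by (intro mult_right_mono) auto
      also have "\<dots> = 2 / \<rho> * (m * a powr q)" by simp
      also have "\<dots> \<le> 2 / \<rho> * (\<rho> * v)" using p \<rho> by (intro mult_left_mono) (auto simp: a_def)
      also have "\<dots> = 2 * v" using \<rho> by simp
      finally have "2 / 5 * C * (h * a * m) \<le> 2 / 5 * C * (2 * v)" using C by (intro mult_left_mono) auto
      also have "\<dots> \<le> C * v" using C p by simp
      finally show "\<exists>r l L m v. r < \<delta> \<and> l < \<delta> \<and> dilatation_scale \<mu> \<nu> \<Omega> f C q \<rho> h x r l L m v \<and>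
        2 / 5 * C * (h * (5 * l / r) * m) \<le> C * v"
        using s unfolding a_def
        by (intro exI[of _ r] exI[of _ l] exI[of _ L] exI[of _ m] exI[of _ v] conjI) auto
    qed (use C in auto)
    then show ?thesis by simp
  qed
qed

text \<open>The volume bound controls \<open>m * a powr q\<close> for \<open>a = 5 * l / r\<close>,
  whereas only \<open>h * a * m\<close> is needed. Since \<open>q > 1\<close> this gains the factor
  \<open>a powr (1 - q)\<close>, and an infinite Lipschitz constant forces \<open>a\<close> to be
  large at all small good radii.\<close>

lemma image_controlled_if_lower_lip_infinite:
  assumes q: "1 < q" and inf: "lower_lip \<Omega> f x = \<infinity>" and e: "0 < e"
  shows "image_controlled \<mu> \<nu> \<Omega> f e x"
proof -
  \<comment> \<open>\<open>a0\<close> solves \<open>C * h * \<rho> * a0 powr (1 - q) = e\<close>. As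
    \<open>L \<le> 2 / 5 * h * a * r\<close>, an oscillation above \<open>M * r\<close> forces
    \<open>a > a0\<close>.\<close>
  define a0 where "a0 = (C * h * \<rho> / e) powr (1 / (q - 1))"
  define M where "M = 2 / 5 * h * a0"
  have a0: "0 < a0" using C h \<rho> e by (simp add: a0_def)
  have M: "0 \<le> M" using a0 h by (simp add: M_def)
  have "\<not> (\<forall>\<delta>>0. \<exists>r>0. r < \<delta> \<and> (\<forall>y\<in>\<Omega>. dist y x < r \<longrightarrow> dist (f y) (f x) \<le> M * r))"
  proof
    assume "\<forall>\<delta>>0. \<exists>r>0. r < \<delta> \<and> (\<forall>y\<in>\<Omega>. dist y x < r \<longrightarrow> dist (f y) (f x) \<le> M * r)"
    then have "lower_lip \<Omega> f x \<le> ennreal (2 * M)" using M by (intro lower_lip_le) auto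
    with inf show False by (simp add: top_unique)
  qed
  then obtain d where d: "0 < d" "\<And>r. 0 < r \<Longrightarrow> r < d \<Longrightarrow> \<not> (\<forall>y\<in>\<Omega>. dist y x < r \<longrightarrow> dist (f y) (f x) \<le> M * r)"
    by blast
  show ?thesis
  proof (rule dilatation_scale_imp_image_controlled)
    fix \<delta> :: real assume "0 < \<delta>"
    then have "0 < min \<delta> d" using d by simp
    from scale[OF this] obtain r l L m v where s: "r < min \<delta> d" "l < min \<delta> d"
      "dilatation_scale \<mu> \<nu> \<Omega> f C q \<rho> h x r l L m v" by blast
    then have p: "0 < r" "0 < l" "0 \<le> m" "0 \<le> v" "m * (5 * l / r) powr q \<le> \<rho> * v" "L \<le> 2 * h * l"
      and osc: "\<forall>y\<in>\<Omega>. dist y x < r \<longrightarrow> dist (f y) (f x) \<le> L"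
      by (auto simp: dilatation_scale_def)
    define a where "a = 5 * l / r"
    have a: "0 < a" using p by (simp add: a_def)
    have "\<not> L \<le> M * r" using d(2)[OF p(1)] s(1) osc by (meson min_less_iff_conj order_trans)
    then have "M * r < 2 * h * l" using p by linarith
    then have "h * a0 < h * a" using p by (simp add: a_def M_def field_simps)
    then have "a0 < a" using h by simp
    then have "a0 powr (q - 1) \<le> a powr (q - 1)" using a0 q by (intro powr_mono2) auto
    moreover have "a0 powr (q - 1) = C * h * \<rho> / e"
      using q C h \<rho> e by (simp add: a0_def powr_powr)
    ultimately have "C * h * \<rho> \<le> e * a powr (q - 1)" using e by (simp add: pos_divide_le_eq mult.commute)
    then have "C * h * \<rho> * a * m \<le> e * a powr (q - 1) * a * m"
      using a p by (intro mult_right_mono) auto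
    also have "\<dots> = e * (m * a powr q)"
      using a by (simp add: powr_diff field_simps)
    also have "\<dots> \<le> e * (\<rho> * v)" using p e by (intro mult_left_mono) (auto simp: a_def)
    finally have "\<rho> * (C * (h * a * m)) \<le> \<rho> * (e * v)" by (simp add: mult_ac)
    then have le: "C * (h * a * m) \<le> e * v" using \<rho> by simp
    moreover have "0 \<le> C * (h * a * m)" using C h a p by simp
    ultimately have "2 / 5 * C * (h * a * m) \<le> e * v" by simp
    then show "\<exists>r l L m v. r < \<delta> \<and> l < \<delta> \<and> dilatation_scale \<mu> \<nu> \<Omega> f C q \<rho> h x r l L m v \<and>
      2 / 5 * C * (h * (5 * l / r) * m) \<le> e * v"
        using s unfolding a_def
        by (intro exI[of _ r] exI[of _ l] exI[of _ L] exI[of _ m] exI[of _ v] conjI) auto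
  qed (use C e in auto)
qed

end

section \<open>Regularity of the map\<close>

lemma suminf_eq_top_if_bounded_below:
  fixes h :: "nat \<Rightarrow> ennreal"
  assumes h: "\<And>n. n0 \<le> n \<Longrightarrow> a \<le> h n" and a: "a \<noteq> 0"
  shows "(\<Sum>n. h n) = \<infinity>"
proof (rule ccontr)
  assume "\<not> ?thesis"
  then obtain s where s: "(\<Sum>n. h n) = ennreal s" "0 \<le> s" by (cases "\<Sum>n. h n" rule: ennreal_cases) auto
  have *: "of_nat k * a \<le> ennreal s" for k
  proof -
    have "of_nat k * a = (\<Sum>n\<in>{n0..<n0 + k}. a)" by simp
    also have "\<dots> \<le> (\<Sum>n\<in>{n0..<n0 + k}. h n)" using h by (intro sum_mono) auto
    also have "\<dots> \<le> (\<Sum>n. h n)" by (rule sum_le_suminf) auto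
    finally show ?thesis using s by simp
  qed
  have "a < top" using *[of 1] by (simp add: le_less_trans[of a "ennreal s"])
  then obtain b where b: "a = ennreal b" "0 < b" using a by (cases a rule: ennreal_cases) (auto simp: less_le)
  obtain k :: nat where "s / b < real k" using reals_Archimedean2 by blast
  then have "s < real k * b" using b by (simp add: pos_divide_less_eq)
  moreover have "real k * b \<le> s"
    using *[of k] b s by (simp add: ennreal_of_nat_eq_real_of_nat ennreal_mult[symmetric])
  ultimately show False by simp
qed

text \<open>Summing admissible functions with geometrically small integrals gives one integrable
  weight that is infinite on all of \<open>\<Gamma>\<close>. Added to an upper gradient, it makes
  the inequality hold on these curves as well.\<close>

lemma Mod1_null_weight:
  fixes \<mu> :: "'a::metric_space set \<Rightarrow> ennreal"
  assumes \<mu>: "metric_measure \<mu>" and \<Gamma>: "\<Gamma> \<subseteq> Collect is_curve" and null: "Mod1 \<mu> \<Gamma> = 0"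
  shows "\<exists>\<rho>. \<rho> \<in> borel_measurable borel \<and> (\<integral>\<^sup>+x. \<rho> x \<partial>caratheodory_measure UNIV \<mu>) < \<infinity> \<and>
    (\<forall>c\<in>\<Gamma>. curve_integral \<rho> c = \<infinity>)"
proof -
  let ?M = "caratheodory_measure UNIV \<mu>"
  have "\<exists>\<rho>. \<rho> \<in> borel_measurable borel \<and> (\<forall>c\<in>\<Gamma>. 1 \<le> curve_integral \<rho> c) \<and>
      (\<integral>\<^sup>+x. \<rho> x \<partial>?M) < ennreal (1 * (1/2)^Suc n)" for n
  proof -
    have "Mod1 \<mu> \<Gamma> < ennreal (1 * (1/2)^Suc n)" using null by simp
    then show ?thesis unfolding Mod1_def INF_less_iff by auto
  qed
  then obtain \<rho> where \<rho>: "\<And>n. \<rho> n \<in> borel_measurable borel" "\<And>n c. c \<in> \<Gamma> \<Longrightarrow> 1 \<le> curve_integral (\<rho> n) c"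
    "\<And>n. (\<integral>\<^sup>+x. \<rho> n x \<partial>?M) < ennreal (1 * (1/2)^Suc n)"
    by metis
  show ?thesis
  proof (intro exI[of _ "\<lambda>x. \<Sum>n. \<rho> n x"] conjI ballI)
    show "(\<lambda>x. \<Sum>n. \<rho> n x) \<in> borel_measurable borel" using \<rho>(1) by measurable
    have "(\<integral>\<^sup>+x. (\<Sum>n. \<rho> n x) \<partial>?M) = (\<Sum>n. \<integral>\<^sup>+x. \<rho> n x \<partial>?M)"
      using metric_measure_borel_measurable[OF \<mu> \<rho>(1)] by (rule nn_integral_suminf)
    also have "\<dots> \<le> (\<Sum>n. ennreal (1 * (1/2)^Suc n))"
      using \<rho>(3) by (intro suminf_le) (auto intro: less_imp_le)
    also have "\<dots> = ennreal 1" by (rule suminf_half_powers) simp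
    also have "\<dots> < \<infinity>" by simp
    finally show "(\<integral>\<^sup>+x. (\<Sum>n. \<rho> n x) \<partial>?M) < \<infinity>" .
    fix c assume c: "c \<in> \<Gamma>"
    then have "curve_integral (\<lambda>x. \<Sum>n. \<rho> n x) c = (\<Sum>n. curve_integral (\<rho> n) c)"
      using \<Gamma> \<rho>(1) by (intro curve_integral_suminf) auto
    also have "\<dots> = \<infinity>" by (rule suminf_eq_top_if_bounded_below[of 0 1]) (use \<rho>(2)[OF c] in auto)
    finally show "curve_integral (\<lambda>x. \<Sum>n. \<rho> n x) c = \<infinity>" .
  qed
qed

lemma dyadic_levels_le_nn_integral:
  assumes [measurable]: "G \<in> borel_measurable M"
  shows "(\<Sum>j. ennreal (2^j) * emeasure M {x\<in>space M. ennreal (2^j) \<le> G x \<and> G x < ennreal (2^Suc j)}) \<le> (\<integral>\<^sup>+x. G x \<partial>M)"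
proof -
  define B where "B j = {x\<in>space M. ennreal (2^j) \<le> G x \<and> G x < ennreal (2^Suc j)}" for j
  have [measurable]: "B j \<in> sets M" for j unfolding B_def by measurable
  have dj: "disjoint_family B"
    unfolding B_def by (rule disjoint_family_dyadic_levels)
  have "(\<Sum>j. ennreal (2^j) * emeasure M (B j)) = (\<Sum>j. \<integral>\<^sup>+x. ennreal (2^j) * indicator (B j) x \<partial>M)"
    by (simp add: nn_integral_cmult_indicator)
  also have "\<dots> = (\<integral>\<^sup>+x. (\<Sum>j. ennreal (2^j) * indicator (B j) x) \<partial>M)"
    by (rule nn_integral_suminf[symmetric]) measurable
  also have "\<dots> \<le> (\<integral>\<^sup>+x. G x \<partial>M)"
  proof (rule nn_integral_mono)
    fix x
    show "(\<Sum>j. ennreal (2^j) * indicator (B j) x) \<le> G x"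
    proof (cases "\<exists>j. x \<in> B j")
      case True
      then obtain j where j: "x \<in> B j" by blast
      have "(\<Sum>j. ennreal (2^j) * indicator (B j) x) = ennreal (2^j)"
        by (rule suminf_cmult_indicator[OF dj j])
      with j show ?thesis by (simp add: B_def)
    qed simp
  qed
  finally show ?thesis unfolding B_def .
qed

text \<open>
  The measure \<open>\<mu>'\<close> need not be sigma-finite on all of \<open>\<Omega>\<close>, so measurability transfers to \<open>\<mu>\<close> only for
  sets near which \<open>\<mu>'\<close> is locally finite.
\<close>

lemma sets_caratheodory_transfer:
  fixes \<mu> \<mu>' :: "'a::metric_space set \<Rightarrow> ennreal"
  assumes \<mu>: "metric_measure \<mu>" and \<mu>': "borel_regular_outer_measure \<Omega> \<mu>'" and \<Omega>: "open \<Omega>"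
    and tb: "totally_bounded \<Omega>" and le: "\<And>A. A \<subseteq> \<Omega> \<Longrightarrow> \<mu> A \<le> \<mu>' A"
    and P: "P \<in> sets (caratheodory_measure \<Omega> \<mu>')" and fin: "\<And>x. x \<in> P \<Longrightarrow> \<exists>r>0. \<mu>' (ball x r \<inter> \<Omega>) < \<infinity>"
  shows "P \<in> sets (caratheodory_measure UNIV \<mu>)"
proof -
  let ?M = "caratheodory_measure UNIV \<mu>" and ?M' = "caratheodory_measure \<Omega> \<mu>'"
  have P\<Omega>: "P \<subseteq> \<Omega>" using sets.sets_into_space[OF P] by (simp add: space_caratheodory[OF \<mu>'])
  have "\<exists>r. 0 < r \<and> r < 1 \<and> \<mu>' (ball x r \<inter> \<Omega>) < \<infinity>" if "x \<in> P" for x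
  proof -
    from fin[OF that] obtain r where r: "0 < r" "\<mu>' (ball x r \<inter> \<Omega>) < \<infinity>" by blast
    have "\<mu>' (ball x (min r (1/2)) \<inter> \<Omega>) \<le> \<mu>' (ball x r \<inter> \<Omega>)" by (intro outer_mono[OF \<mu>']) auto
    also note r(2)
    finally show ?thesis using r(1) by (intro exI[of _ "min r (1/2)"]) auto
  qed
  then obtain r where r: "\<And>x. x \<in> P \<Longrightarrow> 0 < r x \<and> r x < 1" "\<And>x. x \<in> P \<Longrightarrow> \<mu>' (ball x (r x) \<inter> \<Omega>) < \<infinity>"
    by metis
  have "totally_bounded P" using tb P\<Omega> unfolding totally_bounded_iff_balls by (meson order_trans)
  \<comment> \<open>The selection serves here only to extract countably many of the balls.\<close>
  note sel = ball_selection[of P r, OF this, OF r(1)]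
  obtain D where D: "countable D" "D \<subseteq> P" "P \<subseteq> (\<Union>x\<in>D. ball x (r x))"
    using sel that by metis
  have "P \<inter> ball x (r x) \<in> sets ?M" if x: "x \<in> D" for x
  proof -
    let ?A = "P \<inter> ball x (r x)"
    have "ball x (r x) \<inter> \<Omega> \<in> sets (restrict_space borel \<Omega>)" by (auto simp: sets_restrict_space)
    then have "P \<inter> (ball x (r x) \<inter> \<Omega>) \<in> sets ?M'"
      using P borel_sets_caratheodory[OF \<mu>'] by blast
    moreover have "P \<inter> (ball x (r x) \<inter> \<Omega>) = ?A" using P\<Omega> by auto
    ultimately have A: "?A \<in> sets ?M'" by simp
    \<comment> \<open>Since \<open>\<mu>'\<close> is finite on \<open>?A\<close>, the Borel hull
      exceeds it by a set that is null for \<open>\<mu>'\<close>, hence for \<open>\<mu>\<close>,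
      and null sets are measurable for \<open>\<mu>\<close>.\<close>
    obtain B where B: "B \<in> sets (restrict_space borel \<Omega>)" "?A \<subseteq> B" "B \<subseteq> \<Omega>" "\<mu>' B = \<mu>' ?A"
      using borel_hull[OF \<mu>', of ?A] P\<Omega> by blast
    have B': "B \<in> sets ?M'" using B(1) by (rule borel_sets_caratheodory[OF \<mu>'])
    have "\<mu>' ?A \<le> \<mu>' (ball x (r x) \<inter> \<Omega>)" using P\<Omega> by (intro outer_mono[OF \<mu>']) auto
    also have "\<dots> < \<infinity>" using r(2) D(2) x by blast
    finally have Afin: "emeasure ?M' ?A \<noteq> \<infinity>" using A by (simp add: emeasure_caratheodory[OF \<mu>'])
    have "emeasure ?M' (B - ?A) = emeasure ?M' B - emeasure ?M' ?A"
      using A B' B(2) Afin by (intro emeasure_Diff) auto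
    also have "\<dots> = 0"
      using A B' B(4) Afin by (simp add: emeasure_caratheodory[OF \<mu>'] diff_eq_0_iff_ennreal)
    finally have "\<mu>' (B - ?A) = 0"
      using A B' emeasure_caratheodory[OF \<mu>', of "B - ?A"] by simp
    moreover have "\<mu> (B - ?A) \<le> \<mu>' (B - ?A)" using B(3) by (intro le) auto
    ultimately have "\<mu> (B - ?A) = 0" by simp
    then have "B - ?A \<in> sets ?M"
      by (intro null_sets_caratheodory[OF metric_measure_regular[OF \<mu>]]) auto
    moreover have "B \<in> sets ?M"
      using B(1) \<Omega> by (intro metric_measure_borel[OF \<mu>]) (auto simp: sets_restrict_space_iff)
    ultimately have "B - (B - ?A) \<in> sets ?M" by blast
    moreover have "B - (B - ?A) = ?A" using B(2) by blast
    ultimately show ?thesis by simp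
  qed
  then have "(\<Union>x\<in>D. P \<inter> ball x (r x)) \<in> sets ?M" using D(1) by (intro sets.countable_UN'') auto
  moreover have "(\<Union>x\<in>D. P \<inter> ball x (r x)) = P" using D(3) by blast
  ultimately show ?thesis by simp
qed

text \<open>The exceptional curves will have infinite weight, so the empty family can be the
  exceptional one in \<open>in_DBV\<close>.\<close>

lemma AM_empty: "AM \<mu> {} = 0"
proof -
  have "AM_admissible {} (\<lambda>_ _. 0)" by (simp add: AM_admissible_def)
  then have "AM \<mu> {} \<le> liminf (\<lambda>i. \<integral>\<^sup>+x. (\<lambda>_ _. 0) i x \<partial>caratheodory_measure UNIV \<mu>)"
    unfolding AM_def by (intro INF_lower) simp
  then show ?thesis by (simp add: Liminf_const)
qed

theorem theorem4p1:
  fixes \<mu> :: "'a::metric_space set \<Rightarrow> ennreal"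
    and \<nu> :: "'b::metric_space set \<Rightarrow> ennreal"
    and \<mu>' :: "'a set \<Rightarrow> ennreal"
    and \<Omega> E :: "'a set"
    and f :: "'a \<Rightarrow> 'b"
    and Q R :: "'a \<Rightarrow> real"
    and C H :: real
  assumes "metric_measure \<mu>" and "metric_measure \<nu>"
    and "open \<Omega>" and "bounded \<Omega>"
    and "inj_on f \<Omega>" and "continuous_on \<Omega> f" and "\<nu> (f ` \<Omega>) < \<infinity>"
    and "metric_doubling \<Omega>"
    and "borel_regular_outer_measure \<Omega> \<mu>'"
    and "\<forall>A\<subseteq>\<Omega>. \<mu> A \<le> \<mu>' A"
    and "\<forall>A\<subseteq>\<Omega>. \<mu> A = 0 \<longrightarrow> \<mu>' A = 0"
    and "E \<subseteq> \<Omega>" and "E \<in> sets (caratheodory_measure \<Omega> \<mu>')"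
    and "C > 1"
    and "\<forall>x\<in>\<Omega> - E.
           Limsup (at_right 0) (\<lambda>r. \<mu> (ball x (20 * r)) / \<mu>' (ball x r \<inter> \<Omega>)) < ennreal C"
    and "\<forall>x\<in>\<Omega> - E. Q x \<ge> 1" and "\<forall>x\<in>\<Omega> - E. R x > 0"
    and "Q \<in> borel_measurable (restrict_space (caratheodory_measure \<Omega> \<mu>') (\<Omega> - E))"
    and "R \<in> borel_measurable (restrict_space (caratheodory_measure \<Omega> \<mu>') (\<Omega> - E))"
    and "(\<lambda>y. Q (the_inv_into \<Omega> f y))
           \<in> borel_measurable (restrict_space (caratheodory_measure UNIV \<nu>) (f ` (\<Omega> - E)))"
    and "\<forall>x\<in>\<Omega> - E.
           Limsup (at_right 0) (\<lambda>r. \<mu>' (ball x r \<inter> \<Omega>) / ennreal (r powr Q x))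
           < ennreal (R x) * Liminf (at_right 0) (\<lambda>r. \<nu> (ball (f x) r) / ennreal (r powr Q x))"
    and "Mod1 \<mu> {c \<in> curves_in \<Omega>. hausdorff1 (f ` (curve_image c \<inter> E)) > 0} = 0"
    and "\<forall>x\<in>\<Omega> - E. h_dil \<Omega> f x < \<infinity>"
    and "set_integrable (caratheodory_measure \<Omega> \<mu>') {x \<in> \<Omega> - E. Q x > 1}
           (\<lambda>x. (Q x - 1) / Q x *
                 (R x * enn2real (h_dil_max \<Omega> f x) powr Q x) powr (1 / (Q x - 1)))"
    and "\<forall>x\<in>{x \<in> \<Omega> - E. Q x = 1}. h_dil_max \<Omega> f x * ennreal (R x) \<le> ennreal H"
  shows "in_DBV \<mu> \<Omega> f \<and> in_D1 \<mu> ({x \<in> \<Omega> - E. Q x > 1} \<union> E) f"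
proof -
  note \<mu> = assms(1) and \<nu> = assms(2) and \<Omega> = assms(3) and inj = assms(5) and f = assms(6)
    and f\<Omega> = assms(7) and \<mu>' = assms(9) and E\<Omega> = assms(12)
  let ?M = "caratheodory_measure UNIV \<mu>" and ?M' = "caratheodory_measure \<Omega> \<mu>'"
  define h where "h x = enn2real (h_dil_max \<Omega> f x)" for x
  define \<phi> where "\<phi> x = (Q x - 1) / Q x * (R x * h x powr Q x) powr (1 / (Q x - 1))" for x
  define S1 where "S1 = {x\<in>\<Omega> - E. Q x = 1}"
  define S2 where "S2 = {x\<in>\<Omega> - E. Q x > 1}"
  let ?lip = "lower_lip \<Omega> f"
  have tb: "totally_bounded \<Omega>" using assms(8,4) by (rule metric_doubling_imp_totally_bounded)
  obtain N where N: "quarter_cover_bound \<Omega> N" using metric_doubling_quarter_cover_bound[OF assms(8)] by blast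
  have \<mu>\<Omega>: "\<mu> \<Omega> < \<infinity>"
  proof -
    obtain b where "\<Omega> \<subseteq> ball undefined b" using assms(4) bounded_subset_ballD by blast
    then have "\<mu> \<Omega> \<le> \<mu> (ball undefined b)" by (intro outer_mono[OF metric_measure_regular[OF \<mu>]]) auto
    also have "\<dots> < \<infinity>" using \<mu> by (simp add: metric_measure_def)
    finally show ?thesis .
  qed
  have h: "1 \<le> h x" "h_dil_max \<Omega> f x = ennreal (h x)" if "x \<in> \<Omega> - E" for x
  proof -
    have "h_dil \<Omega> f x < \<infinity>" using assms(23) that by blast
    then show hx: "h_dil_max \<Omega> f x = ennreal (h x)" by (simp add: h_def h_dil_max_def max_def)
    have "ennreal 1 \<le> ennreal (h x)" unfolding hx[symmetric] by (simp add: h_dil_max_def)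
    then show "1 \<le> h x" by (metis ennreal_1 ennreal_less_one_iff leI not_less)
  qed
  have scale: "\<exists>r l L m v. r < \<delta> \<and> l < \<delta> \<and> dilatation_scale \<mu> \<nu> \<Omega> f C (Q x) (R x) (h x) x r l L m v"
    if "x \<in> \<Omega> - E" "x islimpt \<Omega>" "0 < \<delta>" for x \<delta>
    unfolding h_def
    by (rule dilatation_scale_ex[OF \<nu> f, where \<mu>' = \<mu>']) (use that assms(14,15,17,21,23) in auto)
  have C: "0 < C" using assms(14) by simp

  \<comment> \<open>Excluding \<open>lower_lip = 0\<close> excludes isolated points, where no good
    scale is available. The \<open>max\<close> is there because \<open>H\<close> is not assumed
    nonnegative.\<close>
  define A1 where "A1 = {x\<in>S1. ?lip x \<noteq> 0}"
  have A1: "A1 \<subseteq> \<Omega>" "\<And>x. x \<in> A1 \<Longrightarrow> image_controlled \<mu> \<nu> \<Omega> f (max 0 (C * H)) x"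
  proof -
    show "A1 \<subseteq> \<Omega>" by (auto simp: A1_def S1_def)
    fix x assume x: "x \<in> A1"
    then have x': "x \<in> \<Omega> - E" "Q x = 1" "x islimpt \<Omega>"
      using lower_lip_isolated[of x \<Omega> f] by (auto simp: A1_def S1_def)
    have R: "0 < R x" using assms(17) x' by blast
    have "ennreal (h x * R x) \<le> ennreal H"
      using assms(25) x' h[OF x'(1)] R by (auto simp: ennreal_mult)
    then have "h x * R x \<le> H"
      using h[OF x'(1)] R by (cases "0 \<le> H") (auto simp: ennreal_le_iff ennreal_neg mult_le_0_iff)
    then have "image_controlled \<mu> \<nu> \<Omega> f (C * H) x"
      using scale[OF x'(1,3)] h[OF x'(1)] C R x'(2) by (intro image_controlled_exponent_one)
    then show "image_controlled \<mu> \<nu> \<Omega> f (max 0 (C * H)) x" by (rule image_controlled_mono) simp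
  qed

  \<comment> \<open>The majorants \<open>\<Phi>2\<close> on \<open>A2\<close> and
    \<open>\<Phi>1\<close> on its complement in \<open>S2\<close> require no measurability of
    \<open>A2\<close>.\<close>
  define A2 where "A2 = {x\<in>S2. image_controlled \<mu> \<nu> \<Omega> f C x}"
  have A2: "A2 \<subseteq> \<Omega>" "\<And>x. x \<in> A2 \<Longrightarrow> image_controlled \<mu> \<nu> \<Omega> f C x" by (auto simp: A2_def S2_def)
  have lip_A2: "?lip x \<le> ennreal (2 * \<phi> x)" if x: "x \<in> S2 - A2" for x
  proof (cases "x islimpt \<Omega>")
    case True
    have x': "x \<in> \<Omega> - E" "1 < Q x" "\<not> image_controlled \<mu> \<nu> \<Omega> f C x" using x by (auto simp: S2_def A2_def)
    have "0 < R x" using assms(17) x' by blast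
    from image_controlled_or_lower_lip_le[OF C this h(1)[OF x'(1)] scale[OF x'(1) True] x'(2)] x'(3)
    show ?thesis by (simp add: \<phi>_def)
  next
    case False
    then show ?thesis using x lower_lip_isolated[of x \<Omega> f] by (auto simp: S2_def)
  qed

  define Z where "Z = {x\<in>S2. ?lip x = \<infinity>}"
  have Z: "Z \<subseteq> \<Omega>" "\<And>x e. x \<in> Z \<Longrightarrow> 0 < e \<Longrightarrow> image_controlled \<mu> \<nu> \<Omega> f e x"
  proof -
    show "Z \<subseteq> \<Omega>" by (auto simp: Z_def S2_def)
    fix x e assume x: "x \<in> Z" and e: "0 < (e::real)"
    have x': "x \<in> \<Omega> - E" "1 < Q x" "?lip x = \<infinity>" using x by (auto simp: S2_def Z_def)
    then have lim: "x islimpt \<Omega>" using lower_lip_isolated[of x \<Omega> f] by auto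
    have "0 < R x" using assms(17) x' by blast
    from image_controlled_if_lower_lip_infinite[OF C this h(1)[OF x'(1)] scale[OF x'(1) lim] x'(2,3) e]
    show "image_controlled \<mu> \<nu> \<Omega> f e x" .
  qed

  \<comment> \<open>The integrability of \<open>\<phi>\<close> is with respect to
    \<open>\<mu>'\<close>. Since \<open>\<mu> \<le> \<mu>'\<close> as outer measures, the level sets
    satisfy the summability that \<open>borel_majorant\<close> asks for, whether or not they are
    measurable for \<open>\<mu>\<close>.\<close>
  obtain \<Phi>1 where \<Phi>1: "\<Phi>1 \<in> borel_measurable borel" "(\<integral>\<^sup>+x\<in>\<Omega>. \<Phi>1 x \<partial>?M) < \<infinity>"
    "\<And>x. x \<in> S2 \<Longrightarrow> ennreal (2 * \<phi> x) \<le> \<Phi>1 x"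
  proof (rule borel_majorant[OF \<mu> \<Omega> \<mu>\<Omega>, of S2 "\<lambda>x. ennreal (2 * \<phi> x)"])
    have int: "integrable ?M' (\<lambda>x. indicator S2 x *\<^sub>R \<phi> x)"
      using assms(24) unfolding set_integrable_def S2_def \<phi>_def h_def .
    define G where "G x = ennreal (norm (2 * (indicator S2 x *\<^sub>R \<phi> x)))" for x
    have int2: "integrable ?M' (\<lambda>x. 2 * (indicator S2 x *\<^sub>R \<phi> x))" using int by simp
    have [measurable]: "G \<in> borel_measurable ?M'"
      using borel_measurable_integrable[OF int2] unfolding G_def by measurable
    have \<phi>0: "0 \<le> \<phi> x" if "x \<in> S2" for x using that by (auto simp: \<phi>_def S2_def)
    let ?L = "\<lambda>j. S2 \<inter> {x. ennreal (2^j) \<le> ennreal (2 * \<phi> x) \<and> ennreal (2 * \<phi> x) < ennreal (2^Suc j)}"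
    have L: "{x\<in>space ?M'. ennreal (2^j) \<le> G x \<and> G x < ennreal (2^Suc j)} = ?L j" for j
    proof -
      have "G x = (if x \<in> S2 then ennreal (2 * \<phi> x) else 0)" for x using \<phi>0 by (simp add: G_def)
      moreover have "S2 \<subseteq> space ?M'" by (auto simp: space_caratheodory[OF \<mu>'] S2_def)
      ultimately show ?thesis by (auto split: if_splits simp del: power_Suc)
    qed
    have L_sets: "?L j \<in> sets ?M'" for j unfolding L[symmetric] by measurable
    have "(\<Sum>j. ennreal (2^j) * \<mu> (?L j)) \<le> (\<Sum>j. ennreal (2^j) * emeasure ?M' (?L j))"
    proof (intro suminf_le allI mult_left_mono)
      fix j
      have "?L j \<subseteq> \<Omega>" by (auto simp: S2_def)
      then have "\<mu> (?L j) \<le> \<mu>' (?L j)" using assms(10) by blast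
      also have "\<dots> = emeasure ?M' (?L j)" using L_sets by (simp only: emeasure_caratheodory[OF \<mu>'])
      finally show "\<mu> (?L j) \<le> emeasure ?M' (?L j)" .
    qed auto
    also have "\<dots> \<le> (\<integral>\<^sup>+x. G x \<partial>?M')"
      using dyadic_levels_le_nn_integral[of G ?M'] unfolding L by simp
    also have "\<dots> < \<infinity>" using int2 unfolding G_def by (simp only: integrable_iff_bounded)
    finally show "(\<Sum>j. ennreal (2^j) * \<mu> (?L j)) < \<infinity>" .
  qed (use that in auto)

  obtain \<Phi>2 where \<Phi>2: "\<Phi>2 \<in> borel_measurable borel" "(\<integral>\<^sup>+x\<in>\<Omega>. \<Phi>2 x \<partial>?M) < \<infinity>"
    "\<And>x. x \<in> A2 \<Longrightarrow> ?lip x < \<infinity> \<Longrightarrow> ?lip x \<le> \<Phi>2 x"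
    using controlled_lip_majorant[OF \<mu> \<nu> tb N \<Omega> \<mu>\<Omega> f inj f\<Omega> A2 less_imp_le[OF C]] that by blast

  obtain W where W: "open W" "f ` \<Omega> \<subseteq> W" "\<nu> W \<le> \<nu> (f ` \<Omega>) + ennreal 1"
    using metric_measure_open_superset[OF \<nu>, of 1] by auto
  have "\<nu> W < top" using W(3) f\<Omega> by (simp add: le_less_trans)
  then obtain w where w: "\<nu> W = ennreal w" "0 \<le> w" by (cases "\<nu> W" rule: ennreal_cases) auto

  have "\<exists>g. g \<in> borel_measurable borel \<and> (\<integral>\<^sup>+x. g x \<partial>?M) \<le> ennreal (1 * (1/2)^Suc n) \<and>
    (\<forall>c T. c \<in> curves_in \<Omega> \<longrightarrow> (1/2)^n \<le> fst c \<longrightarrow> T \<subseteq> {0..fst c} \<longrightarrow> snd c ` T \<subseteq> Z \<longrightarrow>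
       leb_outer (curve_dist f c ` T) \<le> curve_integral g c)" for n
  proof -
    \<comment> \<open>\<open>K\<close> is chosen to bring \<open>2 * K * (N * w)\<close> below
      \<open>(1/2)^Suc n\<close>, which is possible because points of \<open>Z\<close> are
      controlled with every positive constant. The summand 1 covers \<open>w = 0\<close>.\<close>
    define d where "d = 2 * real N * w + 1"
    define K where "K = (1/2)^Suc n / d"
    have d: "0 < d" using w by (simp add: d_def add_nonneg_pos)
    then have "0 < K" by (simp add: K_def)
    have "2 * K * (real N * w) = (1/2)^Suc n * ((2 * real N * w) / d)" by (simp add: K_def)
    also have "\<dots> \<le> (1/2)^Suc n * 1" using d by (intro mult_left_mono) (auto simp: d_def)
    finally have K: "0 < K" "2 * K * (real N * w) \<le> (1/2)^Suc n" using \<open>0 < K\<close> by simp_all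
    have "f ` Z \<subseteq> W" using W Z by blast
    from controlled_curve_weight[OF \<mu> \<nu> tb N Z(1) Z(2)[OF _ K(1)] less_imp_le[OF K(1)] W(1) this, of "(1/2)^n"]
    obtain g where g: "g \<in> borel_measurable borel"
      "(\<integral>\<^sup>+x. g x \<partial>?M) \<le> ennreal (2 * K) * (of_nat N * \<nu> W)"
      "\<forall>c T. c \<in> curves_in \<Omega> \<longrightarrow> (1/2)^n \<le> fst c \<longrightarrow> T \<subseteq> {0..fst c} \<longrightarrow> snd c ` T \<subseteq> Z \<longrightarrow>
       leb_outer (curve_dist f c ` T) \<le> curve_integral g c"
      by auto
    note g(2)
    also have "ennreal (2 * K) * (of_nat N * \<nu> W) = ennreal (2 * K * (real N * w))"
      using K w by (simp add: ennreal_mult ennreal_of_nat_eq_real_of_nat)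
    also have "\<dots> \<le> ennreal (1 * (1/2)^Suc n)" using K by (intro ennreal_leI) simp
    finally show ?thesis using g(1,3) by blast
  qed
  then obtain g where g: "\<And>n. g n \<in> borel_measurable borel" "\<And>n. (\<integral>\<^sup>+x. g n x \<partial>?M) \<le> ennreal (1 * (1/2)^Suc n)"
    "\<And>n c T. c \<in> curves_in \<Omega> \<Longrightarrow> (1/2)^n \<le> fst c \<Longrightarrow> T \<subseteq> {0..fst c} \<Longrightarrow> snd c ` T \<subseteq> Z \<Longrightarrow>
       leb_outer (curve_dist f c ` T) \<le> curve_integral (g n) c"
    by metis

  have "{c \<in> curves_in \<Omega>. hausdorff1 (f ` (curve_image c \<inter> E)) > 0} \<subseteq> Collect is_curve"
    by (auto simp: curves_in_def)
  from Mod1_null_weight[OF \<mu> this assms(22)]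
  obtain \<rho> where \<rho>: "\<rho> \<in> borel_measurable borel" "(\<integral>\<^sup>+x. \<rho> x \<partial>?M) < \<infinity>"
    "\<And>c. c \<in> curves_in \<Omega> \<Longrightarrow> 0 < hausdorff1 (f ` (curve_image c \<inter> E)) \<Longrightarrow> curve_integral \<rho> c = \<infinity>"
    by blast

  \<comment> \<open>The last two summands force infinite weight on curves whose parts in
    \<open>Z\<close> or \<open>E\<close> have an image that is not null. The 4 is that of
    \<open>curve_image_le_lip_integral\<close>.\<close>
  define G where "G x = 4 * (\<Phi>1 x + \<Phi>2 x) + ((\<Sum>n. g n x) + \<rho> x)" for x
  have G_meas: "G \<in> borel_measurable borel"
    unfolding G_def using \<Phi>1(1) \<Phi>2(1) g(1) \<rho>(1) by measurable
  note bm = metric_measure_borel_measurable[OF \<mu>]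
  have ind_meas: "(\<lambda>x. u x * indicator \<Omega> x) \<in> borel_measurable ?M" if "u \<in> borel_measurable borel" for u :: "'a \<Rightarrow> ennreal"
    using that \<Omega> by (intro bm borel_measurable_times borel_measurable_indicator) auto
  have G_int: "(\<integral>\<^sup>+x\<in>\<Omega>. G x \<partial>?M) < \<infinity>"
  proof -
    have sum_meas: "(\<lambda>x. \<Sum>n. g n x) \<in> borel_measurable borel" using g(1) by measurable
    have "(\<integral>\<^sup>+x\<in>\<Omega>. G x \<partial>?M) \<le> (\<integral>\<^sup>+x. 4 * (\<Phi>1 x * indicator \<Omega> x + \<Phi>2 x * indicator \<Omega> x) + ((\<Sum>n. g n x) + \<rho> x) \<partial>?M)"
      by (intro nn_integral_mono) (simp add: G_def split: split_indicator)
    also have "\<dots> = (\<integral>\<^sup>+x. 4 * (\<Phi>1 x * indicator \<Omega> x + \<Phi>2 x * indicator \<Omega> x) \<partial>?M) + (\<integral>\<^sup>+x. (\<Sum>n. g n x) + \<rho> x \<partial>?M)"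
      using ind_meas[OF \<Phi>1(1)] ind_meas[OF \<Phi>2(1)] bm[OF sum_meas] bm[OF \<rho>(1)]
      by (intro nn_integral_add) auto
    also have "(\<integral>\<^sup>+x. 4 * (\<Phi>1 x * indicator \<Omega> x + \<Phi>2 x * indicator \<Omega> x) \<partial>?M)
        = 4 * ((\<integral>\<^sup>+x\<in>\<Omega>. \<Phi>1 x \<partial>?M) + (\<integral>\<^sup>+x\<in>\<Omega>. \<Phi>2 x \<partial>?M))"
      using ind_meas[OF \<Phi>1(1)] ind_meas[OF \<Phi>2(1)]
      by (subst nn_integral_cmult, simp, subst nn_integral_add) auto
    also have "(\<integral>\<^sup>+x. (\<Sum>n. g n x) + \<rho> x \<partial>?M) = (\<Sum>n. \<integral>\<^sup>+x. g n x \<partial>?M) + (\<integral>\<^sup>+x. \<rho> x \<partial>?M)"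
      using bm[OF g(1)] bm[OF sum_meas] bm[OF \<rho>(1)] by (simp add: nn_integral_add nn_integral_suminf)
    also have "(\<Sum>n. \<integral>\<^sup>+x. g n x \<partial>?M) \<le> (\<Sum>n. ennreal (1 * (1/2)^Suc n))"
      using g(2) by (intro suminf_le) auto
    also have "\<dots> = ennreal 1" by (rule suminf_half_powers) simp
    finally have "(\<integral>\<^sup>+x\<in>\<Omega>. G x \<partial>?M) \<le> 4 * ((\<integral>\<^sup>+x\<in>\<Omega>. \<Phi>1 x \<partial>?M) + (\<integral>\<^sup>+x\<in>\<Omega>. \<Phi>2 x \<partial>?M)) + (ennreal 1 + (\<integral>\<^sup>+x. \<rho> x \<partial>?M))"
      by (simp add: add_left_mono add_right_mono)
    also have "\<dots> < \<infinity>" using \<Phi>1(2) \<Phi>2(2) \<rho>(2) by (simp add: ennreal_mult_less_top)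
    finally show ?thesis .
  qed

  \<comment> \<open>\<open>T\<close> is arbitrary so that the estimate serves twice: for whole
    curves in the Dirichlet space, and for the part of a curve outside \<open>A1\<close> in
    \<open>in_DBV\<close>.\<close>
  have main: "leb_outer (curve_dist f c ` T) \<le> curve_integral G c"
    if c: "c \<in> curves_in \<Omega>" and T: "T \<subseteq> {0..fst c}" "\<And>s. s \<in> T \<Longrightarrow> snd c s \<in> E \<union> S2 \<or> ?lip (snd c s) = 0" for c T
  \<comment> \<open>Curves of length 0 are set apart, because the weights \<open>g n\<close> apply
    only to curves of length at least \<open>(1/2)^n\<close>.\<close>
  proof (cases "curve_integral G c = \<infinity> \<or> fst c \<le> 0")
    case True
    show ?thesis
    proof (cases "curve_integral G c = \<infinity>")
      case False
      with True T(1) have "T \<subseteq> {0}" by auto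
      then have "curve_dist f c ` T \<subseteq> {0..0}" by (auto simp: curve_dist_def)
      then have "leb_outer (curve_dist f c ` T) \<le> ennreal 0" by (rule leb_outer_Icc_le) auto
      then show ?thesis by simp
    qed simp
  next
    case False
    then have fin: "curve_integral G c < \<infinity>" and l: "0 < fst c" by (auto simp: less_top)
    have cc: "is_curve c" using c by (simp add: curves_in_def)
    have split: "curve_integral G c = 4 * curve_integral (\<lambda>x. \<Phi>1 x + \<Phi>2 x) c
      + (curve_integral (\<lambda>x. \<Sum>n. g n x) c + curve_integral \<rho> c)"
    proof -
      have m: "(\<lambda>x. 4 * (\<Phi>1 x + \<Phi>2 x)) \<in> borel_measurable borel" "(\<lambda>x. \<Phi>1 x + \<Phi>2 x) \<in> borel_measurable borel"
        "(\<lambda>x. \<Sum>n. g n x) \<in> borel_measurable borel" "(\<lambda>x. (\<Sum>n. g n x) + \<rho> x) \<in> borel_measurable borel"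
        using \<Phi>1(1) \<Phi>2(1) g(1) \<rho>(1) by measurable
      show ?thesis
        unfolding G_def curve_integral_add[OF cc m(1,4)] curve_integral_add[OF cc m(3) \<rho>(1)]
          curve_integral_cmult[OF cc m(2)] ..
    qed
    define TE where "TE = {s\<in>T. snd c s \<in> E}"
    define TZ where "TZ = {s\<in>T. snd c s \<in> Z}"
    define TL where "TL = {s\<in>T. (snd c s \<in> S2 \<or> ?lip (snd c s) = 0) \<and> ?lip (snd c s) < \<infinity>}"
    have "T \<subseteq> TE \<union> (TZ \<union> TL)"
    proof
      fix s assume s: "s \<in> T"
      show "s \<in> TE \<union> (TZ \<union> TL)"
      proof (cases "?lip (snd c s) < \<infinity>")
        case True
        then show ?thesis using T(2)[OF s] s by (auto simp: TE_def TL_def)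
      next
        case False
        then have "?lip (snd c s) = \<infinity>" by (metis infinity_ennreal_def top.not_eq_extremum)
        then show ?thesis using T(2)[OF s] s by (auto simp: TE_def TZ_def Z_def)
      qed
    qed
    then have "curve_dist f c ` T \<subseteq> curve_dist f c ` TE \<union> (curve_dist f c ` TZ \<union> curve_dist f c ` TL)" by blast
    then have "leb_outer (curve_dist f c ` T) \<le> leb_outer (curve_dist f c ` TE \<union> (curve_dist f c ` TZ \<union> curve_dist f c ` TL))"
      by (rule outer_measure_of_mono)
    also have "\<dots> \<le> leb_outer (curve_dist f c ` TE) + (leb_outer (curve_dist f c ` TZ) + leb_outer (curve_dist f c ` TL))"
      by (rule order_trans[OF leb_outer_Un_le add_left_mono[OF leb_outer_Un_le]])
    also have "leb_outer (curve_dist f c ` TE) = 0"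
    proof -
      have "curve_integral \<rho> c < \<infinity>" using fin unfolding split by simp
      then have "hausdorff1 (f ` (curve_image c \<inter> E)) = 0"
        using \<rho>(3)[OF c] by (metis less_irrefl not_gr_zero)
      then have "leb_outer (dist (f (snd c 0)) ` (f ` (curve_image c \<inter> E))) = 0"
        by (rule hausdorff1_null_imp_leb_outer_null)
      moreover have "curve_dist f c ` TE \<subseteq> dist (f (snd c 0)) ` (f ` (curve_image c \<inter> E))"
        using T(1) by (auto simp: curve_dist_def TE_def curve_image_def)
      ultimately show ?thesis using outer_measure_of_mono[of "curve_dist f c ` TE" _ lborel] by (metis le_zero_eq)
    qed
    \<comment> \<open>All \<open>g n\<close> with large \<open>n\<close> dominate this same number
      on \<open>c\<close>, so if it were not 0 the series would diverge and \<open>G\<close> would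
      have infinite integral.\<close>
    also have "leb_outer (curve_dist f c ` TZ) = 0"
    proof (rule ccontr)
      assume nz: "leb_outer (curve_dist f c ` TZ) \<noteq> 0"
      obtain n0 where n0: "(1/2::real)^n0 < fst c" using real_arch_pow_inv[OF l, of "1/2"] by auto
      have "(\<Sum>n. curve_integral (g n) c) = \<infinity>"
      proof (rule suminf_eq_top_if_bounded_below[OF _ nz])
        fix n assume "n0 \<le> n"
        then have "(1/2::real)^n \<le> (1/2)^n0" by (intro power_decreasing) auto
        with n0 have "(1/2)^n \<le> fst c" by linarith
        then show "leb_outer (curve_dist f c ` TZ) \<le> curve_integral (g n) c"
          using T(1) by (intro g(3)[OF c]) (auto simp: TZ_def)
      qed
      then have "curve_integral (\<lambda>x. \<Sum>n. g n x) c = \<infinity>" by (simp add: curve_integral_suminf[OF cc g(1)])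
      then show False using fin unfolding split by simp
    qed
    also have "leb_outer (curve_dist f c ` TL) \<le> 4 * curve_integral (\<lambda>x. \<Phi>1 x + \<Phi>2 x) c"
    proof (rule curve_image_le_lip_integral[OF c])
      show "(\<lambda>x. \<Phi>1 x + \<Phi>2 x) \<in> borel_measurable borel" using \<Phi>1(1) \<Phi>2(1) by measurable
      show "TL \<subseteq> {0..fst c}" using T(1) by (auto simp: TL_def)
      fix s assume "s \<in> TL"
      then have s: "snd c s \<in> S2 \<or> ?lip (snd c s) = 0" and lf: "?lip (snd c s) < \<infinity>" by (auto simp: TL_def)
      then show "?lip (snd c s) < \<infinity>" by simp
      consider "?lip (snd c s) = 0" | "snd c s \<in> A2" | "snd c s \<in> S2 - A2" using s by blast
      then show "?lip (snd c s) \<le> \<Phi>1 (snd c s) + \<Phi>2 (snd c s)"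
      proof cases
        case 1 then show ?thesis by simp
      next
        case 2
        then have "?lip (snd c s) \<le> \<Phi>2 (snd c s)" using \<Phi>2(3) lf by blast
        then show ?thesis by (simp add: add_increasing)
      next
        case 3
        then have "?lip (snd c s) \<le> \<Phi>1 (snd c s)" using lip_A2 \<Phi>1(3) by (meson DiffD1 order_trans)
        then show ?thesis by (simp add: add_increasing2)
      qed
    qed
    finally have "leb_outer (curve_dist f c ` T) \<le> 4 * curve_integral (\<lambda>x. \<Phi>1 x + \<Phi>2 x) c"
      by (simp add: add_left_mono)
    also have "\<dots> \<le> curve_integral G c" unfolding split by simp
    finally show ?thesis .
  qed

  \<comment> \<open>Membership in the Dirichlet space\<close>
  have "in_D1 \<mu> (S2 \<union> E) f"
  proof -
    \<comment> \<open>Measurability is transferred for \<open>S1\<close>: off \<open>E\<close> the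
      volume hypothesis makes \<open>\<mu>'\<close> locally finite, while near points of
      \<open>E\<close> this is not given. The desired set is the complement of \<open>S1\<close> in
      \<open>\<Omega>\<close>.\<close>
    have "S1 \<in> sets ?M"
    proof (rule sets_caratheodory_transfer[OF \<mu> \<mu>' \<Omega> tb])
      show "\<mu> A \<le> \<mu>' A" if "A \<subseteq> \<Omega>" for A using assms(10) that by blast
      have sp: "space ?M' = \<Omega>" by (rule space_caratheodory[OF \<mu>'])
      have OE: "\<Omega> - E \<in> sets ?M'" using assms(13) sets.compl_sets[of E ?M'] by (simp add: sp)
      have "{x\<in>space (restrict_space ?M' (\<Omega> - E)). Q x = 1} \<in> sets (restrict_space ?M' (\<Omega> - E))"
        using assms(18) by measurable
      moreover have "{x\<in>space (restrict_space ?M' (\<Omega> - E)). Q x = 1} = S1"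
        by (auto simp: S1_def space_restrict_space sp)
      ultimately show "S1 \<in> sets ?M'"
        using OE sets_restrict_space_iff[of "\<Omega> - E" ?M' S1] by (simp add: sp Int_absorb2 Diff_subset inf.absorb1)
      fix x assume x: "x \<in> S1"
      then have "x \<in> \<Omega> - E" by (simp add: S1_def)
      from less_le_trans[OF bspec[OF assms(21) this] top_greatest]
      have "Limsup (at_right 0) (\<lambda>r. \<mu>' (ball x r \<inter> \<Omega>) / ennreal (r powr Q x)) < top" .
      from Limsup_lessD[OF this] obtain b where b: "0 < b"
        "\<And>r. 0 < r \<Longrightarrow> r < b \<Longrightarrow> \<mu>' (ball x r \<inter> \<Omega>) / ennreal (r powr Q x) < top"
        by (auto simp: eventually_at_right_field)
      have "\<mu>' (ball x (b / 2) \<inter> \<Omega>) / ennreal ((b / 2) powr Q x) < top" using b by auto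
      then have "\<mu>' (ball x (b / 2) \<inter> \<Omega>) \<noteq> \<infinity>" by (auto simp: ennreal_top_divide)
      then show "\<exists>r>0. \<mu>' (ball x r \<inter> \<Omega>) < \<infinity>" using b(1) by (intro exI[of _ "b / 2"]) (auto simp: less_top)
    qed
    moreover have "\<Omega> \<in> sets ?M" using \<Omega> by (intro metric_measure_borel[OF \<mu>]) auto
    moreover have "S2 \<union> E = \<Omega> - S1" using E\<Omega> assms(16) by (force simp: S1_def S2_def)
    ultimately have H: "S2 \<union> E \<in> sets ?M" by auto
    moreover have "upper_gradient (S2 \<union> E) f G"
      unfolding upper_gradient_def
    proof
      show "G \<in> borel_measurable (restrict_space borel (S2 \<union> E))"
        using G_meas by (rule measurable_restrict_space1)
      show "\<forall>c\<in>curves_in (S2 \<union> E). end_dist f c \<le> curve_integral G c"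
      proof
        fix c assume c: "c \<in> curves_in (S2 \<union> E)"
        have "S2 \<union> E \<subseteq> \<Omega>" using E\<Omega> by (auto simp: S2_def)
        then have c': "c \<in> curves_in \<Omega>" using c by (auto simp: curves_in_def)
        have "end_dist f c \<le> leb_outer (curve_dist f c ` {0..fst c})" by (rule end_dist_le_leb_outer[OF f c'])
        also have "\<dots> \<le> curve_integral G c"
        proof (rule main[OF c' order_refl])
          fix s assume "s \<in> {0..fst c}"
          then have "snd c s \<in> curve_image c" by (simp add: curve_image_def)
          then show "snd c s \<in> E \<union> S2 \<or> ?lip (snd c s) = 0" using c by (auto simp: curves_in_def)
        qed
        finally show "end_dist f c \<le> curve_integral G c" .
      qed
    qed
    moreover have "(\<integral>\<^sup>+x\<in>S2 \<union> E. G x \<partial>?M) < \<infinity>"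
    proof -
      have "(\<integral>\<^sup>+x\<in>S2 \<union> E. G x \<partial>?M) \<le> (\<integral>\<^sup>+x\<in>\<Omega>. G x \<partial>?M)"
        using E\<Omega> by (intro nn_integral_mono) (auto simp: S2_def split: split_indicator)
      also note G_int
      finally show ?thesis .
    qed
    ultimately show ?thesis unfolding in_D1_def by blast
  qed

  \<comment> \<open>The sequence of weights for the points with \<open>Q = 1\<close>\<close>
  moreover have "in_DBV \<mu> \<Omega> f"
  proof -
    \<comment> \<open>At these points the constant of control is fixed, so the weights stay bounded
      but need not become small, and unlike those for \<open>Z\<close> they are not summed into one
      function.\<close>
    define B where "B = ennreal (2 * max 0 (C * H)) * (of_nat N * \<nu> W)"
    have fA1: "f ` A1 \<subseteq> W" using A1(1) W(2) by blast
    have "\<exists>g. g \<in> borel_measurable borel \<and> (\<integral>\<^sup>+x. g x \<partial>?M) \<le> B \<and>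
      (\<forall>c T. c \<in> curves_in \<Omega> \<longrightarrow> (1/2)^i \<le> fst c \<longrightarrow> T \<subseteq> {0..fst c} \<longrightarrow> snd c ` T \<subseteq> A1 \<longrightarrow>
         leb_outer (curve_dist f c ` T) \<le> curve_integral g c)" for i
      unfolding B_def
      by (rule controlled_curve_weight[OF \<mu> \<nu> tb N A1 _ W(1) fA1]) auto
    then obtain k where k: "\<And>i. k i \<in> borel_measurable borel" "\<And>i. (\<integral>\<^sup>+x. k i x \<partial>?M) \<le> B"
      "\<And>i c T. c \<in> curves_in \<Omega> \<Longrightarrow> (1/2)^i \<le> fst c \<Longrightarrow> T \<subseteq> {0..fst c} \<Longrightarrow> snd c ` T \<subseteq> A1 \<Longrightarrow>
         leb_outer (curve_dist f c ` T) \<le> curve_integral (k i) c"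
      by metis
    have B: "B < \<infinity>" using w by (simp add: B_def ennreal_mult_less_top ennreal_of_nat_eq_real_of_nat)
    have Gk: "(\<lambda>x. G x + k i x) \<in> borel_measurable borel" for i using G_meas k(1) by measurable
    have "(SUP i. \<integral>\<^sup>+x\<in>\<Omega>. (G x + k i x) \<partial>?M) \<le> (\<integral>\<^sup>+x\<in>\<Omega>. G x \<partial>?M) + B"
    proof (rule SUP_least)
      fix i
      have "(\<integral>\<^sup>+x\<in>\<Omega>. (G x + k i x) \<partial>?M) \<le> (\<integral>\<^sup>+x. G x * indicator \<Omega> x + k i x \<partial>?M)"
        by (intro nn_integral_mono) (simp split: split_indicator)
      also have "\<dots> = (\<integral>\<^sup>+x\<in>\<Omega>. G x \<partial>?M) + (\<integral>\<^sup>+x. k i x \<partial>?M)"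
        using ind_meas[OF G_meas] bm[OF k(1)] by (intro nn_integral_add) auto
      also have "\<dots> \<le> (\<integral>\<^sup>+x\<in>\<Omega>. G x \<partial>?M) + B" using k(2) by (rule add_left_mono)
      finally show "(\<integral>\<^sup>+x\<in>\<Omega>. (G x + k i x) \<partial>?M) \<le> (\<integral>\<^sup>+x\<in>\<Omega>. G x \<partial>?M) + B" .
    qed
    also have "\<dots> < \<infinity>" using G_int B by simp
    finally have bdd: "(SUP i. \<integral>\<^sup>+x\<in>\<Omega>. (G x + k i x) \<partial>?M) < \<infinity>" .
    have curves: "end_dist f c \<le> liminf (\<lambda>i. curve_integral (\<lambda>x. G x + k i x) c)" if c: "c \<in> curves_in \<Omega>" for c
    proof (cases "0 < fst c")
      case False
      then have "fst c = 0" using c by (simp add: curves_in_def is_curve_def)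
      then show ?thesis by (simp add: end_dist_def)
    next
      case True
      have cc: "is_curve c" using c by (simp add: curves_in_def)
      obtain n0 where n0: "(1/2::real)^n0 < fst c" using real_arch_pow_inv[OF True, of "1/2"] by auto
      \<comment> \<open>Points with \<open>Q = 1\<close> and vanishing Lipschitz constant go to
        \<open>T\<close>, where \<open>main\<close> treats them; the remaining ones form
        \<open>A1\<close>.\<close>
      define T where "T = {s\<in>{0..fst c}. snd c s \<in> E \<union> S2 \<or> ?lip (snd c s) = 0}"
      define T1 where "T1 = {s\<in>{0..fst c}. snd c s \<in> A1}"
      have all: "{0..fst c} \<subseteq> T \<union> T1"
      proof
        fix s assume s: "s \<in> {0..fst c}"
        then have "snd c s \<in> \<Omega>" using c by (auto simp: curves_in_def curve_image_def)
        then have "snd c s \<in> E \<or> snd c s \<in> S2 \<or> snd c s \<in> S1" using assms(16) by (force simp: S1_def S2_def)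
        with s show "s \<in> T \<union> T1" by (auto simp: T_def T1_def A1_def)
      qed
      have "end_dist f c \<le> curve_integral (\<lambda>x. G x + k i x) c" if "n0 \<le> i" for i
      proof -
        have "(1/2::real)^i \<le> (1/2)^n0" using that by (intro power_decreasing) auto
        with n0 have i: "(1/2)^i \<le> fst c" by linarith
        have "end_dist f c \<le> leb_outer (curve_dist f c ` {0..fst c})" by (rule end_dist_le_leb_outer[OF f c])
        also have "\<dots> \<le> leb_outer (curve_dist f c ` T \<union> curve_dist f c ` T1)"
          using all by (intro outer_measure_of_mono) blast
        also have "\<dots> \<le> leb_outer (curve_dist f c ` T) + leb_outer (curve_dist f c ` T1)" by (rule leb_outer_Un_le)
        also have "\<dots> \<le> curve_integral G c + curve_integral (k i) c"
          by (intro add_mono main[OF c] k(3)[OF c i]) (auto simp: T_def T1_def)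
        also have "\<dots> = curve_integral (\<lambda>x. G x + k i x) c"
          by (rule curve_integral_add[OF cc G_meas k(1), symmetric])
        finally show ?thesis .
      qed
      then have "eventually (\<lambda>i. end_dist f c \<le> curve_integral (\<lambda>x. G x + k i x) c) sequentially"
        unfolding eventually_sequentially by blast
      then show ?thesis by (rule Liminf_bounded)
    qed
    show ?thesis
      unfolding in_DBV_def
    proof (intro conjI f exI[of _ "\<lambda>i x. G x + k i x"] exI[of _ "{}"] allI ballI)
      show "(\<lambda>x. G x + k i x) \<in> borel_measurable (restrict_space borel \<Omega>)" for i
        using Gk by (rule measurable_restrict_space1)
      show "(SUP i. \<integral>\<^sup>+x\<in>\<Omega>. (G x + k i x) \<partial>?M) < \<infinity>" by (rule bdd)
      show "AM \<mu> {} = 0" by (rule AM_empty)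
      show "end_dist f c \<le> liminf (\<lambda>i. curve_integral (\<lambda>x. G x + k i x) c)" if "c \<in> curves_in \<Omega> - {}" for c
        using curves that by simp
    qed
  qed
  ultimately show ?thesis unfolding S2_def by blast
qed

end
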